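(* Let $d\in\mathbb{N}$, $d\geq3$, let $\beta\in(1,2)$ be the $d$-Bonacci number, and let $h\in\{1,2,\dots,d-1\}$. Put $$\mathcal{L}_h=\Bigl([h]\cap\bigl[1-\tfrac\beta2,\tfrac12\bigr)\Bigr)\cup\Bigl([h-d]\cap\bigl[-\tfrac12,\tfrac\beta2-1\bigr)\Bigr),$$ where $[j]=j+(\beta-1)\mathbb{Z}[\beta]$. Then the collection of tiles $\{\mathcal{R}(x): x\in\mathcal{L}_h\}$ forms a tiling of $\mathbb{R}^{d-1}$ (i.e., it is a layer of the multiple tiling $\{\mathcal{R}(x)\}_{x\in\mathbb{Z}[\beta]\cap X_S}$, which has covering degree $d-1$).
   Context: The $d$-Bonacci number is the Pisot number $\beta\in(1,2)$ satisfying $\beta^d=\beta^{d-1}+\dots+\beta+1$; it is an algebraic unit of degree $d$. Let $X_S=[-\tfrac12,\tfrac\beta2-1)\cup[1-\tfrac\beta2,\tfrac12)$ and $T_S\colon X_S\to X_S$, $T_S(x)=\beta x-\lfloor\beta x-\tfrac12\rfloor$. Let $\beta_{(1)},\dots,\beta_{(e)}$ (together with their complex conjugates) be the non-real Galois conjugates of $\beta$ and $\beta_{(e+1)},\dots,\beta_{(d-e-1)}$ the real Galois conjugates other than $\beta$, with field isomorphisms $\sigma_{(j)}\colon\mathbb{Q}(\beta)\to\mathbb{Q}(\beta_{(j)})$; define $\Phi\colon\mathbb{Q}(\beta)\to\mathbb{C}^e\times\mathbb{R}^{d-2e-1}\cong\mathbb{R}^{d-1}$, $\Phi(x)=(\sigma_{(1)}(x),\dots,\sigma_{(d-e-1)}(x))$.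 For $x\in\mathbb{Z}[\beta]\cap X_S$, $\mathcal{R}(x)$ is the Hausdorff limit $\lim_{n\to\infty}\Phi(\beta^nT_S^{-n}(x))$, $T_S^{-n}(x)$ being the set of preimages of $x$ in $X_S$. A collection of sets forms a tiling of $\mathbb{R}^{d-1}$ if its members take finitely many shapes up to translation, it is locally finite, covers $\mathbb{R}^{d-1}$, each member is the closure of its interior, and almost every point of $\mathbb{R}^{d-1}$ lies in exactly one member.
   Formalization: The transformation is taken as T_S(x) = βx − ⌊βx + 1/2⌋; with the printed ⌊βx − 1/2⌋ its values lie in [1/2, 3/2), outside X_S, so T_S would not map X_S to itself and all preimage sets would be empty. *)

theory Defs
  imports "HOL-Analysis.Analysis" "HOL-Computational_Algebra.Computational_Algebra"
begin

section \<open>The base and its conjugates\<close>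

text \<open>The equation has a unique solution in the interval (1,2), and this solution is a Pisot
  unit of degree \<open>d\<close>; these properties are consequences and not part of the definition.\<close>

definition dBonacci :: "nat \<Rightarrow> real \<Rightarrow> bool" where
  "dBonacci d \<beta> \<longleftrightarrow> 1 < \<beta> \<and> \<beta> < 2 \<and> \<beta> ^ d = (\<Sum>i<d. \<beta> ^ i)"

definition int_adjoin :: "real \<Rightarrow> real set" where
  "int_adjoin \<beta> = {poly (map_poly of_int p) \<beta> | p :: int poly. True}"

definition rat_field_adjoin :: "'a::field_char_0 \<Rightarrow> 'a set" where
  "rat_field_adjoin b =
     {poly (map_poly of_rat p) b / poly (map_poly of_rat q) b | p q :: rat poly.
        poly (map_poly of_rat q) b \<noteq> 0}"

text \<open>An irreducible rational polynomial vanishing at \<open>\<beta>\<close> is, up to a constant factor, the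
  minimal polynomial of \<open>\<beta>\<close>. In particular \<open>\<beta>\<close> counts as a conjugate of itself.\<close>

definition galois_conjugate :: "real \<Rightarrow> complex \<Rightarrow> bool" where
  "galois_conjugate \<beta> z \<longleftrightarrow>
     (\<exists>p :: rat poly. irreducible p \<and> poly (map_poly of_rat p) \<beta> = 0 \<and>
        poly (map_poly of_rat p) z = 0)"

text \<open>The numbers \<open>\<gamma> 1, \<dots>, \<gamma> e\<close> are one representative of each pair of non-real conjugates,
  and \<open>\<gamma> (e + 1), \<dots>, \<gamma> (d - e - 1)\<close> are the real conjugates other than \<open>\<beta>\<close>.\<close>

definition conjugate_enumeration :: "nat \<Rightarrow> real \<Rightarrow> nat \<Rightarrow> (nat \<Rightarrow> complex) \<Rightarrow> bool" where
  "conjugate_enumeration d \<beta> e \<gamma> \<longleftrightarrow>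
     2 * e < d \<and> inj_on \<gamma> {1..d - e - 1} \<and>
     \<gamma> ` {1..e} \<inter> cnj ` \<gamma> ` {1..e} = {} \<and>
     \<gamma> ` {1..e} \<union> cnj ` \<gamma> ` {1..e} = {z. galois_conjugate \<beta> z \<and> z \<notin> \<real>} \<and>
     \<gamma> ` {e + 1..d - e - 1} = {z. galois_conjugate \<beta> z \<and> z \<in> \<real> \<and> z \<noteq> of_real \<beta>}"

definition field_iso_on :: "'a::field set \<Rightarrow> 'b::field set \<Rightarrow> ('a \<Rightarrow> 'b) \<Rightarrow> bool" where
  "field_iso_on K L f \<longleftrightarrow>
     bij_betw f K L \<and> f 1 = 1 \<and>
     (\<forall>x\<in>K. \<forall>y\<in>K. f (x + y) = f x + f y \<and> f (x * y) = f x * f y)"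

text \<open>The identification of \<open>\<complex>\<^sup>e \<times> \<real>\<^bsup>d-2e-1\<^esup>\<close> with \<open>\<real>\<^bsup>d-1\<^esup>\<close>: the numbering \<open>\<iota>\<close> of the
  coordinates by \<open>{1..d - 1}\<close> lists first the real parts and then the imaginary parts of the
  \<open>e\<close> complex components, followed by the \<open>d - 2e - 1\<close> real components.\<close>

definition embed ::
    "nat \<Rightarrow> (nat \<Rightarrow> real \<Rightarrow> complex) \<Rightarrow> ('n::finite \<Rightarrow> nat) \<Rightarrow> real \<Rightarrow> real ^ 'n" where
  "embed e \<sigma> \<iota> x = (\<chi> i.
     if \<iota> i \<le> e then Re (\<sigma> (\<iota> i) x)
     else if \<iota> i \<le> 2 * e then Im (\<sigma> (\<iota> i - e) x)
     else Re (\<sigma> (\<iota> i - e) x))"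

section \<open>The symmetric beta-transformation\<close>

definition XS_neg :: "real \<Rightarrow> real set" where
  "XS_neg \<beta> = {-1/2..<\<beta>/2 - 1}"

definition XS_pos :: "real \<Rightarrow> real set" where
  "XS_pos \<beta> = {1 - \<beta>/2..<1/2}"

definition XS :: "real \<Rightarrow> real set" where
  "XS \<beta> = XS_neg \<beta> \<union> XS_pos \<beta>"

text \<open>The subtracted integer is the one for which the value lies in \<open>[-1/2, 1/2)\<close>, as is
  necessary for a map from \<open>XS \<beta>\<close> to itself. (With \<open>\<beta> * x - 1/2\<close> under the floor, the
  values would lie in \<open>[1/2, 3/2)\<close>, outside \<open>XS \<beta>\<close>.)\<close>

definition TS :: "real \<Rightarrow> real \<Rightarrow> real" where
  "TS \<beta> x = \<beta> * x - of_int \<lfloor>\<beta> * x + 1/2\<rfloor>"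

definition TS_preimage :: "real \<Rightarrow> nat \<Rightarrow> real \<Rightarrow> real set" where
  "TS_preimage \<beta> n x = {y \<in> XS \<beta>. (TS \<beta> ^^ n) y = x}"

section \<open>Tiles\<close>

definition hausdorff_tendsto :: "(nat \<Rightarrow> 'a::metric_space set) \<Rightarrow> 'a set \<Rightarrow> bool" where
  "hausdorff_tendsto A K \<longleftrightarrow>
     (\<forall>\<epsilon>>0. \<forall>\<^sub>F n in sequentially.
        (\<forall>a\<in>A n. \<exists>k\<in>K. dist a k < \<epsilon>) \<and> (\<forall>k\<in>K. \<exists>a\<in>A n. dist a k < \<epsilon>))"

text \<open>Compactness (in fact closedness) makes the limit unique.\<close>

definition hausdorff_lim :: "(nat \<Rightarrow> 'a::metric_space set) \<Rightarrow> 'a set" where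
  "hausdorff_lim A = (THE K. compact K \<and> hausdorff_tendsto A K)"

definition tile ::
    "real \<Rightarrow> nat \<Rightarrow> (nat \<Rightarrow> real \<Rightarrow> complex) \<Rightarrow> ('n::finite \<Rightarrow> nat) \<Rightarrow> real \<Rightarrow> (real ^ 'n) set" where
  "tile \<beta> e \<sigma> \<iota> x =
     hausdorff_lim (\<lambda>n. (\<lambda>y. embed e \<sigma> \<iota> (\<beta> ^ n * y)) ` TS_preimage \<beta> n x)"

section \<open>Tilings\<close>

text \<open>Collections are indexed families, so that members are counted with multiplicity. For
  \<open>m > 0\<close>, the condition on \<open>card\<close> includes finiteness.\<close>

definition multiple_tiling :: "nat \<Rightarrow> 'i set \<Rightarrow> ('i \<Rightarrow> 'a::euclidean_space set) \<Rightarrow> bool" where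
  "multiple_tiling m I R \<longleftrightarrow>
     (\<exists>\<S>. finite \<S> \<and> (\<forall>i\<in>I. \<exists>S\<in>\<S>. \<exists>t. R i = (\<lambda>s. t + s) ` S)) \<and>
     (\<forall>z. \<exists>U. open U \<and> z \<in> U \<and> finite {i \<in> I. R i \<inter> U \<noteq> {}}) \<and>
     (\<Union>i\<in>I. R i) = UNIV \<and>
     (\<forall>i\<in>I. R i = closure (interior (R i))) \<and>
     (AE z in lborel. card {i \<in> I. z \<in> R i} = m)"

definition tiling :: "'i set \<Rightarrow> ('i \<Rightarrow> 'a::euclidean_space set) \<Rightarrow> bool" where
  "tiling I R \<longleftrightarrow> multiple_tiling 1 I R"

definition residue_class :: "real \<Rightarrow> int \<Rightarrow> real set" where
  "residue_class \<beta> j = {of_int j + (\<beta> - 1) * z | z. z \<in> int_adjoin \<beta>}"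

definition layer_index :: "nat \<Rightarrow> real \<Rightarrow> nat \<Rightarrow> real set" where
  "layer_index d \<beta> h =
     (residue_class \<beta> (int h) \<inter> XS_pos \<beta>) \<union> (residue_class \<beta> (int h - int d) \<inter> XS_neg \<beta>)"

end

theory Submission
  imports Defs
begin

text \<open>
  Adding 1 to the negative points of \<open>XS \<beta>\<close> conjugates \<open>TS \<beta>\<close> to the map
  \<open>v \<mapsto> \<beta> v - (\<beta> - 1) a\<close>, \<open>a = [v \<ge> 1/2]\<close>, of the interval \<open>[1 - \<beta>/2, \<beta>/2)\<close>. This map preserves
  the \<open>d - 1\<close> classes modulo \<open>(\<beta> - 1) \<int>[\<beta>]\<close>, and the layers become exactly these classes.

  The covering property is the usual consequence of the relative density of each class. To see that
  each class covers almost every point only once, follow two points whose difference is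
  \<open>(\<beta> - 1)\<close> times a subset sum of \<open>\<beta>\<^sup>-\<^sup>1, \<dots>, \<beta>\<^sup>-\<^sup>d\<close>, up to sign: such differences are preserved by the
  map, and they vanish after one of the points has read \<open>d\<close> digits 1 (and \<open>d\<close> further digits).
  Every difference in \<open>(\<beta> - 1) \<int>[\<beta>]\<close> is a chain of steps \<open>\<plusminus> (\<beta> - 1) \<beta>\<^sup>-\<^sup>i\<close>, and since
  \<open>\<beta>\<^sup>-\<^sup>i + \<beta>\<^sup>-\<^sup>j \<le> 1\<close> the steps can be ordered so as to stay in the interval. Hence a word
  with many blocks \<open>1\<^sup>d 0\<^sup>d\<close> synchronizes the finitely many neighbours of a tile, so that every tile
  contains, at every scale, a ball of comparable size that meets no other tile. This gives
  the closure property of the tiles, and the overlaps form a closed porous set, which is null.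
\<close>

section \<open>The balanced transformation and synchronization of expansions\<close>

text \<open>What makes the tracked differences stable is a coincidence of lengths. \<open>X\<close>
  has length \<beta> - 1, the factor carried by every difference inside a class, so for two points
  of a class the remaining coefficient lies strictly between -1 and 1. As the powers with exponents
  1 to d sum to 1, a subset sum either remains one after a digit or turns into minus the
  complementary subset sum. The d in the blocks has a related origin: the left end of
  \<open>X\<close> is \<beta>^-d / 2, and the right end is its mirror image under v -> 1 - v.
  Synchronizing words must have a length that is the same for all tiles, because the holes they
  produce have to be comparable. Moreover the contraction \<open>M\<close> need not be a similarity,
  so at small scales holes are compared with images of a fixed ball under powers of
  \<open>M\<close>, which keep the proportions. Finiteness of the neighbours and the covering
  property both rest on one fact: \<int>[\<beta>] is a lattice in R x R^(d-1). It is derived by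
  counting the d distinct conjugates.\<close>

definition TB :: "real \<Rightarrow> real \<Rightarrow> real" where
  "TB \<beta> v = \<beta> * v - (if v \<ge> 1/2 then \<beta> - 1 else 0)"

text \<open>The branches of \<open>TB\<close> expand by \<beta> about 0 and about 1, both outside
  this interval, and v -> 1 - v exchanges them. Hence statements on the digits 0 and 1 come in
  mirrored pairs, with \<le> against < at the half-open ends.\<close>

definition XB :: "real \<Rightarrow> real set" where
  "XB \<beta> = {1 - \<beta>/2..<\<beta>/2}"

lemma funpow_add_apply: "(f ^^ (m + n)) x = (f ^^ n) ((f ^^ m) x)"
  by (subst add.commute) (simp add: funpow_add)

text \<open>Multiplication by \<beta> lowers every exponent by one. Exponent 1 would become the
  integer 1; it is dropped here and accounted for separately in \<open>beta_val\<close>.\<close>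

definition shift_down :: "nat set \<Rightarrow> nat set" where
  "shift_down A = {i. 1 \<le> i \<and> Suc i \<in> A}"

locale bonacci =
  fixes d :: nat and \<beta> :: real
  assumes d_ge: "d \<ge> 3" and dBonacci: "dBonacci d \<beta>"
begin

abbreviation "T \<equiv> TB \<beta>"
abbreviation "X \<equiv> XB \<beta>"
abbreviation "Z\<beta> \<equiv> int_adjoin \<beta>"

definition val :: "nat set \<Rightarrow> real" where
  "val A = (\<Sum>i\<in>A. (1/\<beta>) ^ i)"

lemma beta_gt_1: "1 < \<beta>" and beta_less_2: "\<beta> < 2" and beta_pow_d: "\<beta> ^ d = (\<Sum>i<d. \<beta> ^ i)"
  using dBonacci unfolding dBonacci_def by auto

lemma beta_pos: "0 < \<beta>"
  using beta_gt_1 by simp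

lemma pow_d_two_minus: "\<beta> ^ d * (2 - \<beta>) = 1"
proof -
  have "\<beta> ^ d - 1 = (\<beta> - 1) * \<beta> ^ d"
    unfolding power_diff_1_eq beta_pow_d[symmetric] ..
  then show ?thesis by (simp add: algebra_simps)
qed

text \<open>Half of 2 - \<beta> = \<beta>^-d. It shows that a point of \<open>X\<close> at or above
  1/2 survives d divisions by \<beta> inside \<open>X\<close>.\<close>

lemma left_end_eq: "1 - \<beta>/2 = 1 / (2 * \<beta> ^ d)"
proof -
  have "2 - \<beta> = 1 / \<beta> ^ d" using pow_d_two_minus beta_pos by (simp add: eq_divide_eq mult.commute)
  then have "(2 - \<beta>) / 2 = (1 / \<beta> ^ d) / 2" by simp
  then show ?thesis by (simp add: diff_divide_distrib mult.commute)
qed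

text \<open>Division of the equation by s^d. The base s is arbitrary because the same identity,
  applied to two positive roots, later gives their uniqueness.\<close>

lemma root_sum_inverse_powers:
  fixes s :: real
  assumes "s > 0" "s ^ d = (\<Sum>i<d. s ^ i)"
  shows "(\<Sum>i\<in>{1..d}. (1/s) ^ i) = 1"
proof -
  have "s ^ d * (\<Sum>i\<in>{1..d}. (1/s) ^ i) = (\<Sum>i\<in>{1..d}. s ^ (d - i))"
    unfolding sum_distrib_left
    by (intro sum.cong) (use assms(1) in \<open>auto simp: power_diff power_one_over field_simps\<close>)
  also have "\<dots> = (\<Sum>i<d. s ^ i)"
    by (rule sum.reindex_bij_witness[of _ "\<lambda>i. d - i" "\<lambda>i. d - i"]) auto
  finally have "s ^ d * (\<Sum>i\<in>{1..d}. (1/s) ^ i) = s ^ d" using assms(2) by simp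
  then show ?thesis using assms(1) by simp
qed

lemma val_all: "val {1..d} = 1"
  unfolding val_def using beta_pos beta_pow_d by (rule root_sum_inverse_powers)

lemma val_nonneg: "0 \<le> val A"
  unfolding val_def using beta_pos by (intro sum_nonneg) auto

lemma T_in_X: assumes "v \<in> X" shows "T v \<in> X"
proof (cases "v \<ge> 1/2")
  case True
  have "\<beta> * v < \<beta> * (\<beta>/2)" "\<beta> * (1/2) \<le> \<beta> * v"
    using assms beta_pos True unfolding XB_def by auto
  moreover have "(\<beta> - 1) * (\<beta> - 2) \<le> 0"
    using beta_gt_1 beta_less_2 by (simp add: mult_nonneg_nonpos)
  then have "\<beta> * (\<beta>/2) - (\<beta> - 1) \<le> \<beta>/2" by (simp add: field_simps)
  ultimately show ?thesis using True unfolding XB_def TB_def by simp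
next
  case False
  have "1 * v \<le> \<beta> * v" using assms beta_gt_1 beta_less_2 unfolding XB_def
    by (intro mult_right_mono) auto
  moreover have "\<beta> * v < \<beta> * (1/2)" using False beta_pos by (intro mult_strict_left_mono) auto
  ultimately show ?thesis using False assms unfolding XB_def TB_def by simp
qed

lemma T_iter_in_X: "v \<in> X \<Longrightarrow> (T ^^ n) v \<in> X"
  by (induction n) (auto intro: T_in_X)

section \<open>Evolution of differences that are subset sums\<close>

lemma shift_down_subset: "A \<subseteq> {1..Suc n} \<Longrightarrow> shift_down A \<subseteq> {1..n}"
  unfolding shift_down_def by auto

lemma beta_val:
  assumes "finite A" "0 \<notin> A"
  shows "\<beta> * val A = (if 1 \<in> A then 1 else 0) + val (shift_down A)"
proof -
  have *: "\<beta> * val B = val (shift_down A)" if "B = A - {1}" for B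
  proof -
    have "\<beta> * val B = (\<Sum>i\<in>B. \<beta> * (1/\<beta>) ^ i)" unfolding val_def sum_distrib_left ..
    also have "\<dots> = (\<Sum>i\<in>shift_down A. (1/\<beta>) ^ i)"
    proof (rule sum.reindex_bij_witness[of _ Suc "\<lambda>i. i - 1"])
      fix i assume "i \<in> B"
      then have "i > 0" "i \<noteq> 1" "i \<in> A" using assms that by (auto intro: gr0I)
      then show "Suc (i - 1) = i" "i - 1 \<in> shift_down A" "(1/\<beta>) ^ (i - 1) = \<beta> * (1/\<beta>) ^ i"
        using beta_pos unfolding shift_down_def by (cases i; auto)+
    next
      fix i assume "i \<in> shift_down A"
      then show "Suc i - 1 = i" "Suc i \<in> B" using that unfolding shift_down_def by auto
    qed
    finally show ?thesis unfolding val_def .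
  qed
  show ?thesis
  proof (cases "1 \<in> A")
    case True
    then have "val A = 1/\<beta> + val (A - {1})"
      using assms unfolding val_def by (subst sum.remove[of _ 1]) auto
    then show ?thesis using *[OF refl] True beta_pos by (simp add: algebra_simps)
  next
    case False
    then show ?thesis using *[of A] by simp
  qed
qed

text \<open>The differences of two points of \<open>X\<close> that are tracked below are sums of distinct powers
  \<open>(1/\<beta>)\<^sup>i\<close> with \<open>1 \<le> i \<le> d\<close>, up to the factor \<open>\<beta> - 1\<close>. A negative difference is expressed by
  exchanging the two points.\<close>

definition rel :: "nat set \<Rightarrow> real \<Rightarrow> real \<Rightarrow> bool" where
  "rel A v v' \<longleftrightarrow> A \<subseteq> {1..d} \<and> v \<in> X \<and> v' \<in> X \<and> v' - v = (\<beta> - 1) * val A"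

lemma X_diff_less: "v \<in> X \<Longrightarrow> v' \<in> X \<Longrightarrow> v' - v < \<beta> - 1"
  unfolding XB_def by auto

lemma T_diff:
  assumes "rel A v v'"
  shows "T v' - T v = (\<beta> - 1) * ((if 1 \<in> A then 1 else 0) + val (shift_down A)
           + (if v \<ge> 1/2 then 1 else 0) - (if v' \<ge> 1/2 then 1 else 0))"
proof -
  have A: "finite A" "0 \<notin> A" using assms unfolding rel_def by (auto intro: finite_subset)
  have "T v' - T v = (\<beta> - 1) * (\<beta> * val A)
     + (\<beta> - 1) * ((if v \<ge> 1/2 then 1 else 0) - (if v' \<ge> 1/2 then 1 else 0))"
  proof -
    have "\<beta> * v' = \<beta> * v + (\<beta> - 1) * (\<beta> * val A)"
    proof -
      have "v' = v + (\<beta> - 1) * val A" using assms unfolding rel_def by simp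
      then have "\<beta> * v' = \<beta> * (v + (\<beta> - 1) * val A)" by (rule arg_cong)
      then show ?thesis by (simp only: distrib_left mult.left_commute)
    qed
    then show ?thesis unfolding TB_def by (simp add: algebra_simps)
  qed
  then show ?thesis unfolding beta_val[OF A] by (simp add: algebra_simps)
qed

text \<open>Exponent 1 releases a unit into the coefficient, which must still stay below 1 because
  differences in \<open>X\<close> stay below \<beta> - 1. Only the digits 0 at \<open>v\<close> and
  1 at \<open>v'\<close> cancel it.\<close>

lemma rel_step_mem:
  assumes r: "rel A v v'" and A1: "1 \<in> A"
  shows "v < 1/2 \<and> v' \<ge> 1/2 \<and> rel (shift_down A) (T v) (T v')"
proof -
  have X: "T v \<in> X" "T v' \<in> X" using r T_in_X unfolding rel_def by auto
  have s: "shift_down A \<subseteq> {1..d}" using r unfolding rel_def shift_down_def by auto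
  let ?e = "(if v \<ge> 1/2 then 1 else 0) - (if v' \<ge> 1/2 then 1 else 0) :: real"
  have eq: "T v' - T v = (\<beta> - 1) * (1 + val (shift_down A) + ?e)"
    using T_diff[OF r] A1 by simp
  have "(\<beta> - 1) * (1 + val (shift_down A) + ?e) < (\<beta> - 1) * 1" using X_diff_less[OF X] unfolding eq by simp
  then have "1 + val (shift_down A) + ?e < 1" using beta_gt_1 by (subst (asm) mult_less_cancel_left_pos) auto
  then have "v < 1/2 \<and> v' \<ge> 1/2" using val_nonneg[of "shift_down A"] by (auto split: if_splits)
  then show ?thesis using eq X s unfolding rel_def by auto
qed

text \<open>The digits 1 at \<open>v\<close> and 0 at \<open>v'\<close> would push the coefficient
  to at least 1. Equal digits merely shift the set. The digits 0 and 1 subtract 1, and since all d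
  powers sum to 1 the result is minus the sum over the complement: the points exchange
  roles.\<close>

lemma rel_step_nonmem:
  assumes r: "rel A v v'" and A1: "1 \<notin> A"
  shows "((v \<ge> 1/2 \<longleftrightarrow> v' \<ge> 1/2) \<and> rel (shift_down A) (T v) (T v'))
       \<or> (v < 1/2 \<and> v' \<ge> 1/2 \<and> rel ({1..d} - shift_down A) (T v') (T v))"
proof -
  have X: "T v \<in> X" "T v' \<in> X" using r T_in_X unfolding rel_def by auto
  have s: "shift_down A \<subseteq> {1..d}" using r unfolding rel_def shift_down_def by auto
  let ?e = "(if v \<ge> 1/2 then 1 else 0) - (if v' \<ge> 1/2 then 1 else 0) :: real"
  have eq: "T v' - T v = (\<beta> - 1) * (val (shift_down A) + ?e)"
    using T_diff[OF r] A1 by simp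
  have "(\<beta> - 1) * (val (shift_down A) + ?e) < (\<beta> - 1) * 1" using X_diff_less[OF X] unfolding eq by simp
  then have "val (shift_down A) + ?e < 1" using beta_gt_1 by (subst (asm) mult_less_cancel_left_pos) auto
  then have c: "(v \<ge> 1/2 \<longleftrightarrow> v' \<ge> 1/2) \<or> (v < 1/2 \<and> v' \<ge> 1/2)"
    using val_nonneg[of "shift_down A"] by (auto split: if_splits)
  have "val ({1..d} - shift_down A) = 1 - val (shift_down A)"
    using val_all s unfolding val_def by (subst sum_diff) auto
  then have flip: "(\<beta> - 1) * (val (shift_down A) - 1) = - ((\<beta> - 1) * val ({1..d} - shift_down A))"
    by (simp only: minus_mult_right minus_diff_eq)
  from c show ?thesis
  proof
    assume "v \<ge> 1/2 \<longleftrightarrow> v' \<ge> 1/2"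
    then show ?thesis using eq X s unfolding rel_def by auto
  next
    assume "v < 1/2 \<and> v' \<ge> 1/2"
    then show ?thesis using eq X flip unfolding rel_def by auto
  qed
qed

lemma rel_empty: "rel {} v v' \<Longrightarrow> v' = v"
  unfolding rel_def val_def by simp

lemma rel_sym_iter:
  assumes "\<exists>A. rel A v v' \<or> rel A v' v"
  shows "\<exists>A. rel A ((T ^^ n) v) ((T ^^ n) v') \<or> rel A ((T ^^ n) v') ((T ^^ n) v)"
proof (induction n)
  case 0 then show ?case using assms by simp
next
  case (Suc n)
  have *: "\<exists>A. rel A (T w) (T w') \<or> rel A (T w') (T w)" if "rel A w w'" for A w w'
    using rel_step_mem[OF that] rel_step_nonmem[OF that] by blast
  from Suc obtain A where "rel A ((T ^^ n) v) ((T ^^ n) v') \<or> rel A ((T ^^ n) v') ((T ^^ n) v)" by blast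
  then have "\<exists>A. rel A (T ((T ^^ n) v)) (T ((T ^^ n) v')) \<or> rel A (T ((T ^^ n) v')) (T ((T ^^ n) v))"
    using * by blast
  then show ?case by simp
qed

text \<open>As long as \<open>v\<close> reads 1 and is the larger point, the set shifts down into
  {1..d - j}. An exchange of roles fills all exponents above that window at once. Afterwards
  \<open>v\<close> is the smaller point and its digit 1 forces equal digits, so the filled block
  only moves down. After d ones at most an initial segment of exponents is left.\<close>

lemma rel_after_ones:
  assumes "rel A v v' \<or> rel A v' v" and "j \<le> d" and "\<And>i. i < j \<Longrightarrow> (T ^^ i) v \<ge> 1/2"
  shows "(\<exists>B\<subseteq>{1..d - j}. rel B ((T ^^ j) v') ((T ^^ j) v)) \<or>
         (\<exists>A\<subseteq>{1..d - j}. \<exists>i\<le>j. rel (A \<union> {d - j + 1..d - j + i}) ((T ^^ j) v) ((T ^^ j) v'))"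
  using assms(2,3)
proof (induction j)
  case 0
  show ?case using assms(1)
  proof
    assume "rel A v v'"
    moreover from this have "A \<subseteq> {1..d}" unfolding rel_def by simp
    ultimately show ?case by (intro disjI2 exI[of _ A] conjI exI[of _ 0]) auto
  next
    assume "rel A v' v"
    moreover from this have "A \<subseteq> {1..d}" unfolding rel_def by simp
    ultimately show ?case by (intro disjI1) auto
  qed
next
  case (Suc j)
  define w where "w = (T ^^ j) v"
  define w' where "w' = (T ^^ j) v'"
  have one: "w \<ge> 1/2" using Suc.prems unfolding w_def by simp
  have dj: "d - j = Suc (d - Suc j)" using Suc.prems by simp
  have sd: "shift_down B \<subseteq> {1..d - Suc j}" if "B \<subseteq> {1..d - j}" for B
    using shift_down_subset[of B] that dj by simp
  have "(\<exists>B\<subseteq>{1..d - j}. rel B w' w) \<or>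
         (\<exists>A\<subseteq>{1..d - j}. \<exists>i\<le>j. rel (A \<union> {d - j + 1..d - j + i}) w w')"
    using Suc unfolding w_def w'_def by simp
  then show ?case
  proof (elim disjE exE conjE)
    fix B assume B: "B \<subseteq> {1..d - j}" "rel B w' w"
    consider "rel (shift_down B) (T w') (T w)" | "rel ({1..d} - shift_down B) (T w) (T w')"
      using rel_step_mem[OF B(2)] rel_step_nonmem[OF B(2)] by auto
    then show ?thesis
    proof cases
      case 1 then show ?thesis using sd[OF B(1)] unfolding w_def w'_def by auto
    next
      case 2
      have "{1..d} - shift_down B = ({1..d - Suc j} - shift_down B)
          \<union> {d - Suc j + 1..d - Suc j + Suc j}"
        using sd[OF B(1)] Suc.prems by auto
      then show ?thesis using 2 unfolding w_def w'_def
        by (intro disjI2 exI[of _ "{1..d - Suc j} - shift_down B"] conjI exI[of _ "Suc j"]) auto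
    qed
  next
    fix A i assume A: "A \<subseteq> {1..d - j}" "i \<le> j" "rel (A \<union> {d - j + 1..d - j + i}) w w'"
    have "rel (shift_down (A \<union> {d - j + 1..d - j + i})) (T w) (T w')"
      using rel_step_mem[OF A(3)] rel_step_nonmem[OF A(3)] one by (meson linorder_not_le)
    moreover have "shift_down (A \<union> {d - j + 1..d - j + i})
        = shift_down A \<union> {d - Suc j + 1..d - Suc j + i}"
      unfolding shift_down_def using dj by auto
    ultimately show ?thesis using sd[OF A(1)] A(2) unfolding w_def w'_def
      by (intro disjI2 exI[of _ "shift_down A"] conjI exI[of _ i]) auto
  qed
qed

text \<open>Containing exponent 1 dictates both digits, so the set can only shift, losing one
  exponent per step until the points coincide.\<close>

lemma rel_initial_segment_iter:
  assumes "rel {1..i} v v'"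
  shows "rel {1..i - n} ((T ^^ n) v) ((T ^^ n) v')"
proof (induction n)
  case 0 then show ?case using assms by simp
next
  case (Suc n)
  show ?case
  proof (cases "i - n = 0")
    case True
    then have "rel {} ((T ^^ n) v) ((T ^^ n) v')" using Suc by simp
    moreover from rel_empty[OF this] have "(T ^^ n) v' = (T ^^ n) v" .
    ultimately show ?thesis using True T_in_X unfolding rel_def val_def by simp
  next
    case False
    then have "1 \<in> {1..i - n}" by simp
    from rel_step_mem[OF Suc this] have "rel (shift_down {1..i - n}) (T ((T ^^ n) v)) (T ((T ^^ n) v'))"
      by simp
    moreover have "shift_down {1..i - n} = {1..i - Suc n}" unfolding shift_down_def using False by auto
    ultimately show ?thesis by simp
  qed
qed

text \<open>The relation survives the first \<open>K\<close> digits whatever they are; d ones then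
  leave an initial segment, which the next d digits use up.\<close>

lemma synchronize_one:
  assumes r: "\<exists>A. rel A v v' \<or> rel A v' v"
    and ones: "\<And>i. i < d \<Longrightarrow> (T ^^ (K + i)) v \<ge> 1/2"
  shows "(T ^^ (K + 2 * d)) v = (T ^^ (K + 2 * d)) v'"
proof -
  define w where "w = (T ^^ K) v"
  define w' where "w' = (T ^^ K) v'"
  obtain A where A: "rel A w w' \<or> rel A w' w"
    using rel_sym_iter[OF r, of K] unfolding w_def w'_def by auto
  have "(T ^^ i) w \<ge> 1/2" if "i < d" for i
    using ones[OF that] unfolding w_def by (simp add: funpow_add_apply)
  from rel_after_ones[OF A order_refl this]
  have "rel {} ((T ^^ d) w') ((T ^^ d) w) \<or> (\<exists>i\<le>d. rel {1..i} ((T ^^ d) w) ((T ^^ d) w'))"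
    by auto
  moreover have "(T ^^ d) ((T ^^ d) w) = (T ^^ d) ((T ^^ d) w')" if "i \<le> d" "rel {1..i} ((T ^^ d) w) ((T ^^ d) w')" for i
    using rel_empty[of "(T ^^ d) ((T ^^ d) w)" "(T ^^ d) ((T ^^ d) w')"]
      rel_initial_segment_iter[OF that(2), of d] that(1) by simp
  ultimately have "(T ^^ d) ((T ^^ d) w) = (T ^^ d) ((T ^^ d) w')"
    using rel_empty by metis
  then show ?thesis unfolding w_def w'_def mult_2 by (simp only: funpow_add_apply)
qed

section \<open>Decomposing a difference into elementary steps\<close>

lemma rel_singleton:
  assumes "i \<in> {1..d}" "v \<in> X" "v + (\<beta> - 1) * (1/\<beta>) ^ i \<in> X"
  shows "rel {i} v (v + (\<beta> - 1) * (1/\<beta>) ^ i)"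
  using assms unfolding rel_def val_def by auto

lemma two_powers_le_1:
  assumes "i \<in> {1..d}" "j \<in> {1..d}" "i \<noteq> j"
  shows "(1/\<beta>) ^ i + (1/\<beta>) ^ j \<le> 1"
proof -
  have "(1/\<beta>) ^ i + (1/\<beta>) ^ j = val {i, j}" using assms unfolding val_def by simp
  also have "\<dots> \<le> val {1..d}" unfolding val_def using assms beta_pos by (intro sum_mono2) auto
  finally show ?thesis using val_all by simp
qed

text \<open>Coordinates with respect to \<beta>^-1, ..., \<beta>^-d, which turn out to be a
  \<int>-basis of the ring. The \<open>weight\<close> is their l1-norm, that is, the number of
  elementary steps.\<close>

definition ival :: "(nat \<Rightarrow> int) \<Rightarrow> real" where
  "ival c = (\<Sum>i\<in>{1..d}. of_int (c i) * (1/\<beta>) ^ i)"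

definition weight :: "(nat \<Rightarrow> int) \<Rightarrow> nat" where
  "weight c = (\<Sum>i\<in>{1..d}. nat \<bar>c i\<bar>)"

lemma ival_upd: "i \<in> {1..d} \<Longrightarrow> ival (c(i := x)) = ival c + (of_int x - of_int (c i)) * (1/\<beta>) ^ i"
  unfolding ival_def
  by (subst (1 2) sum.remove[of "{1..d}" i])
     (auto simp: algebra_simps intro!: sum.cong)

lemma weight_upd: "i \<in> {1..d} \<Longrightarrow> weight (c(i := x)) + nat \<bar>c i\<bar> = weight c + nat \<bar>x\<bar>"
  unfolding weight_def
  by (subst (1 2) sum.remove[of "{1..d}" i]) (auto intro!: sum.cong)

lemma single_le_ival:
  assumes "\<And>j. j \<in> {1..d} \<Longrightarrow> c j \<ge> 0" "i \<in> {1..d}" "c i > 0"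
  shows "(1/\<beta>) ^ i \<le> ival c"
proof -
  have "1 * (1/\<beta>) ^ i \<le> of_int (c i) * (1/\<beta>) ^ i"
    using assms(3) beta_pos by (intro mult_right_mono) auto
  also have "\<dots> \<le> ival c" unfolding ival_def
    using assms beta_pos by (intro member_le_sum) auto
  finally show ?thesis by simp
qed

text \<open>Since the length of \<open>X\<close> exceeds the sum of any two admissible steps, a step up or a step
  down towards the target always stays inside \<open>X\<close>.\<close>

lemma step_within_X:
  assumes X: "v \<in> X" "v' \<in> X" and diff: "v' - v = (\<beta> - 1) * ival c" and w: "weight c = Suc m"
  shows "\<exists>v1\<in>X. \<exists>c'. weight c' = m \<and> v' - v1 = (\<beta> - 1) * ival c' \<and> (\<exists>A. rel A v v1 \<or> rel A v1 v)"
proof -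
  have up: ?thesis if i: "i \<in> {1..d}" "c i > 0" and v1: "v + (\<beta> - 1) * (1/\<beta>) ^ i \<in> X" for i
  proof (intro bexI[OF _ v1] exI[of _ "c(i := c i - 1)"] conjI)
    show "weight (c(i := c i - 1)) = m" using weight_upd[OF i(1), of c "c i - 1"] w i(2) by simp
    show "v' - (v + (\<beta> - 1) * (1/\<beta>) ^ i) = (\<beta> - 1) * ival (c(i := c i - 1))"
      unfolding ival_upd[OF i(1)] using diff by (simp add: algebra_simps)
  qed (use rel_singleton[OF i(1) X(1) v1] in auto)
  have down: ?thesis if i: "i \<in> {1..d}" "c i < 0" and v1: "v - (\<beta> - 1) * (1/\<beta>) ^ i \<in> X" for i
  proof (intro bexI[OF _ v1] exI[of _ "c(i := c i + 1)"] conjI)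
    show "weight (c(i := c i + 1)) = m" using weight_upd[OF i(1), of c "c i + 1"] w i(2) by simp
    show "v' - (v - (\<beta> - 1) * (1/\<beta>) ^ i) = (\<beta> - 1) * ival (c(i := c i + 1))"
      unfolding ival_upd[OF i(1)] using diff by (simp add: algebra_simps)
  qed (use rel_singleton[OF i(1) v1] X(1) in auto)
  have pos: "0 < (\<beta> - 1) * (1/\<beta>) ^ i" for i using beta_gt_1 by simp
  show ?thesis
  proof (rule ccontr)
    assume no: "\<not> ?thesis"
    have hi: "v + (\<beta> - 1) * (1/\<beta>) ^ i \<ge> \<beta>/2" if "i \<in> {1..d}" "c i > 0" for i
      using up[OF that] no X(1) pos[of i] unfolding XB_def by fastforce
    have lo: "v - (\<beta> - 1) * (1/\<beta>) ^ i < 1 - \<beta>/2" if "i \<in> {1..d}" "c i < 0" for i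
      using down[OF that] no X(1) pos[of i] unfolding XB_def by fastforce
    have "\<exists>i\<in>{1..d}. c i \<noteq> 0"
      using w unfolding weight_def by (rule_tac ccontr) auto
    then obtain k where k: "k \<in> {1..d}" "c k \<noteq> 0" by auto
    show False
    proof (cases "\<exists>i\<in>{1..d}. c i > 0")
      case True
      then obtain i where i: "i \<in> {1..d}" "c i > 0" by auto
      show False
      proof (cases "\<exists>j\<in>{1..d}. c j < 0")
        case True
        then obtain j where j: "j \<in> {1..d}" "c j < 0" by auto
        have "(\<beta> - 1) * 1 < (\<beta> - 1) * ((1/\<beta>) ^ i + (1/\<beta>) ^ j)"
          using hi[OF i] lo[OF j] by (simp add: algebra_simps)
        then have "1 < (1/\<beta>) ^ i + (1/\<beta>) ^ j" using beta_gt_1 by simp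
        then show False using two_powers_le_1[OF i(1) j(1)] i j by fastforce
      next
        case False
        \<comment> \<open>No coefficient is negative, so the step cannot overshoot
          \<open>v'\<close>, which lies in \<open>X\<close>.\<close>
        then have "(1/\<beta>) ^ i \<le> ival c" using i by (intro single_le_ival) (auto simp: not_less)
        then have "(\<beta> - 1) * (1/\<beta>) ^ i \<le> v' - v" unfolding diff using beta_gt_1 by simp
        then show False using hi[OF i] X(2) unfolding XB_def by auto
      qed
    next
      case False
      then have k': "c k < 0" using k by force
      have "(1/\<beta>) ^ k \<le> ival (\<lambda>j. - c j)"
        using k' False k by (intro single_le_ival) (auto simp: not_less)
      also have "\<dots> = - ival c" unfolding ival_def by (simp add: sum_negf)
      finally have "(\<beta> - 1) * (1/\<beta>) ^ k \<le> (\<beta> - 1) * - ival c"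
        using beta_gt_1 by (intro mult_left_mono) auto
      then have "(\<beta> - 1) * (1/\<beta>) ^ k \<le> v - v'" using diff by simp
      then show False using lo[OF k(1) k'] X(2) unfolding XB_def by auto
    qed
  qed
qed

text \<open>Induction on the weight; each elementary step costs one block. Once \<open>v\<close> has
  merged with the intermediate point \<open>v1\<close>, both read the same digits, so the remaining
  blocks of \<open>v\<close> are blocks of \<open>v1\<close>.\<close>

lemma synchronize:
  assumes "v \<in> X" "v' \<in> X" "v' - v = (\<beta> - 1) * ival c" "weight c = m"
    and "\<And>k i. k < m \<Longrightarrow> i < d \<Longrightarrow> (T ^^ (K + 2 * d * k + i)) v \<ge> 1/2"
  shows "(T ^^ (K + 2 * d * m)) v = (T ^^ (K + 2 * d * m)) v'"
  using assms
proof (induction m arbitrary: v c K)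
  case 0
  then have "ival c = 0" unfolding weight_def ival_def by simp
  then show ?case using 0 by simp
next
  case (Suc m)
  obtain v1 c' where v1: "v1 \<in> X" "weight c' = m" "v' - v1 = (\<beta> - 1) * ival c'"
      "\<exists>A. rel A v v1 \<or> rel A v1 v"
    using step_within_X[OF Suc.prems(1-4)] by blast
  have eq: "(T ^^ (K + 2 * d)) v = (T ^^ (K + 2 * d)) v1"
    using Suc.prems(5)[of 0] by (intro synchronize_one[OF v1(4)]) auto
  have eq': "(T ^^ (K + 2 * d + n)) v = (T ^^ (K + 2 * d + n)) v1" for n
    unfolding funpow_add_apply[of "K + 2 * d"] eq ..
  have "(T ^^ (K + 2 * d + 2 * d * m)) v1 = (T ^^ (K + 2 * d + 2 * d * m)) v'"
  proof (rule Suc.IH[OF v1(1) Suc.prems(2) v1(3,2)])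
    fix k i assume ki: "k < m" "i < d"
    have "K + 2 * d + (2 * d * k + i) = K + 2 * d * Suc k + i" by simp
    then show "1 / 2 \<le> (T ^^ (K + 2 * d + 2 * d * k + i)) v1"
      using Suc.prems(5)[of "Suc k" i] ki eq'[of "2 * d * k + i"] by (simp add: add.assoc)
  qed
  then show ?case using eq'[of "2 * d * m"] by (simp add: algebra_simps)
qed

section \<open>Digit words that can be prepended\<close>

lemma zeros_prependable:
  assumes "v \<in> X" "v \<ge> 1/2" "i \<le> d"
  shows "v / \<beta> ^ i \<in> X \<and> (T ^^ i) (v / \<beta> ^ i) = v \<and> (0 < i \<longrightarrow> v / \<beta> ^ i < 1/2)"
  using assms(3)
proof (induction i)
  case 0 then show ?case using assms by simp
next
  case (Suc i)
  let ?w = "v / \<beta> ^ Suc i"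
  have IH: "v / \<beta> ^ i \<in> X" "(T ^^ i) (v / \<beta> ^ i) = v" using Suc by auto
  have w: "?w = (v / \<beta> ^ i) / \<beta>" by (simp add: field_simps)
  have "v / \<beta> ^ i < \<beta>/2" using IH(1) unfolding XB_def by simp
  then have lt: "?w < 1/2" unfolding w using beta_pos by (simp add: field_simps)
  have "1 / (2 * \<beta> ^ d) = (1/2) / \<beta> ^ d" by simp
  also have "\<dots> \<le> v / \<beta> ^ d" using assms beta_pos by (intro divide_right_mono) auto
  also have "\<dots> \<le> ?w" using assms Suc.prems beta_gt_1 by (intro divide_left_mono power_increasing) auto
  finally have "1 - \<beta>/2 \<le> ?w" unfolding left_end_eq .
  moreover have "?w < \<beta>/2" using lt beta_gt_1 by linarith
  ultimately have "?w \<in> X" unfolding XB_def by simp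
  moreover have "T ?w = v / \<beta> ^ i" unfolding TB_def using lt beta_pos by simp
  ultimately show ?case using lt IH(2) by (simp only: funpow_Suc_right comp_apply) simp
qed

text \<open>Mirror image of \<open>zeros_prependable\<close> under v -> 1 - v, hence the invariant
  for 1 - w. The strict v < 1/2 matches the exclusion of the right end of \<open>X\<close>.\<close>

lemma ones_prependable:
  assumes "v \<in> X" "v < 1/2" "i \<le> d"
  shows "\<exists>w\<in>X. (T ^^ i) w = v \<and> 1 - w = (1 - v) / \<beta> ^ i \<and> (\<forall>j<i. (T ^^ j) w \<ge> 1/2)"
  using assms(3)
proof (induction i)
  case 0 then show ?case using assms by auto
next
  case (Suc i)
  then obtain w where w: "w \<in> X" "(T ^^ i) w = v" "1 - w = (1 - v) / \<beta> ^ i" "\<forall>j<i. (T ^^ j) w \<ge> 1/2"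
    by auto
  let ?u = "(w + \<beta> - 1) / \<beta>"
  have u: "1 - ?u = (1 - w) / \<beta>" using beta_pos by (simp add: field_simps)
  have ge: "?u \<ge> 1/2" using w(1) beta_pos unfolding XB_def by (simp add: field_simps)
  have Tu: "T ?u = w" unfolding TB_def using ge beta_pos by simp
  have "1 / (2 * \<beta> ^ d) = (1/2) / \<beta> ^ d" by simp
  also have "\<dots> < (1 - v) / \<beta> ^ d" using assms beta_pos by (intro divide_strict_right_mono) auto
  also have "\<dots> \<le> (1 - v) / \<beta> ^ Suc i"
    using assms Suc.prems beta_gt_1 by (intro divide_left_mono power_increasing) auto
  also have "\<dots> = 1 - ?u" unfolding u w(3) by simp
  finally have "1 - \<beta>/2 < 1 - ?u" unfolding left_end_eq .
  then have "?u < \<beta>/2" by linarith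
  moreover have "1 - \<beta>/2 \<le> ?u" using ge beta_gt_1 by linarith
  ultimately have uX: "?u \<in> X" unfolding XB_def by simp
  have "(T ^^ j) ?u \<ge> 1/2" if "j < Suc i" for j
    using that ge w(4) Tu by (cases j) (auto simp: funpow_swap1)
  then show ?case using uX Tu w(2,3) u
    by (intro bexI[OF _ uX]) (auto simp: funpow_swap1)
qed

text \<open>A block leads from one point at or above 1/2 to another, so blocks can be stacked: d
  zeros lower the point below 1/2, which is what admits d ones in front of them.\<close>

lemma block_prependable:
  assumes "v \<in> X" "v \<ge> 1/2"
  shows "\<exists>w\<in>X. w \<ge> 1/2 \<and> (T ^^ (2 * d)) w = v \<and> (\<forall>i<d. (T ^^ i) w \<ge> 1/2)"
proof -
  have z: "v / \<beta> ^ d \<in> X" "(T ^^ d) (v / \<beta> ^ d) = v" "v / \<beta> ^ d < 1/2"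
    using zeros_prependable[OF assms order_refl] d_ge by auto
  obtain w where w: "w \<in> X" "(T ^^ d) w = v / \<beta> ^ d" "\<forall>j<d. (T ^^ j) w \<ge> 1/2"
    using ones_prependable[OF z(1,3) order_refl] by auto
  have "(T ^^ (2 * d)) w = v" using w z by (simp add: mult_2 funpow_add)
  moreover have "w \<ge> 1/2" using w(3)[rule_format, of 0] d_ge by simp
  ultimately show ?thesis using w by auto
qed

lemma blocks_prependable:
  assumes "v \<in> X" "v \<ge> 1/2"
  shows "\<exists>w\<in>X. w \<ge> 1/2 \<and> (T ^^ (2 * d * N)) w = v \<and> (\<forall>k<N. \<forall>i<d. (T ^^ (2 * d * k + i)) w \<ge> 1/2)"
proof (induction N)
  case 0 then show ?case using assms by auto
next
  case (Suc N)
  then obtain w where w: "w \<in> X" "w \<ge> 1/2" "(T ^^ (2 * d * N)) w = v"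
     "\<forall>k<N. \<forall>i<d. (T ^^ (2 * d * k + i)) w \<ge> 1/2" by auto
  obtain u where u: "u \<in> X" "u \<ge> 1/2" "(T ^^ (2 * d)) u = w" "\<forall>i<d. (T ^^ i) u \<ge> 1/2"
    using block_prependable[OF w(1,2)] by auto
  have it: "(T ^^ (2 * d + n)) u = (T ^^ n) w" for n
    unfolding funpow_add_apply[of "2 * d"] u(3) ..
  have "(T ^^ (2 * d * k + i)) u \<ge> 1/2" if "k < Suc N" "i < d" for k i
  proof (cases k)
    case 0 then show ?thesis using u(4) that by simp
  next
    case (Suc k')
    then have "2 * d * k + i = 2 * d + (2 * d * k' + i)" by simp
    then show ?thesis using it w(4) Suc that by (simp only:)
  qed
  then show ?case using u it[of "2 * d * N"] w(3) by (intro bexI[OF _ u(1)]) auto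
qed

text \<open>The word 10 or 11, according to the side of 1/2. Both have length 2, which keeps the
  length of a synchronizing word independent of \<open>v\<close>.\<close>

lemma connector_prependable:
  assumes "v \<in> X" shows "\<exists>w\<in>X. w \<ge> 1/2 \<and> (T ^^ 2) w = v"
proof (cases "v \<ge> 1/2")
  case True
  have z: "v / \<beta> ^ 1 \<in> X" "(T ^^ 1) (v / \<beta> ^ 1) = v" "v / \<beta> ^ 1 < 1/2"
    using zeros_prependable[OF assms True, of 1] d_ge by auto
  obtain w where w: "w \<in> X" "(T ^^ 1) w = v / \<beta> ^ 1" "\<forall>j<1. (T ^^ j) w \<ge> 1/2"
    using ones_prependable[OF z(1,3), of 1] d_ge by auto
  then show ?thesis using z by (intro bexI[OF _ w(1)]) (auto simp: numeral_2_eq_2)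
next
  case False
  obtain w where w: "w \<in> X" "(T ^^ 2) w = v" "\<forall>j<2. (T ^^ j) w \<ge> 1/2"
    using ones_prependable[OF assms, of 2] d_ge False by auto
  then show ?thesis using w(3)[rule_format, of 0] by auto
qed

lemma synchronizing_preimage:
  assumes "v \<in> X"
  shows "\<exists>w\<in>X. (T ^^ (2 * d * N + 2)) w = v \<and>
    (\<forall>w'\<in>X. \<forall>c. w' - w = (\<beta> - 1) * ival c \<longrightarrow> weight c \<le> N \<longrightarrow> (T ^^ (2 * d * N + 2)) w' = v)"
proof -
  obtain u where u: "u \<in> X" "u \<ge> 1/2" "(T ^^ 2) u = v" using connector_prependable[OF assms] by auto
  obtain w where w: "w \<in> X" "(T ^^ (2 * d * N)) w = u"
     "\<forall>k<N. \<forall>i<d. (T ^^ (2 * d * k + i)) w \<ge> 1/2" using blocks_prependable[OF u(1,2), of N] by blast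
  have Tw: "(T ^^ (2 * d * N + 2)) w = v" unfolding funpow_add_apply w(2) u(3) ..
  have "(T ^^ (2 * d * N + 2)) w' = v"
    if w': "w' \<in> X" "w' - w = (\<beta> - 1) * ival c" "weight c \<le> N" for w' c
  proof -
    have "(T ^^ (0 + 2 * d * weight c)) w = (T ^^ (0 + 2 * d * weight c)) w'"
      using w(3) w'(3) by (intro synchronize[OF w(1) w'(1,2) refl]) auto
    moreover have "2 * d * N + 2 = 2 * d * weight c + (2 * d * (N - weight c) + 2)"
      using w'(3) by (simp add: diff_mult_distrib2)
    ultimately show ?thesis using Tw by (simp only: funpow_add_apply add_0)
  qed
  then show ?thesis using w(1) Tw by auto
qed

end

section \<open>The ring generated by the base; preimages\<close>

context bonacci begin

lemma Z_of_int [simp]: "of_int k \<in> Z\<beta>"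
  unfolding int_adjoin_def by (auto intro!: exI[of _ "[:k:]"] simp: map_poly_pCons)

lemma Z_0 [simp]: "0 \<in> Z\<beta>" and Z_1 [simp]: "1 \<in> Z\<beta>"
  using Z_of_int[of 0] Z_of_int[of 1] by simp_all

lemma Z_of_nat [simp]: "of_nat k \<in> Z\<beta>"
  using Z_of_int[of "int k"] by simp

lemma Z_add: assumes "x \<in> Z\<beta>" "y \<in> Z\<beta>" shows "x + y \<in> Z\<beta>"
proof -
  obtain p q :: "int poly" where pq: "x = poly (map_poly of_int p) \<beta>" "y = poly (map_poly of_int q) \<beta>"
    using assms unfolding int_adjoin_def by auto
  have "map_poly of_int (p + q) = (map_poly of_int p + map_poly of_int q :: real poly)"
    by (intro poly_eqI) (simp add: coeff_map_poly)
  then show ?thesis unfolding int_adjoin_def pq by (auto intro!: exI[of _ "p + q"])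
qed

lemma Z_int_mult: assumes "x \<in> Z\<beta>" shows "of_int k * x \<in> Z\<beta>"
proof -
  obtain p :: "int poly" where p: "x = poly (map_poly of_int p) \<beta>"
    using assms unfolding int_adjoin_def by auto
  have "map_poly of_int (smult k p) = (smult (of_int k) (map_poly of_int p) :: real poly)"
    by (intro poly_eqI) (simp add: coeff_map_poly)
  then show ?thesis unfolding int_adjoin_def p by (auto intro!: exI[of _ "smult k p"])
qed

lemma Z_beta_mult: assumes "x \<in> Z\<beta>" shows "\<beta> * x \<in> Z\<beta>"
proof -
  obtain p :: "int poly" where p: "x = poly (map_poly of_int p) \<beta>"
    using assms unfolding int_adjoin_def by auto
  show ?thesis unfolding int_adjoin_def p by (auto intro!: exI[of _ "pCons 0 p"] simp: map_poly_pCons)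
qed

text \<open>Horner's scheme for integer polynomials in \<beta>.\<close>

lemma Z_induct [consumes 1, case_names zero step]:
  assumes "x \<in> Z\<beta>" "P 0" "\<And>k y. y \<in> Z\<beta> \<Longrightarrow> P y \<Longrightarrow> P (of_int k + \<beta> * y)"
  shows "P x"
proof -
  have "P (poly (map_poly of_int p) \<beta>)" for p :: "int poly"
  proof (induction p)
    case 0 then show ?case using assms(2) by simp
  next
    case (pCons a p)
    then show ?case
      using assms(3)[of "poly (map_poly of_int p) \<beta>" a] by (auto simp: map_poly_pCons int_adjoin_def)
  qed
  then show ?thesis using assms(1) unfolding int_adjoin_def by auto
qed

lemma Z_mult: assumes "x \<in> Z\<beta>" "y \<in> Z\<beta>" shows "x * y \<in> Z\<beta>"
  using assms(1)
proof (induction rule: Z_induct)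
  case (step k z)
  then show ?case using Z_add[OF Z_int_mult[OF assms(2), of k] Z_beta_mult[OF step(2)]]
    by (simp add: algebra_simps)
qed simp

lemma Z_uminus: "x \<in> Z\<beta> \<Longrightarrow> - x \<in> Z\<beta>"
  using Z_int_mult[of x "-1"] by simp

lemma Z_diff: "x \<in> Z\<beta> \<Longrightarrow> y \<in> Z\<beta> \<Longrightarrow> x - y \<in> Z\<beta>"
  using Z_add[of x "- y"] Z_uminus[of y] by simp

lemma Z_beta [simp]: "\<beta> \<in> Z\<beta>"
  using Z_beta_mult[OF Z_1] by simp

lemma Z_power: "x \<in> Z\<beta> \<Longrightarrow> x ^ n \<in> Z\<beta>"
  by (induction n) (auto intro: Z_mult)

lemma Z_sum: "(\<And>i. i \<in> A \<Longrightarrow> f i \<in> Z\<beta>) \<Longrightarrow> sum f A \<in> Z\<beta>"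
  by (induction A rule: infinite_finite_induct) (auto intro: Z_add)

text \<open>The constant term of the equation is a unit of \<int>, so \<beta> is a unit of the
  ring.\<close>

lemma Z_inverse_beta: "1/\<beta> \<in> Z\<beta>"
proof -
  obtain d' where d': "d = Suc d'" using d_ge by (cases d) auto
  have "\<beta> ^ d = (\<Sum>i<Suc d'. \<beta> ^ i)" using beta_pow_d d' by simp
  then have "\<beta> ^ d = (\<Sum>i<d'. \<beta> ^ Suc i) + 1"
    unfolding sum.lessThan_Suc_shift by simp
  then have "1 = \<beta> * (\<beta> ^ d' - (\<Sum>i<d'. \<beta> ^ i))"
    unfolding d' by (simp add: algebra_simps sum_distrib_left)
  then have "1/\<beta> = \<beta> ^ d' - (\<Sum>i<d'. \<beta> ^ i)" using beta_pos by (simp add: divide_eq_eq mult.commute)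
  then show ?thesis by (auto intro!: Z_diff Z_sum Z_power)
qed

lemma Z_divide_beta: "x \<in> Z\<beta> \<Longrightarrow> x / \<beta> \<in> Z\<beta>"
  using Z_mult[OF _ Z_inverse_beta] by (simp add: divide_inverse)

lemma Z_divide_power: "x \<in> Z\<beta> \<Longrightarrow> x / \<beta> ^ n \<in> Z\<beta>"
  using Z_mult[OF _ Z_power[OF Z_inverse_beta], of x n] by (simp add: power_inverse divide_inverse)

lemma Z_beta_power_mult: "x \<in> Z\<beta> \<Longrightarrow> \<beta> ^ n * x \<in> Z\<beta>"
  by (intro Z_mult Z_power Z_beta)

section \<open>Coordinates in the inverse powers of the base\<close>

lemma ival_in_Z: "ival c \<in> Z\<beta>"
  unfolding ival_def by (auto intro!: Z_sum Z_mult Z_power Z_inverse_beta)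

lemma ival_const: "ival (\<lambda>_. m) = of_int m"
proof -
  have "of_int m * val {1..d} = ival (\<lambda>_. m)"
    unfolding val_def ival_def sum_distrib_left ..
  then show ?thesis using val_all by simp
qed

lemma ival_add: "ival (\<lambda>i. c i + c' i) = ival c + ival c'"
  unfolding ival_def sum.distrib[symmetric] by (simp add: algebra_simps)

text \<open>\<beta> times the first power is 1, the sum of all d powers. So \<open>c 1\<close> is
  added to every coordinate, while the other coefficients move down by one.\<close>

lemma beta_ival: "\<beta> * ival c = ival (\<lambda>i. c 1 + (if i = d then 0 else c (Suc i)))"
proof -
  obtain d' where d': "d = Suc d'" using d_ge by (cases d) auto
  have "\<beta> * ival c = (\<Sum>i\<in>{1..d}. of_int (c i) * (\<beta> * (1/\<beta>) ^ i))"
    unfolding ival_def sum_distrib_left by (simp add: mult.left_commute)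
  also have "\<dots> = (\<Sum>i\<in>{..<d}. of_int (c (Suc i)) * (1/\<beta>) ^ i)"
    by (rule sum.reindex_bij_witness[of _ Suc "\<lambda>i. i - 1"])
       (use beta_pos in \<open>auto simp: field_simps power_Suc[symmetric] simp del: power_Suc\<close>)
  also have "{..<d} = insert 0 {1..d'}" using d' by auto
  also have "(\<Sum>i\<in>insert 0 {1..d'}. of_int (c (Suc i)) * (1/\<beta>) ^ i)
      = of_int (c 1) + (\<Sum>i\<in>{1..d'}. of_int (c (Suc i)) * (1/\<beta>) ^ i)" by simp
  also have "(\<Sum>i\<in>{1..d'}. of_int (c (Suc i)) * (1/\<beta>) ^ i)
      = ival (\<lambda>i. if i = d then 0 else c (Suc i))"
    unfolding ival_def by (rule sum.mono_neutral_cong_left) (use d' in auto)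
  finally show ?thesis unfolding ival_add ival_const .
qed

lemma Z_ival: assumes "x \<in> Z\<beta>" shows "\<exists>c. x = ival c"
  using assms
proof (induction rule: Z_induct)
  case zero
  show ?case using ival_const[of 0] by auto
next
  case (step k y)
  then obtain c where c: "y = ival c" by auto
  show ?case unfolding c beta_ival ival_const[of k, symmetric] ival_add[symmetric] by blast
qed

section \<open>The ideal generated by \<beta> - 1\<close>

definition \<Lambda> :: "real set" where
  "\<Lambda> = {(\<beta> - 1) * z | z. z \<in> Z\<beta>}"

lemma Lam_mult: "z \<in> Z\<beta> \<Longrightarrow> (\<beta> - 1) * z \<in> \<Lambda>"
  unfolding \<Lambda>_def by auto

lemma Lam_add: "x \<in> \<Lambda> \<Longrightarrow> y \<in> \<Lambda> \<Longrightarrow> x + y \<in> \<Lambda>"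
  unfolding \<Lambda>_def by clarify (metis Z_add distrib_left)

lemma Lam_uminus: "x \<in> \<Lambda> \<Longrightarrow> - x \<in> \<Lambda>"
  unfolding \<Lambda>_def by clarify (metis Z_uminus minus_mult_right)

lemma Lam_diff: "x \<in> \<Lambda> \<Longrightarrow> y \<in> \<Lambda> \<Longrightarrow> x - y \<in> \<Lambda>"
  using Lam_add[of x "- y"] Lam_uminus[of y] by simp

lemma Lam_subset_Z: "x \<in> \<Lambda> \<Longrightarrow> x \<in> Z\<beta>"
  unfolding \<Lambda>_def by (auto intro!: Z_mult Z_diff)

lemma Lam_times_Z: "x \<in> \<Lambda> \<Longrightarrow> z \<in> Z\<beta> \<Longrightarrow> x * z \<in> \<Lambda>"
  unfolding \<Lambda>_def using Z_mult by (force simp: mult.assoc)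

text \<open>Modulo \<beta> - 1 every power of \<beta> is 1, so the equation of \<beta> reads 1 =
  d.\<close>

lemma d_minus_1_in_Lam: "real d - 1 \<in> \<Lambda>"
proof -
  have p: "\<beta> ^ n - 1 \<in> \<Lambda>" for n
    unfolding power_diff_1_eq by (intro Lam_mult Z_sum Z_power Z_beta)
  have "(\<Sum>i<n. \<beta> ^ i - 1) \<in> \<Lambda>" for n
    by (induction n) (use p[of 0] p Lam_add in auto)
  then have "(\<beta> ^ d - 1) - (\<Sum>i<d. \<beta> ^ i - 1) \<in> \<Lambda>" using Lam_diff p by blast
  moreover have "(\<beta> ^ d - 1) - (\<Sum>i<d. \<beta> ^ i - 1) = real d - 1"
    unfolding sum_subtractf using beta_pow_d by simp
  ultimately show ?thesis by simp
qed

lemma residue_class_iff: "x \<in> residue_class \<beta> j \<longleftrightarrow> x - of_int j \<in> \<Lambda>"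
  unfolding residue_class_def \<Lambda>_def by (auto simp: algebra_simps)

lemma residue_class_subset_Z: "x \<in> residue_class \<beta> j \<Longrightarrow> x \<in> Z\<beta>"
  using Lam_subset_Z[of "x - of_int j"] Z_add[of "x - of_int j" "of_int j"]
  by (simp add: residue_class_iff)

lemma beta_mult_mod_Lam: "w \<in> Z\<beta> \<Longrightarrow> \<beta> * w - w \<in> \<Lambda>"
  using Lam_mult[of w] by (simp add: algebra_simps)

section \<open>Preimages under the balanced map\<close>

definition pre :: "nat \<Rightarrow> real \<Rightarrow> real set" where
  "pre n v = {w \<in> X. (T ^^ n) w = v}"

lemma pre_0: "v \<in> X \<Longrightarrow> pre 0 v = {v}"
  unfolding pre_def by auto

lemma pre_add: "w \<in> pre m u \<Longrightarrow> u \<in> pre n v \<Longrightarrow> w \<in> pre (m + n) v"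
  unfolding pre_def by (simp add: funpow_add_apply)

lemma pre_funpow: "w \<in> pre (m + n) v \<Longrightarrow> (T ^^ m) w \<in> pre n v"
  unfolding pre_def by (simp add: funpow_add_apply T_iter_in_X)

lemma in_pre_funpow: "w \<in> X \<Longrightarrow> w \<in> pre n ((T ^^ n) w)"
  unfolding pre_def by simp

lemma beta_mult_of_T: "T w = v \<Longrightarrow> \<beta> * w = v + (if w \<ge> 1/2 then \<beta> - 1 else 0)"
  unfolding TB_def by auto

lemma pre_1_cases:
  assumes "w \<in> pre 1 v"
  shows "w = v / \<beta> \<or> w = (v + \<beta> - 1) / \<beta>"
proof -
  have "T w = v" using assms unfolding pre_def by simp
  from beta_mult_of_T[OF this] show ?thesis using beta_pos
    by (auto simp: eq_divide_eq mult.commute split: if_splits)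
qed

lemma pre_Suc: "pre (Suc n) v = (\<Union>u\<in>pre 1 v. pre n u)"
  unfolding pre_def using T_iter_in_X by auto

lemma finite_pre: "finite (pre n v)"
proof (induction n arbitrary: v)
  case 0
  show ?case by (rule finite_subset[of _ "{v}"]) (auto simp: pre_def)
next
  case (Suc n)
  have "finite (pre 1 v)"
    by (rule finite_subset[of _ "{v / \<beta>, (v + \<beta> - 1) / \<beta>}"]) (use pre_1_cases in blast, simp)
  then show ?case unfolding pre_Suc using Suc by blast
qed

text \<open>A digit contributes 0 or \<beta> - 1, both in the ideal, and \<beta> acts as the
  identity modulo the ideal. Preimages stay in the ring because \<beta> is a unit.\<close>

lemma pre_class:
  assumes "v \<in> Z\<beta>" "w \<in> pre n v"
  shows "w \<in> Z\<beta> \<and> w - v \<in> \<Lambda>"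
  using assms
proof (induction n arbitrary: v)
  case 0 then show ?case using Lam_mult[OF Z_0] by (simp add: pre_def)
next
  case (Suc n)
  then obtain u where u: "u \<in> pre 1 v" "w \<in> pre n u" unfolding pre_Suc by auto
  have Tu: "T u = v" using u(1) unfolding pre_def by simp
  let ?a = "if u \<ge> 1/2 then \<beta> - 1 else 0"
  have a: "?a \<in> \<Lambda>" using Lam_mult[OF Z_0] Lam_mult[OF Z_1] by simp
  have bu: "\<beta> * u = v + ?a" using beta_mult_of_T[OF Tu] .
  then have "u = (v + ?a) / \<beta>" using beta_pos by (simp add: field_simps)
  then have uZ: "u \<in> Z\<beta>" using Z_divide_beta[OF Z_add[OF Suc.prems(1) Lam_subset_Z[OF a]]] by (simp only:)
  have "?a - (\<beta> * u - u) \<in> \<Lambda>" using a beta_mult_mod_Lam[OF uZ] by (rule Lam_diff)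
  moreover have "?a - (\<beta> * u - u) = u - v" using bu by (simp split: if_splits)
  ultimately have "u - v \<in> \<Lambda>" by (simp only:)
  then show ?case using Suc.IH[OF uZ u(2)] Lam_add[of "w - u" "u - v"] by simp
qed

lemma T_iter_class:
  assumes "w \<in> Z\<beta>"
  shows "(T ^^ n) w \<in> Z\<beta> \<and> (T ^^ n) w - w \<in> \<Lambda>"
proof (induction n)
  case 0 show ?case using assms Lam_mult[OF Z_0] by simp
next
  case (Suc n)
  let ?u = "(T ^^ n) w"
  let ?a = "if ?u \<ge> 1/2 then \<beta> - 1 else 0"
  have a: "?a \<in> \<Lambda>" using Lam_mult[OF Z_0] Lam_mult[OF Z_1] by simp
  have T: "T ?u = \<beta> * ?u - ?a" unfolding TB_def ..
  have "T ?u - ?u = (\<beta> * ?u - ?u) - ?a" unfolding T by simp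
  then have m: "T ?u - ?u \<in> \<Lambda>" using Lam_diff[OF beta_mult_mod_Lam a] Suc by metis
  then have "T ?u \<in> Z\<beta>" using Z_add[OF Lam_subset_Z[OF m], of ?u] Suc by simp
  moreover have "T ?u - w \<in> \<Lambda>" using Lam_add[OF m, of "?u - w"] Suc by simp
  ultimately show ?case by simp
qed

text \<open>The type of \<open>v\<close> records how many digits 0 and how many digits 1 can be prepended to the
  expansion of \<open>v\<close>. It determines the tile of \<open>v\<close> up to translation.\<close>

definition type :: "real \<Rightarrow> nat set \<times> nat set" where
  "type v = ({i \<in> {..d}. v \<ge> \<beta> ^ i * (1 - \<beta>/2)}, {i \<in> {..d}. 1 - v > \<beta> ^ i * (1 - \<beta>/2)})"

lemma pow_left_end: "\<beta> ^ d * (1 - \<beta>/2) = 1/2" "\<beta> ^ Suc d * (1 - \<beta>/2) = \<beta>/2"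
  using left_end_eq beta_pos by simp_all

lemma pow_left_end_le: "i \<le> d \<Longrightarrow> \<beta> ^ i * (1 - \<beta>/2) \<le> 1/2"
  unfolding pow_left_end(1)[symmetric] using beta_gt_1 beta_less_2
  by (intro mult_right_mono power_increasing) auto

lemma lo_in_pre_iff: "v \<in> X \<Longrightarrow> v / \<beta> \<in> pre 1 v \<longleftrightarrow> 1 \<in> fst (type v)"
proof -
  assume v: "v \<in> X"
  then have lt: "v / \<beta> < 1/2" unfolding XB_def using beta_pos by (simp add: field_simps)
  then have "T (v / \<beta>) = v" unfolding TB_def using beta_pos by simp
  moreover have "v / \<beta> < \<beta> / 2" using lt beta_gt_1 by linarith
  ultimately show ?thesis unfolding pre_def XB_def type_def using d_ge beta_pos
    by (auto simp: le_divide_eq mult.commute)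
qed

lemma hi_in_pre_iff: "v \<in> X \<Longrightarrow> (v + \<beta> - 1) / \<beta> \<in> pre 1 v \<longleftrightarrow> 1 \<in> snd (type v)"
proof -
  assume v: "v \<in> X"
  let ?u = "(v + \<beta> - 1) / \<beta>"
  have ge: "?u \<ge> 1/2" using v unfolding XB_def using beta_pos by (simp add: field_simps)
  then have "T ?u = v" unfolding TB_def using beta_pos by simp
  moreover have "1 - \<beta>/2 \<le> ?u" using ge beta_gt_1 by linarith
  moreover have "?u < \<beta>/2 \<longleftrightarrow> 1 - v > \<beta> * (1 - \<beta>/2)"
  proof -
    have "?u < \<beta>/2 \<longleftrightarrow> v + \<beta> - 1 < \<beta>/2 * \<beta>" using beta_pos by (simp only: divide_less_eq if_True)
    also have "\<dots> \<longleftrightarrow> 1 - v > \<beta> * (1 - \<beta>/2)" unfolding right_diff_distrib by auto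
    finally show ?thesis .
  qed
  ultimately show ?thesis unfolding pre_def XB_def type_def using d_ge by auto
qed

text \<open>The prepended 0 uses up one admissible 0, and since v / \<beta> < 1/2 every run of at
  most d ones becomes admissible. So the new type is a function of the old one;
  \<open>type_hi\<close> is the mirror image.\<close>

lemma type_lo:
  assumes "v \<in> X" shows "type (v / \<beta>) = ({i \<in> {..d}. Suc i \<in> fst (type v)}, {..d})"
proof -
  have lt: "v / \<beta> < 1/2" using assms unfolding XB_def using beta_pos by (simp add: field_simps)
  have eq: "v / \<beta> \<ge> \<beta> ^ i * (1 - \<beta>/2) \<longleftrightarrow> v \<ge> \<beta> ^ Suc i * (1 - \<beta>/2)" for i
    using beta_pos by (simp add: le_divide_eq mult_ac)
  \<comment> \<open>Index d is no exception: d + 1 prepended zeros would need v \<ge>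
    \<beta>/2.\<close>
  have "\<not> v \<ge> \<beta> ^ Suc d * (1 - \<beta>/2)" unfolding pow_left_end using assms unfolding XB_def by simp
  then have "v / \<beta> \<ge> \<beta> ^ i * (1 - \<beta>/2) \<longleftrightarrow> Suc i \<in> fst (type v)" if "i \<le> d" for i
    unfolding eq type_def using that by (cases "i = d") auto
  moreover have "1 - v / \<beta> > \<beta> ^ i * (1 - \<beta>/2)" if "i \<le> d" for i
    using pow_left_end_le[OF that] lt by linarith
  ultimately show ?thesis unfolding type_def[of "v / \<beta>"] by auto
qed

lemma type_hi:
  assumes "v \<in> X"
  shows "type ((v + \<beta> - 1) / \<beta>) = ({..d}, {i \<in> {..d}. Suc i \<in> snd (type v)})"
proof -
  let ?u = "(v + \<beta> - 1) / \<beta>"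
  have ge: "?u \<ge> 1/2" using assms unfolding XB_def using beta_pos by (simp add: field_simps)
  have u: "1 - ?u = (1 - v) / \<beta>" using beta_pos by (simp add: field_simps)
  have eq: "1 - ?u > \<beta> ^ i * (1 - \<beta>/2) \<longleftrightarrow> 1 - v > \<beta> ^ Suc i * (1 - \<beta>/2)" for i
    unfolding u using beta_pos by (simp add: less_divide_eq mult_ac)
  have "\<not> 1 - v > \<beta> ^ Suc d * (1 - \<beta>/2)" unfolding pow_left_end using assms unfolding XB_def by simp
  then have "1 - ?u > \<beta> ^ i * (1 - \<beta>/2) \<longleftrightarrow> Suc i \<in> snd (type v)" if "i \<le> d" for i
    unfolding eq type_def using that by (cases "i = d") auto
  moreover have "?u \<ge> \<beta> ^ i * (1 - \<beta>/2)" if "i \<le> d" for i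
    using pow_left_end_le[OF that] ge by linarith
  ultimately show ?thesis unfolding type_def[of ?u] by auto
qed

text \<open>Points of equal type admit the same digit words, by \<open>type_lo\<close> and
  \<open>type_hi\<close> at each digit, and a word of length n is inverted by an affine map of slope
  \<beta>^-n.\<close>

lemma pre_translate:
  assumes "v \<in> X" "v' \<in> X" "type v = type v'" "w \<in> pre n v"
  shows "w + (v' - v) / \<beta> ^ n \<in> pre n v'"
  using assms
proof (induction n arbitrary: v v')
  case 0 then show ?case by (auto simp: pre_def)
next
  case (Suc n)
  then obtain u where u: "u \<in> pre 1 v" "w \<in> pre n u" unfolding pre_Suc by auto
  let ?u' = "u + (v' - v) / \<beta>"
  have uX: "u \<in> X" using u unfolding pre_def by auto
  have u': "?u' \<in> pre 1 v' \<and> type ?u' = type u"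
  proof (cases "u = v / \<beta>")
    case True
    then have "?u' = v' / \<beta>" by (simp add: diff_divide_distrib)
    then show ?thesis using True Suc.prems u(1) lo_in_pre_iff type_lo by metis
  next
    case False
    then have e: "u = (v + \<beta> - 1) / \<beta>" using pre_1_cases[OF u(1)] by simp
    then have "?u' = (v' + \<beta> - 1) / \<beta>" by (simp add: diff_divide_distrib add_divide_distrib)
    then show ?thesis using e Suc.prems u(1) hi_in_pre_iff type_hi by metis
  qed
  then have "w + (?u' - u) / \<beta> ^ n \<in> pre n ?u'"
    using Suc.IH[OF uX _ _ u(2), of ?u'] unfolding pre_def by auto
  then have "w + (v' - v) / \<beta> ^ Suc n \<in> pre n ?u'" by (simp add: mult.commute)
  then show ?case unfolding pre_Suc using u' by auto
qed

lemma finite_types: "finite (range type)"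
  by (rule finite_subset[of _ "Pow {..d} \<times> Pow {..d}"]) (auto simp: type_def)

lemma pre_nonempty: "v \<in> X \<Longrightarrow> pre n v \<noteq> {}"
proof (induction n arbitrary: v)
  case 0 then show ?case by (simp add: pre_0)
next
  case (Suc n)
  have "pre 1 v \<noteq> {}"
  proof (cases "v \<ge> 1/2")
    case True
    then have "v / \<beta> ^ 1 \<in> pre 1 v"
      unfolding pre_def using zeros_prependable[OF Suc.prems True, of 1] d_ge by auto
    then show ?thesis by auto
  next
    case False
    then show ?thesis using ones_prependable[OF Suc.prems, of 1] d_ge unfolding pre_def by auto
  qed
  then obtain u where u: "u \<in> pre 1 v" by auto
  then have "pre n u \<noteq> {}" using Suc.IH unfolding pre_def by auto
  then show ?case unfolding pre_Suc using u by auto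
qed

end

section \<open>Tiles as Hausdorff limits\<close>

definition lift :: "real \<Rightarrow> real" where
  "lift x = (if x < 0 then x + 1 else x)"

lemma hausdorff_lim_eqI:
  assumes "compact K" "hausdorff_tendsto A K"
  shows "hausdorff_lim A = K"
  unfolding hausdorff_lim_def
proof (rule the_equality)
  have sub: "L \<subseteq> K'" if "hausdorff_tendsto A L" "hausdorff_tendsto A K'" "compact K'" for L K'
  proof
    fix x assume x: "x \<in> L"
    have "\<exists>y\<in>K'. dist y x < e" if "e > 0" for e
    proof -
      have ev: "\<forall>\<^sub>F n in sequentially.
          (\<forall>a\<in>A n. \<exists>k\<in>S. dist a k < e/2) \<and> (\<forall>k\<in>S. \<exists>a\<in>A n. dist a k < e/2)"
        if "hausdorff_tendsto A S" for S
        using that \<open>e > 0\<close> unfolding hausdorff_tendsto_def by (meson half_gt_zero)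
      from eventually_conj[OF ev[OF \<open>hausdorff_tendsto A L\<close>] ev[OF \<open>hausdorff_tendsto A K'\<close>]]
      obtain n where n: "\<forall>k\<in>L. \<exists>a\<in>A n. dist a k < e/2" "\<forall>a\<in>A n. \<exists>k\<in>K'. dist a k < e/2"
        by (auto simp: eventually_sequentially)
      obtain a where a: "a \<in> A n" "dist a x < e/2" using n(1) x by blast
      obtain k where k: "k \<in> K'" "dist a k < e/2" using n(2) a(1) by blast
      show ?thesis using a k dist_triangle_half_r[of a k e x] by blast
    qed
    then have "x \<in> closure K'" by (simp add: closure_approachable)
    then show "x \<in> K'" using that(3) by (simp add: compact_imp_closed)
  qed
  show "compact K \<and> hausdorff_tendsto A K" using assms ..
  show "L = K" if "compact L \<and> hausdorff_tendsto A L" for L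
    using sub assms that by blast
qed

context bonacci begin

section \<open>Passage between the symmetric and the balanced map\<close>

lemma lift_bij: "bij_betw lift (XS \<beta>) X"
proof (rule bij_betw_byWitness[where f' = "\<lambda>v. if v \<ge> 1/2 then v - 1 else v"])
  show "\<forall>x\<in>XS \<beta>. (if lift x \<ge> 1/2 then lift x - 1 else lift x) = x"
    using beta_gt_1 beta_less_2 by (auto simp: lift_def XS_def XS_neg_def XS_pos_def)
  show "\<forall>v\<in>X. lift (if v \<ge> 1/2 then v - 1 else v) = v"
    using beta_gt_1 beta_less_2 by (auto simp: lift_def XB_def)
  show "lift ` XS \<beta> \<subseteq> X"
    using beta_gt_1 beta_less_2 by (auto simp: lift_def XS_def XS_neg_def XS_pos_def XB_def)
  show "(\<lambda>v. if v \<ge> 1/2 then v - 1 else v) ` X \<subseteq> XS \<beta>"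
    using beta_gt_1 beta_less_2 by (auto simp: XS_def XS_neg_def XS_pos_def XB_def)
qed

lemma lift_in_X: "x \<in> XS \<beta> \<Longrightarrow> lift x \<in> X"
  using lift_bij by (auto simp: bij_betw_def)

text \<open>The integer subtracted by \<open>TS\<close> records the change of sign from x to its
  image: -1 from negative to positive, 0 for none, 1 from positive to negative. After lifting, only
  the sign of x remains visible, and \<open>T\<close> reads the digit 1 exactly when x < 0.\<close>

lemma TS_lift:
  assumes "x \<in> XS \<beta>"
  shows "TS \<beta> x \<in> XS \<beta> \<and> lift (TS \<beta> x) = T (lift x)"
proof -
  consider (neg1) "-1/2 \<le> x" "\<beta> * x < -1/2" | (neg0) "\<beta> * x \<ge> -1/2" "x < \<beta>/2 - 1"
    | (pos0) "x \<ge> 1 - \<beta>/2" "\<beta> * x < 1/2" | (pos1) "x < 1/2" "\<beta> * x \<ge> 1/2"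
  proof -
    have "(-1/2 \<le> x \<and> x < \<beta>/2 - 1) \<or> (x \<ge> 1 - \<beta>/2 \<and> x < 1/2)"
      using assms unfolding XS_def XS_neg_def XS_pos_def by auto
    then show thesis
    proof
      assume "-1/2 \<le> x \<and> x < \<beta>/2 - 1"
      then show thesis using that(1,2) by (cases "\<beta> * x < -1/2") (simp_all only: not_less)
    next
      assume "x \<ge> 1 - \<beta>/2 \<and> x < 1/2"
      then show thesis using that(3,4) by (cases "\<beta> * x < 1/2") (simp_all only: not_less)
    qed
  qed
  then show ?thesis
  proof cases
    case neg1
    have x: "x < 0" using neg1 mult_nonneg_nonneg[of \<beta> x] beta_pos by linarith
    have "\<beta> * (-1/2) \<le> \<beta> * x" using neg1 beta_pos by (intro mult_left_mono) auto
    then have bx: "\<beta> * x \<ge> - \<beta>/2" by simp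
    then have "\<lfloor>\<beta> * x + 1/2\<rfloor> = -1" using neg1 beta_less_2 by (intro floor_unique) auto
    then have "TS \<beta> x = \<beta> * x + 1" unfolding TS_def by simp
    then show ?thesis using neg1 x bx beta_less_2
      by (auto simp: lift_def TB_def XS_def XS_pos_def XS_neg_def algebra_simps)
  next
    case neg0
    have x: "x < 0" using neg0 beta_less_2 by simp
    have "\<beta> * x < 1 * x" using x beta_gt_1 by (intro mult_strict_right_mono_neg) auto
    then have bx: "\<beta> * x < \<beta>/2 - 1" using neg0 by simp
    then have "\<lfloor>\<beta> * x + 1/2\<rfloor> = 0" using neg0 beta_less_2 by (intro floor_unique) auto
    then have TS: "TS \<beta> x = \<beta> * x" unfolding TS_def by simp
    have "-1/2 \<le> x" using assms x beta_less_2 unfolding XS_def XS_pos_def XS_neg_def by auto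
    then show ?thesis using neg0 x bx beta_less_2 TS
      by (auto simp: lift_def TB_def XS_def XS_pos_def XS_neg_def algebra_simps)
  next
    case pos0
    have x: "0 < x" using pos0 beta_less_2 by simp
    have "1 * x < \<beta> * x" using x beta_gt_1 by (intro mult_strict_right_mono) auto
    then have bx: "\<beta> * x \<ge> 1 - \<beta>/2" using pos0 by simp
    then have "\<lfloor>\<beta> * x + 1/2\<rfloor> = 0" using pos0 beta_less_2 by (intro floor_unique) auto
    then have TS: "TS \<beta> x = \<beta> * x" unfolding TS_def by simp
    have "x < 1/2" using assms x beta_less_2 unfolding XS_def XS_pos_def XS_neg_def by auto
    then show ?thesis using pos0 x bx beta_less_2 TS
      by (auto simp: lift_def TB_def XS_def XS_pos_def XS_neg_def algebra_simps)
  next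
    case pos1
    have x: "0 < x" using pos1 mult_nonneg_nonpos[of \<beta> x] beta_pos by linarith
    have "\<beta> * x < \<beta> * (1/2)" using pos1 beta_pos by (intro mult_strict_left_mono) auto
    then have bx: "\<beta> * x < \<beta>/2" by simp
    then have "\<lfloor>\<beta> * x + 1/2\<rfloor> = 1" using pos1 beta_less_2 by (intro floor_unique) auto
    then have TS: "TS \<beta> x = \<beta> * x - 1" unfolding TS_def by simp
    then show ?thesis using pos1 x bx beta_less_2
      by (auto simp: lift_def TB_def XS_def XS_pos_def XS_neg_def algebra_simps)
  qed
qed

lemma TS_iter_lift:
  assumes "x \<in> XS \<beta>"
  shows "(TS \<beta> ^^ n) x \<in> XS \<beta> \<and> lift ((TS \<beta> ^^ n) x) = (T ^^ n) (lift x)"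
  by (induction n) (use assms TS_lift in auto)

lemma lift_TS_preimage:
  assumes "x \<in> XS \<beta>"
  shows "lift ` TS_preimage \<beta> n x = pre n (lift x)"
proof
  show "lift ` TS_preimage \<beta> n x \<subseteq> pre n (lift x)"
    unfolding TS_preimage_def pre_def using TS_iter_lift lift_in_X by auto
  show "pre n (lift x) \<subseteq> lift ` TS_preimage \<beta> n x"
  proof
    fix w assume w: "w \<in> pre n (lift x)"
    then obtain y where y: "y \<in> XS \<beta>" "w = lift y"
      using lift_bij unfolding pre_def bij_betw_def by auto
    then have "lift ((TS \<beta> ^^ n) y) = lift x" using w TS_iter_lift unfolding pre_def by auto
    then have "(TS \<beta> ^^ n) y = x"
      using inj_onD[OF bij_betw_imp_inj_on[OF lift_bij]] TS_iter_lift[OF y(1)] assms by blast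
    then show "w \<in> lift ` TS_preimage \<beta> n x" unfolding TS_preimage_def using y by auto
  qed
qed

lemma lift_class: "lift x - x \<in> {0, 1}"
  unfolding lift_def by simp

lemma lift_in_Z_iff: "lift x \<in> Z\<beta> \<longleftrightarrow> x \<in> Z\<beta>"
  unfolding lift_def using Z_add[OF _ Z_1, of x] Z_diff[OF _ Z_1, of "x + 1"] by auto

end

text \<open>The properties of the Galois embedding on which the geometry of the tiles rests. The
  last two assumptions say that the pairs (x, \<Phi> x), for x in the ring, form a lattice: finitely
  many in bounded sets, and within bounded distance of every point.\<close>

locale bonacci_embedding = bonacci +
  fixes \<Phi> :: "real \<Rightarrow> real ^ 'n" and M :: "real ^ 'n \<Rightarrow> real ^ 'n" and \<theta> :: real
  assumes Phi_add: "x \<in> Z\<beta> \<Longrightarrow> y \<in> Z\<beta> \<Longrightarrow> \<Phi> (x + y) = \<Phi> x + \<Phi> y"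
    and Phi_beta: "x \<in> Z\<beta> \<Longrightarrow> \<Phi> (\<beta> * x) = M (\<Phi> x)"
    and linear_M: "linear M" and inj_M: "inj M"
    and contraction: "norm (M z) \<le> \<theta> * norm z"
    and theta: "0 < \<theta>" "\<theta> < 1"
    and discrete: "finite {x \<in> Z\<beta>. \<bar>x\<bar> \<le> a \<and> norm (\<Phi> x) \<le> b}"
    and relatively_dense: "\<exists>K. \<forall>t z. \<exists>x\<in>Z\<beta>. \<bar>x - t\<bar> \<le> K \<and> norm (\<Phi> x - z) \<le> K"
begin

lemma Phi_0: "\<Phi> 0 = 0"
  using Phi_add[of 0 0] by simp

lemma Phi_diff: "x \<in> Z\<beta> \<Longrightarrow> y \<in> Z\<beta> \<Longrightarrow> \<Phi> (x - y) = \<Phi> x - \<Phi> y"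
  using Phi_add[of "x - y" y] Z_diff by (simp add: algebra_simps)

lemma Phi_pow: "x \<in> Z\<beta> \<Longrightarrow> \<Phi> (\<beta> ^ n * x) = (M ^^ n) (\<Phi> x)"
proof (induction n)
  case (Suc n)
  then show ?case using Phi_beta[OF Z_beta_power_mult[of x n]] by (simp add: mult.assoc)
qed simp

lemma linear_Mn: "linear (M ^^ n)"
  by (induction n) (use linear_compose[OF _ linear_M] in \<open>auto simp: o_def linear_ident\<close>)

lemma inj_Mn: "inj (M ^^ n)"
  by (induction n) (use inj_compose[OF inj_M] in \<open>auto simp: o_def\<close>)

lemma surj_Mn: "surj (M ^^ n)"
  using linear_injective_imp_surjective linear_Mn inj_Mn by blast

lemma Mn_diff: "(M ^^ n) (x - y) = (M ^^ n) x - (M ^^ n) y"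
  using linear_Mn by (rule linear_diff)

lemma norm_Mn: "norm ((M ^^ n) z) \<le> \<theta> ^ n * norm z"
proof (induction n)
  case (Suc n)
  have "norm ((M ^^ Suc n) z) \<le> \<theta> * norm ((M ^^ n) z)" using contraction by simp
  also have "\<dots> \<le> \<theta> * (\<theta> ^ n * norm z)" using Suc theta by (intro mult_left_mono) auto
  finally show ?case by (simp add: mult.assoc)
qed simp

text \<open>Sum of the geometric series with terms
  \<open>\<theta> ^ n * norm (\<Phi> (\<beta> - 1))\<close>, which bound the contributions of the
  digits.\<close>

definition C :: real where
  "C = norm (\<Phi> (\<beta> - 1)) / (1 - \<theta>)"

lemma C_nonneg: "0 \<le> C"
  unfolding C_def using theta by simp

lemma C_theta_tendsto_0: "(\<lambda>n. c * \<theta> ^ n) \<longlonglongrightarrow> 0"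
  using tendsto_mult_left[OF LIMSEQ_power_zero[of \<theta>], of c] theta by simp

text \<open>The bound has the form of a difference so that it telescopes over successive
  digits.\<close>

lemma Phi_step_bound:
  assumes "w \<in> Z\<beta>"
  shows "norm (\<Phi> (\<beta> ^ Suc n * w) - \<Phi> (\<beta> ^ n * T w)) \<le> C * (\<theta> ^ n - \<theta> ^ Suc n)"
proof -
  let ?a = "if w \<ge> 1/2 then \<beta> - 1 else 0"
  have a: "?a \<in> Z\<beta>" using Lam_subset_Z[OF Lam_mult[OF Z_1]] by simp
  have Tw: "T w \<in> Z\<beta>" using T_iter_class[OF assms, of 1] by simp
  have "\<beta> ^ Suc n * w = \<beta> ^ n * T w + \<beta> ^ n * ?a"
    unfolding power_Suc2 mult.assoc beta_mult_of_T[OF refl, of w] distrib_left ..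
  then have "\<Phi> (\<beta> ^ Suc n * w) - \<Phi> (\<beta> ^ n * T w) = \<Phi> (\<beta> ^ n * ?a)"
    using Phi_add[OF Z_beta_power_mult[OF Tw] Z_beta_power_mult[OF a], of n n] by simp
  also have "\<dots> = (M ^^ n) (\<Phi> ?a)" using Phi_pow[OF a] .
  finally have "norm (\<Phi> (\<beta> ^ Suc n * w) - \<Phi> (\<beta> ^ n * T w)) \<le> \<theta> ^ n * norm (\<Phi> ?a)"
    using norm_Mn by simp
  also have "\<dots> \<le> \<theta> ^ n * norm (\<Phi> (\<beta> - 1))"
    using theta by (intro mult_left_mono) (auto simp: Phi_0)
  also have "\<dots> = C * (\<theta> ^ n - \<theta> ^ Suc n)" unfolding C_def using theta by (simp add: field_simps)
  finally show ?thesis .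
qed

lemma Phi_iter_bound:
  assumes "w \<in> Z\<beta>"
  shows "norm (\<Phi> (\<beta> ^ (m + n) * w) - \<Phi> (\<beta> ^ n * (T ^^ m) w)) \<le> C * (\<theta> ^ n - \<theta> ^ (m + n))"
  using assms
proof (induction m arbitrary: w)
  case (Suc m)
  have Tw: "T w \<in> Z\<beta>" using T_iter_class[OF Suc.prems, of 1] by simp
  have "norm (\<Phi> (\<beta> ^ (Suc m + n) * w) - \<Phi> (\<beta> ^ n * (T ^^ Suc m) w))
    \<le> norm (\<Phi> (\<beta> ^ Suc (m + n) * w) - \<Phi> (\<beta> ^ (m + n) * T w))
      + norm (\<Phi> (\<beta> ^ (m + n) * T w) - \<Phi> (\<beta> ^ n * (T ^^ m) (T w)))"
    unfolding funpow_Suc_right comp_apply add_Suc dist_norm[symmetric] by (rule dist_triangle)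
  also have "\<dots> \<le> C * (\<theta> ^ (m + n) - \<theta> ^ Suc (m + n)) + C * (\<theta> ^ n - \<theta> ^ (m + n))"
    by (intro add_mono Phi_step_bound Suc.prems Suc.IH Tw)
  also have "\<dots> = C * (\<theta> ^ n - \<theta> ^ (Suc m + n))" by (simp add: algebra_simps)
  finally show ?case .
qed simp

lemma Phi_iter_bound':
  assumes "w \<in> Z\<beta>"
  shows "norm (\<Phi> (\<beta> ^ (m + n) * w) - \<Phi> (\<beta> ^ n * (T ^^ m) w)) \<le> C * \<theta> ^ n"
proof -
  have "C * (\<theta> ^ n - \<theta> ^ (m + n)) \<le> C * \<theta> ^ n" using C_nonneg theta by (intro mult_left_mono) auto
  then show ?thesis using Phi_iter_bound[OF assms] by (rule order_trans[rotated])
qed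

text \<open>The tile described without a limit: at every depth n the point is within the tail
  \<open>C * \<theta> ^ n\<close> of an approximating point. As an intersection of finite unions of
  balls this set is closed; \<open>hausdorff_lim_Rt\<close> identifies it with the Hausdorff
  limit.\<close>

definition Rt :: "real \<Rightarrow> (real ^ 'n) set" where
  "Rt v = {z. \<forall>n. \<exists>w\<in>pre n v. norm (z - \<Phi> (\<beta> ^ n * w)) \<le> C * \<theta> ^ n}"

lemma Rt_eq_Inter: "Rt v = (\<Inter>n. \<Union>w\<in>pre n v. cball (\<Phi> (\<beta> ^ n * w)) (C * \<theta> ^ n))"
  unfolding Rt_def by (auto simp: dist_norm norm_minus_commute)

lemma closed_approx: "closed (\<Union>w\<in>pre n v. cball (\<Phi> (\<beta> ^ n * w)) (C * \<theta> ^ n))"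
  using finite_pre by (intro closed_UN) auto

lemma Rt_bound: "v \<in> X \<Longrightarrow> z \<in> Rt v \<Longrightarrow> norm (z - \<Phi> v) \<le> C"
  unfolding Rt_def by (auto simp: pre_0 dest!: spec[of _ 0])

lemma compact_Rt: assumes "v \<in> X" shows "compact (Rt v)"
proof -
  have "closed (Rt v)" unfolding Rt_eq_Inter using closed_approx by (intro closed_INT) auto
  moreover have "Rt v \<subseteq> cball (\<Phi> v) C"
    using Rt_bound[OF assms] by (auto simp: dist_norm norm_minus_commute)
  ultimately show ?thesis using bounded_cball bounded_subset compact_eq_bounded_closed by blast
qed

text \<open>A preimage of depth n \<ge> m is truncated to one of depth m with an error of at most C
  \<theta>^m, and the approximating sets are closed. So approximations at arbitrarily large depths
  suffice.\<close>

lemma in_RtI: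
  assumes v: "v \<in> Z\<beta>"
    and approx: "\<And>e m. 0 < e \<Longrightarrow> \<exists>n\<ge>m. \<exists>w\<in>pre n v. norm (z - \<Phi> (\<beta> ^ n * w)) < e"
  shows "z \<in> Rt v"
  unfolding Rt_eq_Inter
proof
  fix m
  let ?S = "\<Union>w\<in>pre m v. cball (\<Phi> (\<beta> ^ m * w)) (C * \<theta> ^ m)"
  have "\<exists>y\<in>?S. dist y z < e" if e: "e > 0" for e
  proof -
    obtain n w where n: "n \<ge> m" "w \<in> pre n v" "norm (z - \<Phi> (\<beta> ^ n * w)) < e"
      using approx[OF e, of m] by blast
    have nm: "n = (n - m) + m" using n(1) by simp
    have "(T ^^ (n - m)) w \<in> pre m v" using pre_funpow[of w "n - m" m v] n(2) nm by simp
    moreover have "norm (\<Phi> (\<beta> ^ n * w) - \<Phi> (\<beta> ^ m * (T ^^ (n - m)) w)) \<le> C * \<theta> ^ m"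
      using Phi_iter_bound'[of w "n - m" m] pre_class[OF v n(2)] nm by simp
    ultimately have "\<Phi> (\<beta> ^ n * w) \<in> ?S" by (auto simp: dist_norm norm_minus_commute[of "\<Phi> (\<beta> ^ n * w)"])
    then show ?thesis using n(3)
      by (intro bexI[of _ "\<Phi> (\<beta> ^ n * w)"]) (auto simp: dist_norm norm_minus_commute)
  qed
  then have "z \<in> closure ?S" by (simp add: closure_approachable)
  then show "z \<in> ?S" using closed_approx closure_closed by blast
qed

lemma eventually_C_theta: "0 < e \<Longrightarrow> \<exists>N. \<forall>n\<ge>N. c * \<theta> ^ n < e"
  using order_tendstoD(2)[OF C_theta_tendsto_0] unfolding eventually_sequentially by blast

text \<open>Words extend indefinitely by \<open>pre_nonempty\<close>; the images of the extensions
  stay in one closed ball and accumulate at a point of the tile.\<close>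

lemma Rt_near_preimage:
  assumes v: "v \<in> X" "v \<in> Z\<beta>" and w: "w \<in> pre n v"
  shows "\<exists>z\<in>Rt v. norm (z - \<Phi> (\<beta> ^ n * w)) \<le> C * \<theta> ^ n"
proof -
  have wX: "w \<in> X" using w unfolding pre_def by simp
  have "\<forall>m. \<exists>u. u \<in> pre m w" using pre_nonempty[OF wX] by blast
  then obtain u where u: "\<And>m. u m \<in> pre m w" by metis
  have wZ: "w \<in> Z\<beta>" using pre_class[OF v(2) w] by simp
  define p where "p m = \<Phi> (\<beta> ^ (m + n) * u m)" for m
  let ?B = "cball (\<Phi> (\<beta> ^ n * w)) (C * \<theta> ^ n)"
  have "p m \<in> ?B" for m
  proof -
    have "(T ^^ m) (u m) = w" "u m \<in> Z\<beta>" using u[of m] pre_class[OF wZ u[of m]] unfolding pre_def by auto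
    then show ?thesis using Phi_iter_bound'[of "u m" m n] unfolding p_def
      by (simp add: dist_norm norm_minus_commute)
  qed
  then obtain z r where z: "z \<in> ?B" "strict_mono r" "(p \<circ> r) \<longlonglongrightarrow> z"
    using compact_cball[of "\<Phi> (\<beta> ^ n * w)" "C * \<theta> ^ n"] unfolding compact_def by blast
  have "z \<in> Rt v"
  proof (rule in_RtI[OF v(2)])
    fix e :: real and m :: nat assume "0 < e"
    then obtain N where N: "\<And>k. k \<ge> N \<Longrightarrow> norm (p (r k) - z) < e"
      using z(3) unfolding LIMSEQ_def by (auto simp: dist_norm)
    let ?k = "max N m"
    have "r ?k \<ge> m" using seq_suble[OF z(2), of ?k] by simp
    then show "\<exists>n\<ge>m. \<exists>w\<in>pre n v. norm (z - \<Phi> (\<beta> ^ n * w)) < e"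
      using N[of ?k] pre_add[OF u[of "r ?k"] w] unfolding p_def
      by (intro exI[of _ "r ?k + n"] conjI bexI[of _ "u (r ?k)"]) (auto simp: norm_minus_commute)
  qed
  then show ?thesis using z(1) by (auto simp: dist_norm norm_minus_commute)
qed

lemma hausdorff_lim_Rt:
  assumes x: "x \<in> XS \<beta>" "x \<in> Z\<beta>"
  shows "hausdorff_lim (\<lambda>n. (\<lambda>y. \<Phi> (\<beta> ^ n * y)) ` TS_preimage \<beta> n x) = Rt (lift x)"
proof (rule hausdorff_lim_eqI)
  have v: "lift x \<in> X" "lift x \<in> Z\<beta>" using lift_in_X[OF x(1)] lift_in_Z_iff x(2) by auto
  show "compact (Rt (lift x))" using compact_Rt[OF v(1)] .
  \<comment> \<open>The tile is defined with the points \<open>y\<close> of \<open>XS\<close>, the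
    set \<open>Rt\<close> with their lifts; the discrepancy 0 or 1 is contracted by
    \<open>M ^^ n\<close>.\<close>
  have diff: "norm (\<Phi> (\<beta> ^ n * y) - \<Phi> (\<beta> ^ n * lift y)) \<le> norm (\<Phi> 1) * \<theta> ^ n"
    if "lift y \<in> Z\<beta>" for n y
  proof -
    let ?b = "lift y - y"
    have b: "?b \<in> Z\<beta>" "norm (\<Phi> ?b) \<le> norm (\<Phi> 1)" using lift_class[of y] by (auto simp: Phi_0)
    have "\<Phi> (\<beta> ^ n * lift y) = \<Phi> (\<beta> ^ n * y) + \<Phi> (\<beta> ^ n * ?b)"
      using Phi_add[OF Z_beta_power_mult[of y n] Z_beta_power_mult[OF b(1), of n]] that lift_in_Z_iff
      by (simp add: algebra_simps)
    then have "norm (\<Phi> (\<beta> ^ n * y) - \<Phi> (\<beta> ^ n * lift y)) = norm ((M ^^ n) (\<Phi> ?b))"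
      using Phi_pow[OF b(1)] by simp
    also have "\<dots> \<le> \<theta> ^ n * norm (\<Phi> ?b)" by (rule norm_Mn)
    also have "\<dots> \<le> \<theta> ^ n * norm (\<Phi> 1)" using b theta by (intro mult_left_mono) auto
    finally show ?thesis by (simp add: mult.commute)
  qed
  let ?c = "C + norm (\<Phi> 1)"
  show "hausdorff_tendsto (\<lambda>n. (\<lambda>y. \<Phi> (\<beta> ^ n * y)) ` TS_preimage \<beta> n x) (Rt (lift x))"
    unfolding hausdorff_tendsto_def
  proof (intro allI impI)
    fix e :: real assume "0 < e"
    then obtain N where N: "\<And>n. n \<ge> N \<Longrightarrow> ?c * \<theta> ^ n < e" using eventually_C_theta by blast
    have dist: "norm (z - \<Phi> (\<beta> ^ n * y)) < e"
      if "norm (z - \<Phi> (\<beta> ^ n * lift y)) \<le> C * \<theta> ^ n" "lift y \<in> Z\<beta>" "n \<ge> N" for z n y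
    proof -
      have "norm (z - \<Phi> (\<beta> ^ n * y)) \<le> norm (z - \<Phi> (\<beta> ^ n * lift y)) + norm (\<Phi> (\<beta> ^ n * lift y) - \<Phi> (\<beta> ^ n * y))"
        using norm_triangle_ineq[of "z - \<Phi> (\<beta> ^ n * lift y)" "\<Phi> (\<beta> ^ n * lift y) - \<Phi> (\<beta> ^ n * y)"] by simp
      also have "\<dots> \<le> ?c * \<theta> ^ n" using that(1) diff[OF that(2), of n] by (simp add: norm_minus_commute distrib_right)
      finally show ?thesis using N[OF that(3)] by simp
    qed
    have "(\<forall>a\<in>(\<lambda>y. \<Phi> (\<beta> ^ n * y)) ` TS_preimage \<beta> n x. \<exists>k\<in>Rt (lift x). dist a k < e) \<and>
        (\<forall>k\<in>Rt (lift x). \<exists>a\<in>(\<lambda>y. \<Phi> (\<beta> ^ n * y)) ` TS_preimage \<beta> n x. dist a k < e)"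
      if n: "n \<ge> N" for n
    proof (intro conjI ballI)
      fix a assume "a \<in> (\<lambda>y. \<Phi> (\<beta> ^ n * y)) ` TS_preimage \<beta> n x"
      then obtain y where y: "y \<in> TS_preimage \<beta> n x" "a = \<Phi> (\<beta> ^ n * y)" by auto
      have w: "lift y \<in> pre n (lift x)" using lift_TS_preimage[OF x(1)] y(1) by blast
      from Rt_near_preimage[OF v w] obtain z where z: "z \<in> Rt (lift x)"
        "norm (z - \<Phi> (\<beta> ^ n * lift y)) \<le> C * \<theta> ^ n" by blast
      then show "\<exists>k\<in>Rt (lift x). dist a k < e"
        using dist[OF z(2) _ n] pre_class[OF v(2) w] y(2) by (auto simp: dist_norm norm_minus_commute)
    next
      fix k assume "k \<in> Rt (lift x)"
      then obtain w where w: "w \<in> pre n (lift x)" "norm (k - \<Phi> (\<beta> ^ n * w)) \<le> C * \<theta> ^ n"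
        unfolding Rt_def by blast
      then obtain y where y: "y \<in> TS_preimage \<beta> n x" "w = lift y" using lift_TS_preimage[OF x(1)] by blast
      have "norm (k - \<Phi> (\<beta> ^ n * y)) < e"
        using dist[OF _ _ n] w y(2) pre_class[OF v(2) w(1)] by blast
      then show "\<exists>a\<in>(\<lambda>y. \<Phi> (\<beta> ^ n * y)) ` TS_preimage \<beta> n x. dist a k < e"
        using y(1) by (auto simp: dist_norm norm_minus_commute)
    qed
    then show "\<forall>\<^sub>F n in sequentially.
       (\<forall>a\<in>(\<lambda>y. \<Phi> (\<beta> ^ n * y)) ` TS_preimage \<beta> n x. \<exists>k\<in>Rt (lift x). dist a k < e) \<and>
        (\<forall>k\<in>Rt (lift x). \<exists>a\<in>(\<lambda>y. \<Phi> (\<beta> ^ n * y)) ` TS_preimage \<beta> n x. dist a k < e)"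
      unfolding eventually_sequentially by blast
  qed
qed

lemma Rt_inflate:
  assumes v: "v \<in> Z\<beta>" and w: "w \<in> pre k v" and z: "z \<in> Rt w"
  shows "(M ^^ k) z \<in> Rt v"
proof (rule in_RtI[OF v])
  fix e :: real and m :: nat assume "0 < e"
  then obtain N where N: "\<And>n. n \<ge> N \<Longrightarrow> C * \<theta> ^ n < e" using eventually_C_theta by blast
  let ?n = "max N m"
  obtain u where u: "u \<in> pre ?n w" "norm (z - \<Phi> (\<beta> ^ ?n * u)) \<le> C * \<theta> ^ ?n"
    using z unfolding Rt_def by blast
  have uZ: "u \<in> Z\<beta>" using pre_class u(1) pre_class[OF v w] by blast
  have "(M ^^ k) z - \<Phi> (\<beta> ^ (?n + k) * u) = (M ^^ k) (z - \<Phi> (\<beta> ^ ?n * u))"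
    unfolding Mn_diff Phi_pow[OF uZ] by (simp add: add.commute funpow_add)
  then have "norm ((M ^^ k) z - \<Phi> (\<beta> ^ (?n + k) * u)) \<le> \<theta> ^ k * norm (z - \<Phi> (\<beta> ^ ?n * u))"
    using norm_Mn by simp
  also have "\<dots> \<le> 1 * norm (z - \<Phi> (\<beta> ^ ?n * u))"
    using theta by (intro mult_right_mono power_le_one) auto
  also have "\<dots> < e" using u(2) N[of ?n] by simp
  finally show "\<exists>n\<ge>m. \<exists>w\<in>pre n v. norm ((M ^^ k) z - \<Phi> (\<beta> ^ n * w)) < e"
    using pre_add[OF u(1) w] by (intro exI[of _ "?n + k"] conjI bexI[of _ u]) auto
qed

text \<open>The deep preimages of \<open>v\<close> approximating \<open>z\<close> are all mapped by
  suitable iterates into the finite set \<open>pre k v\<close>, so some \<open>w\<close> in it is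
  reached for infinitely many depths.\<close>

lemma Rt_subdivide:
  assumes v: "v \<in> Z\<beta>" and z: "z \<in> Rt v"
  shows "\<exists>w\<in>pre k v. \<exists>y\<in>Rt w. z = (M ^^ k) y"
proof -
  obtain y where y: "z = (M ^^ k) y" using surj_Mn[of k] by (metis surjD)
  have "\<forall>n. \<exists>u. u \<in> pre (n + k) v \<and> norm (z - \<Phi> (\<beta> ^ (n + k) * u)) \<le> C * \<theta> ^ (n + k)"
    using z unfolding Rt_def by blast
  then obtain u where u: "\<And>n. u n \<in> pre (n + k) v"
      "\<And>n. norm (z - \<Phi> (\<beta> ^ (n + k) * u n)) \<le> C * \<theta> ^ (n + k)" by metis
  have "(\<lambda>n. (T ^^ n) (u n)) ` UNIV \<subseteq> pre k v" using pre_funpow u(1) by auto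
  then have "finite ((\<lambda>n. (T ^^ n) (u n)) ` UNIV)" using finite_pre finite_subset by blast
  then obtain n0 where n0: "infinite {n \<in> UNIV. (T ^^ n) (u n) = (T ^^ n0) (u n0)}"
    using pigeonhole_infinite[of UNIV "\<lambda>n. (T ^^ n) (u n)"] by auto
  define w where "w = (T ^^ n0) (u n0)"
  have w: "w \<in> pre k v" unfolding w_def using pre_funpow[OF u(1)] .
  \<comment> \<open>Invertibility of \<open>M ^^ k\<close> turns approximation of \<open>z\<close>
    into approximation of \<open>y\<close>.\<close>
  obtain B where B: "B > 0" "\<And>x. B * norm x \<le> norm ((M ^^ k) x)"
    using linear_inj_bounded_below_pos[OF linear_Mn inj_Mn, of k] by blast
  have "y \<in> Rt w"
  proof (rule in_RtI)
    show wZ: "w \<in> Z\<beta>" using pre_class[OF v w] by simp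
    fix e :: real and m :: nat assume "0 < e"
    then obtain N where N: "\<And>n. n \<ge> N \<Longrightarrow> C * \<theta> ^ n < B * e"
      using eventually_C_theta[of "B * e"] B(1) by auto
    obtain n where n: "n \<ge> max N m" "(T ^^ n) (u n) = w"
      using n0[unfolded infinite_nat_iff_unbounded_le, rule_format, of "max N m"] unfolding w_def by auto
    have un: "u n \<in> pre n w" using n(2) u(1)[of n] unfolding pre_def by simp
    have uZ: "u n \<in> Z\<beta>" using pre_class[OF wZ un] by simp
    have "(M ^^ k) (y - \<Phi> (\<beta> ^ n * u n)) = z - \<Phi> (\<beta> ^ (n + k) * u n)"
      unfolding Mn_diff Phi_pow[OF uZ] y by (simp add: add.commute funpow_add)
    then have "B * norm (y - \<Phi> (\<beta> ^ n * u n)) \<le> C * \<theta> ^ (n + k)" 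
      using B(2)[of "y - \<Phi> (\<beta> ^ n * u n)"] u(2)[of n] by simp
    also have "\<dots> < B * e" using N[of "n + k"] n(1) by simp
    finally have "norm (y - \<Phi> (\<beta> ^ n * u n)) < e" using B(1) by simp
    then show "\<exists>n\<ge>m. \<exists>u\<in>pre n w. norm (y - \<Phi> (\<beta> ^ n * u)) < e" using n(1) un by auto
  qed
  then show ?thesis using w y by blast
qed

end

section \<open>Covering, exclusive balls, shapes\<close>

context bonacci begin

definition cls :: "int \<Rightarrow> real set" where
  "cls j = X \<inter> residue_class \<beta> j"

lemma clsD: "v \<in> cls j \<Longrightarrow> v \<in> X" "v \<in> cls j \<Longrightarrow> v \<in> Z\<beta>" "v \<in> cls j \<Longrightarrow> v - of_int j \<in> \<Lambda>"
  unfolding cls_def using residue_class_subset_Z residue_class_iff by auto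

lemma clsI: "v \<in> X \<Longrightarrow> v - of_int j \<in> \<Lambda> \<Longrightarrow> v \<in> cls j"
  unfolding cls_def by (simp add: residue_class_iff)

lemma pre_cls: assumes "v \<in> cls j" "w \<in> pre n v" shows "w \<in> cls j"
proof (rule clsI)
  show "w \<in> X" using assms unfolding pre_def by simp
  show "w - of_int j \<in> \<Lambda>"
    using Lam_add[of "w - v" "v - of_int j"] pre_class[OF clsD(2)[OF assms(1)] assms(2)] clsD(3)[OF assms(1)]
    by simp
qed

lemma T_iter_cls: assumes "w \<in> cls j" shows "(T ^^ n) w \<in> cls j"
proof (rule clsI)
  show "(T ^^ n) w \<in> X" using T_iter_in_X clsD(1)[OF assms] .
  show "(T ^^ n) w - of_int j \<in> \<Lambda>"
    using Lam_add[of "(T ^^ n) w - w" "w - of_int j"] T_iter_class[OF clsD(2)[OF assms], of n] clsD(3)[OF assms]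
    by simp
qed

lemma Lam_d_multiple: "of_int k * (real d - 1) \<in> \<Lambda>"
  using Lam_times_Z[OF d_minus_1_in_Lam Z_of_int[of k]] by (simp add: mult.commute)

lemma Z_class: assumes "x \<in> Z\<beta>" shows "\<exists>h\<in>{1..d - 1}. x - of_int (int h) \<in> \<Lambda>"
proof -
  have "\<exists>j::int. x - of_int j \<in> \<Lambda>" using assms
  proof (induction rule: Z_induct)
    case zero show ?case by (rule exI[of _ 0]) (use Lam_mult[OF Z_0] in simp)
  next
    case (step k y)
    then obtain j :: int where j: "y - of_int j \<in> \<Lambda>" by auto
    have "of_int k + \<beta> * y - of_int (k + j) = (\<beta> * y - y) + (y - of_int j)" by simp
    then show ?case using Lam_add[OF beta_mult_mod_Lam[OF step(1)] j] by metis
  qed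
  then obtain j :: int where j: "x - of_int j \<in> \<Lambda>" ..
  define m where "m = int d - 1"
  have m: "m \<ge> 2" using d_ge unfolding m_def by simp
  \<comment> \<open>Representatives are taken in {1..d - 1}, as for the layers, and not in {0..d -
    2}.\<close>
  define h where "h = nat (1 + (j - 1) mod m)"
  have b: "0 \<le> (j - 1) mod m" "(j - 1) mod m < m" using m by auto
  have h: "int h = 1 + (j - 1) mod m" unfolding h_def using b by simp
  have "j = int h + (j - 1) div m * m" unfolding h by (simp add: minus_mod_eq_div_mult[symmetric])
  then have "real_of_int j = real_of_int (int h + (j - 1) div m * m)" by (rule arg_cong)
  also have "\<dots> = of_int (int h) + of_int ((j - 1) div m) * (real d - 1)" unfolding m_def by simp
  finally have jh: "real_of_int j = of_int (int h) + of_int ((j - 1) div m) * (real d - 1)" .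
  have "x - of_int (int h) = (x - of_int j) + of_int ((j - 1) div m) * (real d - 1)"
    unfolding jh by simp
  then have "x - of_int (int h) \<in> \<Lambda>" using Lam_add[OF j Lam_d_multiple] by metis
  moreover have "h \<in> {1..d - 1}" using h b unfolding m_def by auto
  ultimately show ?thesis by blast
qed

end

context bonacci_embedding begin

lemma Phi_nat_mult: "x \<in> Z\<beta> \<Longrightarrow> \<Phi> (real n * x) = real n *\<^sub>R \<Phi> x"
proof (induction n)
  case (Suc n)
  have "real n * x \<in> Z\<beta>" using Suc Z_mult by simp
  then show ?case using Phi_add[of "real n * x" x] Suc by (simp add: algebra_simps)
qed (simp add: Phi_0)

lemma finite_near: "finite {v \<in> X \<inter> Z\<beta>. norm (\<Phi> v - z) \<le> b}"
proof (rule finite_subset[OF _ discrete[of 1 "b + norm z"]])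
  show "{v \<in> X \<inter> Z\<beta>. norm (\<Phi> v - z) \<le> b} \<subseteq> {x \<in> Z\<beta>. \<bar>x\<bar> \<le> 1 \<and> norm (\<Phi> x) \<le> b + norm z}"
  proof clarsimp
    fix v assume "v \<in> X" "norm (\<Phi> v - z) \<le> b"
    moreover have "norm (\<Phi> v) \<le> norm z + norm (\<Phi> v - z)" by (rule norm_triangle_sub)
    ultimately show "\<bar>v\<bar> \<le> 1 \<and> norm (\<Phi> v) \<le> b + norm z"
      using beta_gt_1 beta_less_2 unfolding XB_def by auto
  qed
qed

lemma Rt_locally_finite: "finite {v \<in> X \<inter> Z\<beta>. Rt v \<inter> ball z r \<noteq> {}}"
proof (rule finite_subset[OF _ finite_near[of z "C + r"]])
  show "{v \<in> X \<inter> Z\<beta>. Rt v \<inter> ball z r \<noteq> {}} \<subseteq> {v \<in> X \<inter> Z\<beta>. norm (\<Phi> v - z) \<le> C + r}"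
  proof clarsimp
    fix v assume v: "v \<in> X" "v \<in> Z\<beta>" "Rt v \<inter> ball z r \<noteq> {}"
    then obtain y where y: "y \<in> Rt v" "dist z y < r" by auto
    have "norm (y - \<Phi> v) \<le> C" using Rt_bound[OF v(1) y(1)] .
    then show "norm (\<Phi> v - z) \<le> C + r"
      using y(2) dist_triangle[of "\<Phi> v" z y] by (simp add: dist_norm norm_minus_commute)
  qed
qed

text \<open>Density of the ring yields points in a real window of unknown length and in no
  prescribed class. The factor d - 1, which lies in the ideal, fixes the class; division by the unit
  \<beta>^m shrinks the window into \<open>X\<close>, at the price of a larger but uniform
  distance.\<close>

lemma cls_relatively_dense: "\<exists>K. \<forall>z. \<exists>v\<in>cls j. norm (\<Phi> v - z) \<le> K"
proof -
  obtain K where K: "\<And>t z. \<exists>x\<in>Z\<beta>. \<bar>x - t\<bar> \<le> K \<and> norm (\<Phi> x - z) \<le> K"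
    using relatively_dense by auto
  define D where "D = real d - 1"
  have D: "D > 0" "D = real (d - 1)" unfolding D_def using d_ge by auto
  obtain m where m: "D * K * 2 / (\<beta> - 1) < \<beta> ^ m" using real_arch_pow[OF beta_gt_1] by blast
  obtain B where B: "B > 0" "\<And>x. B * norm x \<le> norm ((M ^^ m) x)"
    using linear_inj_bounded_below_pos[OF linear_Mn inj_Mn, of m] by blast
  have "\<exists>v\<in>cls j. norm (\<Phi> v - z) \<le> D * (K / B)" for z
  proof -
    \<comment> \<open>With \<open>q'\<close> near \<open>t\<close> and \<open>\<Phi> q'\<close> near
      \<open>y\<close>, the point \<open>v\<close> below is near the midpoint 1/2 of
      \<open>X\<close> and \<open>\<Phi> v\<close> is near \<open>z\<close>.\<close>
    define t where "t = (1/2 - of_int j) / D"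
    define y where "y = (1/D) *\<^sub>R (z - \<Phi> (of_int j))"
    obtain q where q: "q \<in> Z\<beta>" "\<bar>q - \<beta> ^ m * t\<bar> \<le> K" "norm (\<Phi> q - (M ^^ m) y) \<le> K"
      using K by blast
    define q' where "q' = q / \<beta> ^ m"
    have q': "q' \<in> Z\<beta>" "q = \<beta> ^ m * q'" unfolding q'_def using Z_divide_power[OF q(1)] beta_pos by auto
    define v where "v = of_int j + D * q'"
    have cl: "v - of_int j \<in> \<Lambda>"
      unfolding v_def D_def using Lam_times_Z[OF d_minus_1_in_Lam q'(1)] by simp
    have "v - 1/2 = D * (q' - t)" unfolding v_def t_def using D by (simp add: field_simps)
    moreover have "\<beta> ^ m * \<bar>q' - t\<bar> \<le> K"
    proof -
      have "\<beta> ^ m * \<bar>q' - t\<bar> = \<bar>\<beta> ^ m * (q' - t)\<bar>" using beta_pos by (simp add: abs_mult)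
      then show ?thesis using q(2) q'(2) by (simp add: right_diff_distrib)
    qed
    ultimately have "\<beta> ^ m * \<bar>v - 1/2\<bar> \<le> D * K"
      using D by (simp add: abs_mult mult.left_commute)
    also have "\<dots> < \<beta> ^ m * ((\<beta> - 1) / 2)" using m beta_gt_1 by (simp add: field_simps)
    finally have "\<bar>v - 1/2\<bar> < (\<beta> - 1) / 2" using beta_pos by simp
    then have vX: "v \<in> X" unfolding XB_def abs_less_iff by auto
    have Dq: "D * q' \<in> Z\<beta>" using Z_mult[OF _ q'(1), of D] D(2) by simp
    have "\<Phi> v = \<Phi> (of_int j) + D *\<^sub>R \<Phi> q'"
      unfolding v_def using Phi_add[OF Z_of_int Dq] Phi_nat_mult[OF q'(1)] D(2) by simp
    then have "\<Phi> v - z = D *\<^sub>R (\<Phi> q' - y)" unfolding y_def using D(1) by (simp add: algebra_simps)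
    then have "norm (\<Phi> v - z) = D * norm (\<Phi> q' - y)" using D(1) by simp
    moreover have "B * norm (\<Phi> q' - y) \<le> K"
      using B(2)[of "\<Phi> q' - y"] q(3) unfolding Mn_diff q'(2) Phi_pow[OF q'(1)] by simp
    then have "norm (\<Phi> q' - y) \<le> K / B" using B(1) by (simp add: le_divide_eq mult.commute)
    ultimately have "norm (\<Phi> v - z) \<le> D * (K / B)" using D(1) by (simp only: mult_left_mono less_imp_le)
    then show ?thesis using clsI[OF vX cl] by blast
  qed
  then show ?thesis by blast
qed

text \<open>For each n a point \<open>v n\<close> of the class is chosen near the n-th inverse image
  of \<open>z\<close>. The images of its iterates \<open>x n\<close> stay at bounded distance from
  \<open>z\<close>, so the \<open>x n\<close> form a finite set, and a value taken infinitely often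
  has \<open>z\<close> in its tile.\<close>

lemma cls_covers: "\<exists>v\<in>cls j. z \<in> Rt v"
proof -
  obtain K where K: "\<And>z. \<exists>v\<in>cls j. norm (\<Phi> v - z) \<le> K" using cls_relatively_dense by blast
  have K0: "0 \<le> K" using K[of 0] norm_ge_zero order_trans by blast
  have "\<forall>n. \<exists>v y. (M ^^ n) y = z \<and> v \<in> cls j \<and> norm (\<Phi> v - y) \<le> K"
    using K surj_Mn by (metis surjD)
  then obtain v y where vy: "\<And>n. (M ^^ n) (y n) = z" "\<And>n. v n \<in> cls j" "\<And>n. norm (\<Phi> (v n) - y n) \<le> K"
    by metis
  define x where "x n = (T ^^ n) (v n)" for n
  have x: "x n \<in> cls j" for n unfolding x_def using T_iter_cls[OF vy(2)] .
  have near: "norm (\<Phi> (\<beta> ^ n * v n) - z) \<le> K * \<theta> ^ n" for n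
  proof -
    have "\<Phi> (\<beta> ^ n * v n) - z = (M ^^ n) (\<Phi> (v n) - y n)"
      unfolding Mn_diff vy(1) Phi_pow[OF clsD(2)[OF vy(2)]] ..
    then have "norm (\<Phi> (\<beta> ^ n * v n) - z) \<le> \<theta> ^ n * norm (\<Phi> (v n) - y n)" using norm_Mn by simp
    also have "\<dots> \<le> \<theta> ^ n * K" using vy(3) theta by (intro mult_left_mono) auto
    finally show ?thesis by (simp add: mult.commute)
  qed
  have "norm (\<Phi> (x n) - z) \<le> C + K" for n
  proof -
    have "norm (\<Phi> (\<beta> ^ n * v n) - \<Phi> (x n)) \<le> C"
      unfolding x_def using Phi_iter_bound'[OF clsD(2)[OF vy(2)[of n]], of n 0] by simp
    moreover have "K * \<theta> ^ n \<le> K * 1" using K0 theta by (intro mult_left_mono power_le_one) auto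
    ultimately show ?thesis using near[of n]
        norm_triangle_ineq[of "\<Phi> (x n) - \<Phi> (\<beta> ^ n * v n)" "\<Phi> (\<beta> ^ n * v n) - z"]
      by (simp add: norm_minus_commute)
  qed
  then have "range x \<subseteq> {v \<in> X \<inter> Z\<beta>. norm (\<Phi> v - z) \<le> C + K}" using clsD(1,2)[OF x] by auto
  then have "finite (range x)" using finite_near finite_subset by blast
  then obtain n0 where n0: "infinite {n \<in> UNIV. x n = x n0}"
    using pigeonhole_infinite[of UNIV x] by auto
  have "z \<in> Rt (x n0)"
  proof (rule in_RtI[OF clsD(2)[OF x]])
    fix e :: real and m :: nat assume "0 < e"
    then obtain N where N: "\<And>n. n \<ge> N \<Longrightarrow> K * \<theta> ^ n < e" using eventually_C_theta by blast
    obtain n where n: "n \<ge> max N m" "x n = x n0"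
      using n0[unfolded infinite_nat_iff_unbounded_le, rule_format, of "max N m"] by auto
    have "v n \<in> pre n (x n0)" using in_pre_funpow[OF clsD(1)[OF vy(2)[of n]], of n] n(2) unfolding x_def by simp
    moreover have "norm (z - \<Phi> (\<beta> ^ n * v n)) < e"
      using near[of n] N[of n] n(1) by (simp add: norm_minus_commute)
    ultimately show "\<exists>n\<ge>m. \<exists>w\<in>pre n (x n0). norm (z - \<Phi> (\<beta> ^ n * w)) < e" using n(1) by auto
  qed
  then show ?thesis using x by blast
qed

text \<open>A tile of the class that meets the small set does so in a subtile of some
  \<open>w'\<close> whose difference from \<open>w\<close> lies in a finite set. The word of
  \<open>w\<close> synchronizes all these differences, so \<open>w'\<close> is sent to
  \<open>v\<close> too. The depth n is the same for all \<open>v\<close>.\<close>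

lemma exclusive_preimage:
  "\<exists>n. \<forall>j. \<forall>v\<in>cls j. \<exists>w\<in>pre n v. \<forall>v'\<in>cls j. Rt v' \<inter> (M ^^ n) ` ball (\<Phi> w) 1 \<noteq> {} \<longrightarrow> v' = v"
proof -
  \<comment> \<open>The possible differences \<open>w' - w\<close> when the tile of
    \<open>w'\<close>, within \<open>C\<close> of \<open>\<Phi> w'\<close>, meets the unit ball
    about \<open>\<Phi> w\<close>.\<close>
  define F where "F = {u \<in> Z\<beta>. \<bar>u\<bar> \<le> 1 \<and> norm (\<Phi> u) \<le> C + 1} \<inter> \<Lambda>"
  have finF: "finite F" unfolding F_def using discrete by auto
  have "\<forall>u\<in>\<Lambda>. \<exists>c. u = (\<beta> - 1) * ival c" unfolding \<Lambda>_def using Z_ival by fastforce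
  then obtain c where c: "\<And>u. u \<in> \<Lambda> \<Longrightarrow> u = (\<beta> - 1) * ival (c u)" by metis
  define N where "N = (\<Sum>u\<in>F. weight (c u))"
  have wN: "weight (c u) \<le> N" if "u \<in> F" for u
    unfolding N_def using finF that by (intro member_le_sum) auto
  let ?n = "2 * d * N + 2"
  have "\<exists>w\<in>pre ?n v. \<forall>v'\<in>cls j. Rt v' \<inter> (M ^^ ?n) ` ball (\<Phi> w) 1 \<noteq> {} \<longrightarrow> v' = v"
    if v: "v \<in> cls j" for j v
  proof -
    obtain w where w: "w \<in> X" "(T ^^ ?n) w = v" and
      sync: "\<And>w' c. w' \<in> X \<Longrightarrow> w' - w = (\<beta> - 1) * ival c \<Longrightarrow> weight c \<le> N \<Longrightarrow> (T ^^ ?n) w' = v"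
      using synchronizing_preimage[OF clsD(1)[OF v], of N] by blast
    have wp: "w \<in> pre ?n v" unfolding pre_def using w by simp
    have wc: "w \<in> cls j" using pre_cls[OF v wp] .
    have "v' = v" if v': "v' \<in> cls j" and ne: "Rt v' \<inter> (M ^^ ?n) ` ball (\<Phi> w) 1 \<noteq> {}" for v'
    proof -
      obtain p where p: "(M ^^ ?n) p \<in> Rt v'" "norm (\<Phi> w - p) < 1" using ne by (auto simp: dist_norm)
      obtain w' y where w': "w' \<in> pre ?n v'" "y \<in> Rt w'" "(M ^^ ?n) p = (M ^^ ?n) y"
        using Rt_subdivide[OF clsD(2)[OF v'] p(1)] by blast
      have "y = p" using w'(3) inj_Mn by (metis injD)
      have w'c: "w' \<in> cls j" using pre_cls[OF v' w'(1)] .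
      have "norm (p - \<Phi> w') \<le> C" using Rt_bound[OF clsD(1)[OF w'c]] w'(2) \<open>y = p\<close> by simp
      then have "norm (\<Phi> (w' - w)) \<le> C + 1"
        using p(2) norm_triangle_ineq[of "\<Phi> w' - p" "p - \<Phi> w"]
        unfolding Phi_diff[OF clsD(2)[OF w'c] clsD(2)[OF wc]] by (simp add: norm_minus_commute)
      moreover have L: "w' - w \<in> \<Lambda>" using Lam_diff[OF clsD(3)[OF w'c] clsD(3)[OF wc]] by simp
      moreover have "\<bar>w' - w\<bar> \<le> 1"
        using X_diff_less[OF clsD(1)[OF wc] clsD(1)[OF w'c]] X_diff_less[OF clsD(1)[OF w'c] clsD(1)[OF wc]]
          beta_less_2 by auto
      ultimately have "w' - w \<in> F" unfolding F_def using Lam_subset_Z by auto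
      then have "(T ^^ ?n) w' = v" using sync[OF clsD(1)[OF w'c] c[OF L] wN] by simp
      then show ?thesis using w'(1) unfolding pre_def by simp
    qed
    then show ?thesis using wp by blast
  qed
  then show ?thesis by blast
qed

lemma open_Mn_image: "open S \<Longrightarrow> open ((M ^^ n) ` S)"
  using open_surjective_linear_image linear_Mn surj_Mn by blast

text \<open>Each point of the exclusive set is in some tile of the class by
  \<open>cls_covers\<close>, and exclusivity leaves only the tile of \<open>v\<close>: the set lies
  inside it.\<close>

lemma exclusive_ball:
  "\<exists>n. \<forall>j. \<forall>v\<in>cls j. \<exists>p. (M ^^ n) ` ball p 1 \<subseteq> Rt v \<and>
     (\<forall>v'\<in>cls j. Rt v' \<inter> (M ^^ n) ` ball p 1 \<noteq> {} \<longrightarrow> v' = v)"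
proof -
  obtain n where n: "\<And>j v. v \<in> cls j \<Longrightarrow> \<exists>w\<in>pre n v. \<forall>v'\<in>cls j. Rt v' \<inter> (M ^^ n) ` ball (\<Phi> w) 1 \<noteq> {} \<longrightarrow> v' = v"
    using exclusive_preimage by blast
  have "\<exists>p. (M ^^ n) ` ball p 1 \<subseteq> Rt v \<and>
     (\<forall>v'\<in>cls j. Rt v' \<inter> (M ^^ n) ` ball p 1 \<noteq> {} \<longrightarrow> v' = v)" if v: "v \<in> cls j" for j v
  proof -
    obtain w where w: "\<And>v'. v' \<in> cls j \<Longrightarrow> Rt v' \<inter> (M ^^ n) ` ball (\<Phi> w) 1 \<noteq> {} \<Longrightarrow> v' = v"
      using n[OF v] by blast
    have "(M ^^ n) ` ball (\<Phi> w) 1 \<subseteq> Rt v"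
    proof
      fix y assume y: "y \<in> (M ^^ n) ` ball (\<Phi> w) 1"
      obtain v' where "v' \<in> cls j" "y \<in> Rt v'" using cls_covers by blast
      then show "y \<in> Rt v" using w[of v'] y by blast
    qed
    then show ?thesis using w by blast
  qed
  then show ?thesis by blast
qed

text \<open>A point of the tile lies in subtiles of diameter at most 2 C \<theta>^k, and each of
  these has interior points by \<open>exclusive_ball\<close>.\<close>

lemma Rt_closure_interior:
  assumes v: "v \<in> X" "v \<in> Z\<beta>"
  shows "Rt v = closure (interior (Rt v))"
proof
  show "closure (interior (Rt v)) \<subseteq> Rt v"
    using compact_imp_closed[OF compact_Rt[OF v(1)]] interior_subset[of "Rt v"]
    by (intro closure_minimal)
  obtain h where h: "v - of_int (int h) \<in> \<Lambda>" using Z_class[OF v(2)] by blast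
  then have vc: "v \<in> cls (int h)" using v by (intro clsI)
  obtain n where n: "\<forall>j. \<forall>v\<in>cls j. \<exists>p. (M ^^ n) ` ball p 1 \<subseteq> Rt v \<and>
     (\<forall>v'\<in>cls j. Rt v' \<inter> (M ^^ n) ` ball p 1 \<noteq> {} \<longrightarrow> v' = v)"
    using exclusive_ball ..
  show "Rt v \<subseteq> closure (interior (Rt v))"
  proof
    fix z assume z: "z \<in> Rt v"
    have "\<exists>y\<in>interior (Rt v). dist y z < e" if e: "e > 0" for e
    proof -
      obtain k where k: "2 * C * \<theta> ^ k < e" using eventually_C_theta[OF e] by blast
      obtain w y where w: "w \<in> pre k v" "y \<in> Rt w" "z = (M ^^ k) y"
        using Rt_subdivide[OF v(2) z] by blast
      have wc: "w \<in> cls (int h)" using pre_cls[OF vc w(1)] .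
      obtain p where p: "(M ^^ n) ` ball p 1 \<subseteq> Rt w" using n[rule_format, OF wc] by blast
      let ?q = "(M ^^ n) p"
      have q: "?q \<in> Rt w" using p by auto
      have sub: "(M ^^ k) ` (M ^^ n) ` ball p 1 \<subseteq> Rt v"
        using p Rt_inflate[OF v(2) w(1)] by blast
      have "(M ^^ k) ?q \<in> (M ^^ k) ` (M ^^ n) ` ball p 1" by simp
      then have int: "(M ^^ k) ?q \<in> interior (Rt v)"
        using interior_maximal[OF sub] open_Mn_image open_ball by blast
      have "norm ((M ^^ k) ?q - z) \<le> \<theta> ^ k * norm (?q - y)"
        unfolding w(3) Mn_diff[symmetric] by (rule norm_Mn)
      also have "\<dots> \<le> \<theta> ^ k * (2 * C)"
        using Rt_bound[OF clsD(1)[OF wc] q] Rt_bound[OF clsD(1)[OF wc] w(2)] theta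
          norm_triangle_ineq4[of "?q - \<Phi> w" "y - \<Phi> w"]
        by (intro mult_left_mono) auto
      also have "\<dots> < e" using k by (simp add: mult.commute)
      finally show ?thesis using int by (auto simp: dist_norm)
    qed
    then show "z \<in> closure (interior (Rt v))" by (simp add: closure_approachable)
  qed
qed

section \<open>Shapes up to translation\<close>

lemma Rt_translate_subset:
  assumes v: "v \<in> X" "v \<in> Z\<beta>" and v': "v' \<in> X" "v' \<in> Z\<beta>" and t: "type v = type v'"
    and z: "z \<in> Rt v"
  shows "\<Phi> v' - \<Phi> v + z \<in> Rt v'"
  unfolding Rt_def
proof (intro CollectI allI)
  fix n
  obtain w where w: "w \<in> pre n v" "norm (z - \<Phi> (\<beta> ^ n * w)) \<le> C * \<theta> ^ n" using z unfolding Rt_def by blast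
  let ?w = "w + (v' - v) / \<beta> ^ n"
  have wZ: "w \<in> Z\<beta>" using pre_class[OF v(2) w(1)] by simp
  have "\<beta> ^ n * ?w = \<beta> ^ n * w + (v' - v)" using beta_pos by (simp add: distrib_left)
  then have "\<Phi> (\<beta> ^ n * ?w) = \<Phi> (\<beta> ^ n * w) + (\<Phi> v' - \<Phi> v)"
    using Phi_add[OF Z_beta_power_mult[OF wZ, of n] Z_diff[OF v'(2) v(2)]] Phi_diff[OF v'(2) v(2)] by simp
  then have "\<Phi> v' - \<Phi> v + z - \<Phi> (\<beta> ^ n * ?w) = z - \<Phi> (\<beta> ^ n * w)" by simp
  then show "\<exists>w\<in>pre n v'. norm (\<Phi> v' - \<Phi> v + z - \<Phi> (\<beta> ^ n * w)) \<le> C * \<theta> ^ n"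
    using w(2) pre_translate[OF v(1) v'(1) t w(1)] by metis
qed

lemma Rt_translate:
  assumes v: "v \<in> X" "v \<in> Z\<beta>" and v': "v' \<in> X" "v' \<in> Z\<beta>" and t: "type v = type v'"
  shows "Rt v' = (\<lambda>s. (\<Phi> v' - \<Phi> v) + s) ` Rt v"
proof
  show "(\<lambda>s. (\<Phi> v' - \<Phi> v) + s) ` Rt v \<subseteq> Rt v'" using Rt_translate_subset[OF v v' t] by blast
  show "Rt v' \<subseteq> (\<lambda>s. (\<Phi> v' - \<Phi> v) + s) ` Rt v"
  proof
    fix z assume "z \<in> Rt v'"
    from Rt_translate_subset[OF v' v t[symmetric] this]
    show "z \<in> (\<lambda>s. (\<Phi> v' - \<Phi> v) + s) ` Rt v"
      by (intro image_eqI[of _ _ "\<Phi> v - \<Phi> v' + z"]) auto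
  qed
qed

lemma Rt_finitely_many_shapes:
  "\<exists>\<S>. finite \<S> \<and> (\<forall>v\<in>X \<inter> Z\<beta>. \<exists>S\<in>\<S>. \<exists>t. Rt v = (\<lambda>s. t + s) ` S)"
proof -
  define r where "r \<tau> = (SOME v. v \<in> X \<inter> Z\<beta> \<and> type v = \<tau>)" for \<tau>
  have r: "r (type v) \<in> X \<inter> Z\<beta> \<and> type (r (type v)) = type v" if "v \<in> X \<inter> Z\<beta>" for v
    unfolding r_def using that by (intro someI_ex[of "\<lambda>u. u \<in> X \<inter> Z\<beta> \<and> type u = type v"]) auto
  have "\<exists>S\<in>(Rt \<circ> r) ` range type. \<exists>t. Rt v = (\<lambda>s. t + s) ` S" if "v \<in> X \<inter> Z\<beta>" for v
    using Rt_translate[of "r (type v)" v] r[OF that] that by auto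
  then show ?thesis using finite_types by (intro exI[of _ "(Rt \<circ> r) ` range type"]) auto
qed

end

section \<open>Overlaps are null sets\<close>

lemma emeasure_lborel_bounded:
  fixes S :: "'a::euclidean_space set"
  assumes "bounded S" "S \<in> sets borel"
  shows "emeasure lborel S = ennreal (measure lebesgue S)"
proof -
  have "emeasure lborel S = ennreal (measure lborel S)"
    using emeasure_bounded_finite[OF assms(1)] by (intro emeasure_eq_ennreal_measure) auto
  then show ?thesis using assms(2) by simp
qed

lemma borel_translate_Int:
  fixes A B :: "'a::euclidean_space set"
  assumes "A \<in> sets borel" "B \<in> sets borel"
  shows "{t \<in> B. z + t \<in> A} \<in> sets borel"
proof -
  have "(+) z -` A \<inter> space borel \<in> sets borel"
    using assms(1) by (intro measurable_sets[of "(+) z" borel borel]) auto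
  moreover have "{t \<in> B. z + t \<in> A} = B \<inter> ((+) z -` A \<inter> space borel)" by auto
  ultimately show ?thesis using assms(2) by (metis sets.Int)
qed

text \<open>By Fubini, \<open>\<mu>(A) \<mu>(B)\<close> is the integral over \<open>z\<close> of the measure of the points of \<open>A\<close> in
  \<open>z + B\<close>, which is at most \<open>q \<mu>(B)\<close> and vanishes unless \<open>z\<close> is close to \<open>A\<close>.\<close>

lemma measure_convolution_bound:
  fixes A B N :: "'a::euclidean_space set"
  assumes A: "A \<in> sets borel" and B: "B \<in> sets borel" and N: "N \<in> sets borel"
    and le: "\<And>z. emeasure lborel {t \<in> B. z + t \<in> A} \<le> q * emeasure lborel B"
    and out: "\<And>z t. t \<in> B \<Longrightarrow> z + t \<in> A \<Longrightarrow> z \<in> N"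
  shows "emeasure lborel A * emeasure lborel B \<le> q * emeasure lborel B * emeasure lborel N"
proof -
  let ?f = "\<lambda>z t. indicator A (z + t) * indicator B t :: ennreal"
  have meas: "case_prod ?f \<in> borel_measurable (lborel \<Otimes>\<^sub>M lborel)"
    using A B by measurable
  have shift: "(\<integral>\<^sup>+ z. indicator A (z + t) \<partial>lborel) = emeasure lborel A" for t
  proof -
    have "(\<integral>\<^sup>+ z. indicator A (z + t) \<partial>lborel) = (\<integral>\<^sup>+ z. indicator A z \<partial>distr lborel borel ((+) t))"
      using A by (subst nn_integral_distr) (auto simp: add.commute)
    then show ?thesis using A by (simp add: lborel_distr_plus)
  qed
  have "emeasure lborel A * emeasure lborel B = (\<integral>\<^sup>+ t. emeasure lborel A * indicator B t \<partial>lborel)"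
    using B by (simp add: nn_integral_cmult)
  also have "\<dots> = (\<integral>\<^sup>+ t. (\<integral>\<^sup>+ z. ?f z t \<partial>lborel) \<partial>lborel)"
    using A by (intro nn_integral_cong) (simp add: nn_integral_multc shift)
  also have "\<dots> = (\<integral>\<^sup>+ z. (\<integral>\<^sup>+ t. ?f z t \<partial>lborel) \<partial>lborel)"
    using lborel_pair.Fubini'[OF meas] .
  also have "\<dots> \<le> (\<integral>\<^sup>+ z. q * emeasure lborel B * indicator N z \<partial>lborel)"
  proof (rule nn_integral_mono)
    fix z :: 'a
    have S: "{t \<in> B. z + t \<in> A} \<in> sets lborel" using borel_translate_Int[OF A B] by simp
    have "(\<integral>\<^sup>+ t. ?f z t \<partial>lborel) = (\<integral>\<^sup>+ t. indicator {t \<in> B. z + t \<in> A} t \<partial>lborel)"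
      by (intro nn_integral_cong) (auto simp: indicator_def)
    also have "\<dots> = emeasure lborel {t \<in> B. z + t \<in> A}" using S by simp
    also have "\<dots> \<le> q * emeasure lborel B * indicator N z"
    proof (cases "z \<in> N")
      case True then show ?thesis using le by simp
    next
      case False
      then have "{t \<in> B. z + t \<in> A} = {}" using out by auto
      then have "emeasure lborel {t \<in> B. z + t \<in> A} = 0" by (simp only: emeasure_empty)
      then show ?thesis by (simp only: zero_le)
    qed
    finally show "(\<integral>\<^sup>+ t. ?f z t \<partial>lborel) \<le> q * emeasure lborel B * indicator N z" .
  qed
  also have "\<dots> = q * emeasure lborel B * emeasure lborel N" using N by (simp add: nn_integral_cmult)
  finally show ?thesis .
qed

text \<open>The convolution bound gives \<mu>(A) \<le> q \<mu>(N) for the closed neighbourhoods N of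
  A. These decrease to A, so \<mu>(A) \<le> q \<mu>(A) with \<mu>(A) finite. The test sets B may
  have any shape, which suits images of balls under \<open>M ^^ k\<close>.\<close>

lemma porous_compact_null:
  fixes A :: "'a::euclidean_space set"
  assumes "compact A" and q: "0 \<le> q" "q < 1"
    and porous: "\<And>r. r > 0 \<Longrightarrow> \<exists>B. open B \<and> B \<noteq> {} \<and> B \<subseteq> ball 0 r \<and>
        (\<forall>z. measure lebesgue {t \<in> B. z + t \<in> A} \<le> q * measure lebesgue B)"
  shows "emeasure lborel A = 0"
proof (cases "A = {}")
  case False
  define N where "N n = {z. infdist z A \<le> 1 / Suc n}" for n :: nat
  have Acl: "closed A" "bounded A" using assms(1) by (auto simp: compact_imp_closed compact_imp_bounded)
  have Ncl: "closed (N n)" for n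
    unfolding N_def by (intro closed_Collect_le continuous_intros)
  have Nbd: "bounded (N n)" for n
  proof -
    obtain R where R: "\<And>a. a \<in> A \<Longrightarrow> norm a \<le> R" using Acl(2) unfolding bounded_iff by auto
    have "norm z \<le> R + 1" if "z \<in> N n" for z
    proof -
      obtain a where a: "a \<in> A" "infdist z A = dist z a"
        using infdist_attains_inf[OF Acl(1) False] by blast
      have "dist z a \<le> 1" using that a(2) unfolding N_def
        by (auto intro: order_trans[of _ "1 / (1 + real n)"])
      then show ?thesis using R[OF a(1)] norm_triangle_sub[of z a] by (simp add: dist_norm)
    qed
    then show ?thesis unfolding bounded_iff by blast
  qed
  have le: "emeasure lborel A \<le> ennreal q * emeasure lborel (N n)" for n
  proof -
    obtain B where B: "open B" "B \<noteq> {}" "B \<subseteq> ball 0 (1 / Suc n)"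
      "\<And>z. measure lebesgue {t \<in> B. z + t \<in> A} \<le> q * measure lebesgue B"
      using porous[of "1 / Suc n"] of_nat_0_less_iff zero_less_Suc zero_less_divide_1_iff by blast
    have Bbd: "bounded B" using B(3) bounded_ball bounded_subset by blast
    have conv: "emeasure lborel A * emeasure lborel B \<le> ennreal q * emeasure lborel B * emeasure lborel (N n)"
    proof (rule measure_convolution_bound)
      fix z
      have S: "{t \<in> B. z + t \<in> A} \<in> sets borel" using B(1) Acl(1) by (intro borel_translate_Int) auto
      have "bounded {t \<in> B. z + t \<in> A}" using Bbd by (rule bounded_subset) auto
      then show "emeasure lborel {t \<in> B. z + t \<in> A} \<le> ennreal q * emeasure lborel B"
        using B(4)[of z] S Bbd B(1) q by (simp add: emeasure_lborel_bounded ennreal_mult[symmetric] ennreal_leI)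
      fix t assume t: "t \<in> B" "z + t \<in> A"
      have "infdist z A \<le> dist z (z + t)" using t(2) by (rule infdist_le)
      also have "\<dots> < 1 / Suc n" using B(3) t(1) by (auto simp: dist_norm)
      finally show "z \<in> N n" unfolding N_def by simp
    qed (use Acl B(1) Ncl in auto)
    have B0: "emeasure lborel B \<noteq> 0"
    proof
      assume "emeasure lborel B = 0"
      then have "B \<in> null_sets lborel" using B(1) by (intro null_setsI) auto
      then have "negligible B" unfolding negligible_iff_null_sets by (rule null_sets_completionI)
      then show False using open_not_negligible B(1,2) by blast
    qed
    have "emeasure lborel B \<noteq> top" using emeasure_bounded_finite[OF Bbd] by auto
    moreover have "emeasure lborel B * emeasure lborel A
        \<le> emeasure lborel B * (ennreal q * emeasure lborel (N n))"
      using conv by (simp only: ac_simps)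
    ultimately show ?thesis using ennreal_mult_le_mult_iff[OF B0] by blast
  qed
  have dec: "decseq N"
  proof (rule decseq_SucI)
    fix n
    have "1 / real (Suc (Suc n)) \<le> 1 / Suc n" by (intro frac_le) auto
    then show "N (Suc n) \<subseteq> N n" unfolding N_def by force
  qed
  have "emeasure lborel A = emeasure lborel (\<Inter>n. N n)"
  proof -
    have "z \<in> A" if "\<forall>n. z \<in> N n" for z
    proof -
      have "infdist z A \<le> 1 / Suc n" for n using that unfolding N_def by auto
      then have "infdist z A \<le> 0"
        by (intro LIMSEQ_le_const[OF LIMSEQ_inverse_real_of_nat]) (auto simp: inverse_eq_divide)
      then show ?thesis using in_closed_iff_infdist_zero[OF Acl(1) False] infdist_nonneg[of z A] by simp
    qed
    then have "(\<Inter>n. N n) = A" unfolding N_def by auto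
    then show ?thesis by simp
  qed
  also have "\<dots> = (INF n. emeasure lborel (N n))"
  proof (rule INF_emeasure_decseq[symmetric])
    show "range N \<subseteq> sets lborel" using Ncl by auto
    show "decseq N" by (rule dec)
    show "emeasure lborel (N i) \<noteq> \<infinity>" for i using emeasure_bounded_finite[OF Nbd, of i] by auto
  qed
  finally have eq: "emeasure lborel A = (INF n. emeasure lborel (N n))" .
  have tend: "(\<lambda>n. emeasure lborel (N n)) \<longlonglongrightarrow> emeasure lborel A"
    unfolding eq using Ncl dec by (intro LIMSEQ_INF decseq_emeasure) auto
  have "(\<lambda>n. ennreal q * emeasure lborel (N n)) \<longlonglongrightarrow> ennreal q * emeasure lborel A"
    by (intro ennreal_tendsto_cmult tend) simp
  then have le': "emeasure lborel A \<le> ennreal q * emeasure lborel A"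
    by (rule LIMSEQ_le_const) (use le in auto)
  have A: "emeasure lborel A = ennreal (measure lebesgue A)"
    using Acl by (intro emeasure_lborel_bounded) auto
  have "measure lebesgue A \<le> q * measure lebesgue A"
    using le' unfolding A using q by (simp add: ennreal_mult[symmetric])
  then have "(1 - q) * measure lebesgue A \<le> 0" by (simp add: algebra_simps)
  then have "measure lebesgue A \<le> 0" using q by (simp add: mult_le_0_iff)
  then show ?thesis unfolding A by (simp add: measure_le_0_iff ennreal_eq_0_iff)
qed simp

lemma porous_closed_null:
  fixes E :: "'a::euclidean_space set"
  assumes "closed E" and q: "0 \<le> q" "q < 1"
    and porous: "\<And>r. r > 0 \<Longrightarrow> \<exists>B. open B \<and> B \<noteq> {} \<and> B \<subseteq> ball 0 r \<and>
        (\<forall>z. measure lebesgue {t \<in> B. z + t \<in> E} \<le> q * measure lebesgue B)"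
  shows "E \<in> null_sets lborel"
proof -
  have "E \<inter> cball 0 (real n) \<in> null_sets lborel" for n
  proof -
    have "emeasure lborel (E \<inter> cball 0 (real n)) = 0"
    proof (rule porous_compact_null[OF _ q])
      show "compact (E \<inter> cball 0 (real n))" using assms(1) by (intro closed_Int_compact) auto
      fix r :: real assume "r > 0"
      then obtain B where B: "open B" "B \<noteq> {}" "B \<subseteq> ball 0 r"
        "\<And>z. measure lebesgue {t \<in> B. z + t \<in> E} \<le> q * measure lebesgue B" using porous by blast
      have Bm: "B \<in> lmeasurable" using B(1,3) by (intro lmeasurable_open bounded_subset[OF bounded_ball])
      have "measure lebesgue {t \<in> B. z + t \<in> E \<inter> cball 0 (real n)} \<le> q * measure lebesgue B" for z
      proof -
        have m: "{t \<in> B. z + t \<in> E} \<in> sets lborel" "{t \<in> B. z + t \<in> E \<inter> cball 0 (real n)} \<in> sets lborel"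
          using borel_translate_Int[of E B z] borel_translate_Int[of "E \<inter> cball 0 (real n)" B z] B(1) assms(1)
          by auto
        have "measure lebesgue {t \<in> B. z + t \<in> E \<inter> cball 0 (real n)} \<le> measure lebesgue {t \<in> B. z + t \<in> E}"
          using m by (intro measure_mono_fmeasurable fmeasurableI2[OF Bm]) auto
        then show ?thesis using B(4)[of z] by simp
      qed
      then show "\<exists>B. open B \<and> B \<noteq> {} \<and> B \<subseteq> ball 0 r \<and>
        (\<forall>z. measure lebesgue {t \<in> B. z + t \<in> E \<inter> cball 0 (real n)} \<le> q * measure lebesgue B)"
        using B by blast
    qed
    then show ?thesis using assms(1) by (intro null_setsI) auto
  qed
  then have "(\<Union>n. E \<inter> cball 0 (real n)) \<in> null_sets lborel" by (intro null_sets_UN) 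
  moreover have "(\<Union>n. E \<inter> cball 0 (real n)) = E" using real_arch_simple by (auto simp: dist_norm)
  ultimately show ?thesis by simp
qed

section \<open>Overlaps inside one class\<close>

context bonacci_embedding begin

definition overlap :: "int \<Rightarrow> (real ^ 'n) set" where
  "overlap j = {z. \<exists>v\<in>cls j. \<exists>v'\<in>cls j. v \<noteq> v' \<and> z \<in> Rt v \<and> z \<in> Rt v'}"

text \<open>A locally finite union of closed sets is closed.\<close>

lemma closed_overlap: "closed (overlap j)"
proof -
  have "z \<in> overlap j" if z: "z \<in> closure (overlap j)" for z
  proof -
    define V where "V = {v \<in> X \<inter> Z\<beta>. Rt v \<inter> ball z 1 \<noteq> {}}"
    have finV: "finite V" unfolding V_def by (rule Rt_locally_finite)
    define P where "P = {(v, v') \<in> V \<times> V. v \<in> cls j \<and> v' \<in> cls j \<and> v \<noteq> v'}"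
    have finP: "finite P" unfolding P_def 
      by (rule finite_subset[OF _ finite_cartesian_product[OF finV finV]]) blast
    define F where "F = (\<Union>p\<in>P. Rt (fst p) \<inter> Rt (snd p))"
    have "closed F" unfolding F_def
    proof (rule closed_UN[OF finP], rule ballI)
      fix p assume "p \<in> P"
      then have "fst p \<in> X" "snd p \<in> X" unfolding P_def V_def by auto
      then show "closed (Rt (fst p) \<inter> Rt (snd p))"
        using compact_imp_closed compact_Rt by (intro closed_Int) auto
    qed
    moreover have "overlap j \<inter> ball z 1 \<subseteq> F"
    proof
      fix y assume y: "y \<in> overlap j \<inter> ball z 1"
      then obtain v v' where v: "v \<in> cls j" "v' \<in> cls j" "v \<noteq> v'" "y \<in> Rt v" "y \<in> Rt v'"
        unfolding overlap_def by auto
      then have "(v, v') \<in> P" unfolding P_def V_def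
        using y clsD(1,2)[OF v(1)] clsD(1,2)[OF v(2)] by blast
      then show "y \<in> F" unfolding F_def using v by force
    qed
    ultimately have sub: "closure (overlap j \<inter> ball z 1) \<subseteq> F" by (simp add: closure_minimal)
    have "z \<in> closure (overlap j \<inter> ball z 1)"
      unfolding closure_approachable
    proof (intro allI impI)
      fix e :: real assume "0 < e"
      then have "min e 1 > 0" by simp
      then obtain y where "y \<in> overlap j" "dist y z < min e 1" using z unfolding closure_approachable by blast
      then show "\<exists>y\<in>overlap j \<inter> ball z 1. dist y z < e" by (auto simp: dist_commute)
    qed
    then have "z \<in> F" using sub by blast
    then show ?thesis unfolding F_def P_def overlap_def by auto
  qed
  then show ?thesis using closure_subset_eq by blast
qed

text \<open>Distinct points have disjoint preimage sets, so subdividing both tiles again yields two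
  distinct tiles with a common point. In this way a hole of the overlap at one scale produces holes
  at all smaller scales.\<close>

lemma overlap_deflate: assumes "(M ^^ k) y \<in> overlap j" shows "y \<in> overlap j"
proof -
  obtain v v' where v: "v \<in> cls j" "v' \<in> cls j" "v \<noteq> v'" "(M ^^ k) y \<in> Rt v" "(M ^^ k) y \<in> Rt v'"
    using assms unfolding overlap_def by auto
  obtain w y1 where w: "w \<in> pre k v" "y1 \<in> Rt w" "(M ^^ k) y = (M ^^ k) y1"
    using Rt_subdivide[OF clsD(2)[OF v(1)] v(4)] by blast
  obtain w' y2 where w': "w' \<in> pre k v'" "y2 \<in> Rt w'" "(M ^^ k) y = (M ^^ k) y2"
    using Rt_subdivide[OF clsD(2)[OF v(2)] v(5)] by blast
  have "y1 = y" "y2 = y" using w(3) w'(3) inj_Mn[of k] by (auto dest: injD)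
  moreover have "w \<noteq> w'" using w(1) w'(1) v(3) unfolding pre_def by auto
  ultimately show ?thesis unfolding overlap_def
    using w(2) w'(2) pre_cls[OF v(1) w(1)] pre_cls[OF v(2) w'(1)] by blast
qed

text \<open>One configuration, the ball of radius \<open>\<rho>\<close> with a hole that is a
  translate of \<open>G\<close>, is transported by \<open>M ^^ k\<close>. The proportion of the hole
  in \<open>B\<close> is therefore bounded below independently of k.\<close>

lemma overlap_null: "overlap j \<in> null_sets lborel"
proof -
  obtain n where n: "\<forall>j. \<forall>v\<in>cls j. \<exists>p. (M ^^ n) ` ball p 1 \<subseteq> Rt v \<and>
     (\<forall>v'\<in>cls j. Rt v' \<inter> (M ^^ n) ` ball p 1 \<noteq> {} \<longrightarrow> v' = v)"
    using exclusive_ball ..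
  define G where "G = (M ^^ n) ` ball 0 1"
  \<comment> \<open>Two points of one tile are at most 2 C apart, so the hole of a tile lies in the
    ball of radius \<open>\<rho>\<close> about any point of that tile.\<close>
  define \<rho> where "\<rho> = 2 * C + 1"
  have \<rho>: "\<rho> > 0" unfolding \<rho>_def using C_nonneg by simp
  have G: "open G" unfolding G_def by (intro open_Mn_image open_ball)
  have G0: "0 \<in> G" unfolding G_def using linear_0[OF linear_Mn] by (metis centre_in_ball image_eqI zero_less_one)
  have Gball: "(M ^^ n) ` ball p 1 = (+) ((M ^^ n) p) ` G" for p
  proof -
    have "(M ^^ n) ` ball p 1 = (M ^^ n) ` (+) p ` ball 0 1"
      using ball_translation[of p 0 1] by simp
    also have "\<dots> = (+) ((M ^^ n) p) ` G"
      unfolding G_def image_image linear_add[OF linear_Mn] ..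
    finally show ?thesis .
  qed
  have cover: "cball 0 \<rho> \<subseteq> (\<Union>x. (+) x ` G)" using G0 by force
  have op: "open ((+) x ` G)" for x using G by (rule open_translation)
  obtain F0 where F0: "finite F0" "cball 0 \<rho> \<subseteq> (\<Union>x\<in>F0. (+) x ` G)"
    by (rule compactE_image[OF compact_cball op cover])
  \<comment> \<open>This many translates of \<open>G\<close> cover the ball of radius
    \<open>\<rho>\<close>, also after applying \<open>M ^^ k\<close>; hence the hole takes up at
    least the fraction 1/m.\<close>
  define m where "m = real (card F0)"
  have "F0 \<noteq> {}" using F0(2) \<rho> by auto
  then have m: "m \<ge> 1" unfolding m_def using F0(1) by (simp add: Suc_leI card_gt_0_iff)
  show ?thesis
  proof (rule porous_closed_null[OF closed_overlap, of "1 - 1/m"])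
    show "0 \<le> 1 - 1/m" "1 - 1/m < 1" using m by auto
    fix r :: real assume r: "r > 0"
    obtain k where k: "\<rho> * \<theta> ^ k < r" using eventually_C_theta[OF r] by blast
    define B where "B = (M ^^ k) ` ball 0 \<rho>"
    define Gk where "Gk = (M ^^ k) ` G"
    have B: "open B" "B \<noteq> {}" "B \<subseteq> ball 0 r"
    proof -
      show "open B" unfolding B_def by (intro open_Mn_image open_ball)
      show "B \<noteq> {}" unfolding B_def using \<rho> by simp
      have "norm ((M ^^ k) x) < r" if "norm x < \<rho>" for x
      proof -
        have "norm ((M ^^ k) x) \<le> \<theta> ^ k * norm x" by (rule norm_Mn)
        also have "\<dots> \<le> \<theta> ^ k * \<rho>" using that theta by (intro mult_left_mono) auto
        finally show ?thesis using k by (simp add: mult.commute)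
      qed
      then show "B \<subseteq> ball 0 r" unfolding B_def by auto
    qed
    have bG: "bounded G" unfolding G_def using bounded_linear_image[OF bounded_ball] linear_Mn linear_conv_bounded_linear by blast
    have bGk: "bounded Gk" unfolding Gk_def using bounded_linear_image[OF bG] linear_Mn linear_conv_bounded_linear by blast
    have oGk: "open Gk" unfolding Gk_def using G by (rule open_Mn_image)
    have Bm: "B \<in> lmeasurable" using B(1,3) by (intro lmeasurable_open bounded_subset[OF bounded_ball])
    have Gm: "Gk \<in> lmeasurable" using bGk oGk by (rule lmeasurable_open)
    have shift: "(M ^^ k) ` (+) x ` G = (+) ((M ^^ k) x) ` Gk" for x
      unfolding Gk_def image_image linear_add[OF linear_Mn] ..
    have "B \<subseteq> (\<Union>x\<in>F0. (+) ((M ^^ k) x) ` Gk)"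
      unfolding B_def shift[symmetric] image_UN[symmetric]
      by (rule image_mono[OF order_trans[OF ball_subset_cball F0(2)]])
    then have "measure lebesgue B \<le> measure lebesgue (\<Union>x\<in>F0. (+) ((M ^^ k) x) ` Gk)"
      using Bm Gm F0(1) by (intro measure_mono_fmeasurable fmeasurable.finite_UN) (auto intro: measurable_translation fmeasurableD)
    also have "\<dots> \<le> (\<Sum>x\<in>F0. measure lebesgue ((+) ((M ^^ k) x) ` Gk))"
      using Gm F0(1) by (intro measure_UNION_le) (auto intro: measurable_translation fmeasurableD)
    also have "\<dots> = m * measure lebesgue Gk" unfolding measure_translation m_def by simp
    finally have mB: "measure lebesgue B \<le> m * measure lebesgue Gk" .
    have "measure lebesgue {t \<in> B. z + t \<in> overlap j} \<le> (1 - 1/m) * measure lebesgue B" for z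
    proof -
      obtain y where y: "z = (M ^^ k) y" using surj_Mn[of k] by (metis surjD)
      obtain v where v: "v \<in> cls j" "y \<in> Rt v" using cls_covers by blast
      from n[THEN spec, THEN bspec, OF v(1)]
      obtain p where p: "(M ^^ n) ` ball p 1 \<subseteq> Rt v"
        "\<forall>v'\<in>cls j. Rt v' \<inter> (M ^^ n) ` ball p 1 \<noteq> {} \<longrightarrow> v' = v"
        by (elim exE conjE)
      \<comment> \<open>Position of the exclusive set of the tile of \<open>v\<close> as seen from
        \<open>y\<close>, since \<open>t\<close> is measured from \<open>z\<close>.\<close>
      define a where "a = (M ^^ n) p - y"
      have hole: "y + (a + g) \<in> Rt v \<and> y + (a + g) \<notin> overlap j" if "g \<in> G" for g
      proof -
        have mem: "y + (a + g) \<in> (M ^^ n) ` ball p 1" unfolding Gball a_def using that by auto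
        then have "v' = v" if "v' \<in> cls j" "y + (a + g) \<in> Rt v'" for v' using p(2) that by blast
        then have "y + (a + g) \<notin> overlap j" unfolding overlap_def by auto
        then show ?thesis using p(1) mem by blast
      qed
      define H where "H = (+) ((M ^^ k) a) ` Gk"
      have HB: "H \<subseteq> B"
      proof
        fix x assume "x \<in> H"
        then obtain g where g: "g \<in> G" "x = (M ^^ k) (a + g)" unfolding H_def shift[symmetric] by auto
        have "norm (y + (a + g) - \<Phi> v) \<le> C" "norm (y - \<Phi> v) \<le> C"
          using Rt_bound[OF clsD(1)[OF v(1)]] hole[OF g(1)] v(2) by auto
        then have "norm (a + g) < \<rho>"
          using norm_triangle_ineq4[of "y + (a + g) - \<Phi> v" "y - \<Phi> v"] unfolding \<rho>_def by simp
        then show "x \<in> B" unfolding B_def g(2) by auto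
      qed
      have sub: "{t \<in> B. z + t \<in> overlap j} \<subseteq> B - H"
      proof clarsimp
        fix t assume t: "t \<in> B" "z + t \<in> overlap j" "t \<in> H"
        then obtain g where g: "g \<in> G" "t = (M ^^ k) (a + g)" unfolding H_def shift[symmetric] by auto
        have "z + t = (M ^^ k) (y + (a + g))" unfolding y g(2) by (simp only: linear_add[OF linear_Mn])
        then show False using overlap_deflate[of k "y + (a + g)"] t(2) hole[OF g(1)] by simp
      qed
      have Hm: "H \<in> lmeasurable" unfolding H_def using Gm by (rule measurable_translation)
      have "{t \<in> B. z + t \<in> overlap j} \<in> sets lborel"
        using B(1) closed_overlap[of j] borel_translate_Int[of "overlap j" B z] by auto
      then have "measure lebesgue {t \<in> B. z + t \<in> overlap j} \<le> measure lebesgue (B - H)"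
        using sub Bm Hm by (intro measure_mono_fmeasurable) auto
      also have "\<dots> = measure lebesgue B - measure lebesgue H"
        using Bm Hm HB by (intro measurable_measure_Diff) (auto intro: fmeasurableD)
      also have "measure lebesgue H = measure lebesgue Gk" unfolding H_def by (rule measure_translation)
      also have "measure lebesgue B - measure lebesgue Gk \<le> measure lebesgue B - measure lebesgue B / m"
        using mB m by (simp add: divide_le_eq mult.commute)
      finally show ?thesis by (simp add: algebra_simps)
    qed
    then show "\<exists>B. open B \<and> B \<noteq> {} \<and> B \<subseteq> ball 0 r \<and>
        (\<forall>z. measure lebesgue {t \<in> B. z + t \<in> overlap j} \<le> (1 - 1/m) * measure lebesgue B)"
      using B by blast
  qed
qed

lemma AE_exactly_one: "AE z in lborel. card {v \<in> cls j. z \<in> Rt v} = 1"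
proof (rule AE_I'[OF overlap_null[of j]])
  show "{z \<in> space lborel. card {v \<in> cls j. z \<in> Rt v} \<noteq> 1} \<subseteq> overlap j"
  proof clarsimp
    fix z assume c: "card {v \<in> cls j. z \<in> Rt v} \<noteq> Suc 0"
    show "z \<in> overlap j"
    proof (rule ccontr)
      assume no: "z \<notin> overlap j"
      obtain v where v: "v \<in> cls j" "z \<in> Rt v" using cls_covers by blast
      then have "{v \<in> cls j. z \<in> Rt v} = {v}" using no unfolding overlap_def by auto
      then show False using c by simp
    qed
  qed
qed

end

section \<open>The embedding by Galois conjugates\<close>

context bonacci begin

text \<open>The sum of the inverse powers is strictly decreasing in the base, so it equals 1 only
  once.\<close>

lemma positive_root_unique:
  fixes s t :: real
  assumes "s > 0" "s ^ d = (\<Sum>i<d. s ^ i)" "t > 0" "t ^ d = (\<Sum>i<d. t ^ i)"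
  shows "s = t"
proof -
  have less: False if st: "a < b" and a: "a > 0" "a ^ d = (\<Sum>i<d. a ^ i)" and b: "b > 0" "b ^ d = (\<Sum>i<d. b ^ i)"
    for a b :: real
  proof -
    have "(\<Sum>i\<in>{1..d}. (1/b) ^ i) < (\<Sum>i\<in>{1..d}. (1/a) ^ i)"
      using st a b d_ge by (intro sum_strict_mono power_strict_mono frac_less2) auto
    then show False using root_sum_inverse_powers[OF a] root_sum_inverse_powers[OF b] by simp
  qed
  then show ?thesis using assms less[of s t] less[of t s] by (meson linorder_neqE)
qed

text \<open>For norm t \<ge> 1, the form z^d (2 - z) = 1 of the equation and the triangle inequality
  for the sum of powers give |2 - z| \<le> 2 - t. This forces z to be the real number t, and \<beta>
  is the only positive root.\<close>

lemma conjugate_norm_less_1: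
  fixes z :: complex
  assumes root: "z ^ d = (\<Sum>i<d. z ^ i)" and ne: "z \<noteq> of_real \<beta>"
  shows "norm z < 1"
proof (rule ccontr)
  assume "\<not> norm z < 1"
  define t where "t = norm z"
  have t: "t \<ge> 1" using \<open>\<not> norm z < 1\<close> unfolding t_def by simp
  have "z ^ d - 1 = (z - 1) * z ^ d" unfolding power_diff_1_eq root[symmetric] ..
  then have "z ^ d * (2 - z) = 1" by (simp add: algebra_simps)
  then have "norm (z ^ d * (2 - z)) = 1" by simp
  then have prod: "t ^ d * norm (2 - z) = 1" unfolding t_def by (simp add: norm_mult norm_power)
  have "norm (2::complex) \<le> norm (2 - z) + norm z" using norm_triangle_ineq[of "2 - z" z] by simp
  then have tri: "2 - t \<le> norm (2 - z)" unfolding t_def by simp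
  have "t ^ d = norm (\<Sum>i<d. z ^ i)" unfolding t_def root[symmetric] by (simp add: norm_power)
  also have "\<dots> \<le> (\<Sum>i<d. t ^ i)" unfolding t_def norm_power[symmetric] by (rule norm_sum)
  finally have "(t - 1) * t ^ d \<le> (t - 1) * (\<Sum>i<d. t ^ i)" using t by (intro mult_left_mono) auto
  then have "(t - 1) * t ^ d \<le> t ^ d - 1" unfolding power_diff_1_eq .
  then have "t ^ d * norm (2 - z) \<le> t ^ d * (2 - t)" using prod by (simp add: algebra_simps)
  then have "norm (2 - z) \<le> 2 - t" using t by simp
  then have "2 - Re z \<le> 2 - t" using complex_Re_le_cmod[of "2 - z"] by simp
  then have Re: "Re z = t" using complex_Re_le_cmod[of z] unfolding t_def by simp
  have "(Re z)\<^sup>2 + (Im z)\<^sup>2 = t\<^sup>2" unfolding t_def by (simp add: cmod_power2)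
  then have "Im z = 0" unfolding Re by simp
  then have z: "z = of_real t" using Re by (simp add: complex_eq_iff)
  have "complex_of_real (t ^ d) = of_real (\<Sum>i<d. t ^ i)" using root unfolding z by simp
  then have "t ^ d = (\<Sum>i<d. t ^ i)" by (simp only: of_real_eq_iff)
  then have "t = \<beta>" using positive_root_unique[of t \<beta>] t beta_pos beta_pow_d by simp
  then show False using ne z by simp
qed

end

locale bonacci_conjugates = bonacci +
  fixes e :: nat and \<gamma> :: "nat \<Rightarrow> complex" and \<sigma> :: "nat \<Rightarrow> real \<Rightarrow> complex" and \<iota> :: "'n::finite \<Rightarrow> nat"
  assumes conj_enum: "conjugate_enumeration d \<beta> e \<gamma>"
    and iso: "\<And>j. j \<in> {1..d - e - 1} \<Longrightarrow>
           field_iso_on (rat_field_adjoin \<beta>) (rat_field_adjoin (\<gamma> j)) (\<sigma> j) \<and> \<sigma> j \<beta> = \<gamma> j"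
    and iota: "bij_betw \<iota> (UNIV :: 'n set) {1..d - 1}"
begin

abbreviation "J \<equiv> {1..d - e - 1}"

lemma e_less: "2 * e < d"
  using conj_enum unfolding conjugate_enumeration_def by simp

lemma gamma_nonreal: "j \<in> {1..e} \<Longrightarrow> \<gamma> j \<notin> \<real>"
  using conj_enum unfolding conjugate_enumeration_def by (metis (no_types, lifting) Un_iff image_eqI mem_Collect_eq)

lemma gamma_real: "j \<in> {e + 1..d - e - 1} \<Longrightarrow> \<gamma> j \<in> \<real> \<and> \<gamma> j \<noteq> of_real \<beta>"
proof -
  assume "j \<in> {e + 1..d - e - 1}"
  then have "\<gamma> j \<in> \<gamma> ` {e + 1..d - e - 1}" by (rule imageI)
  then show ?thesis using conj_enum unfolding conjugate_enumeration_def by simp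
qed

lemma gamma_inj: "inj_on \<gamma> J"
  using conj_enum unfolding conjugate_enumeration_def by simp

lemma gamma_cnj_disjoint: "\<gamma> ` {1..e} \<inter> cnj ` \<gamma> ` {1..e} = {}"
  using conj_enum unfolding conjugate_enumeration_def by simp

lemma J_cases: assumes "j \<in> J" obtains "j \<in> {1..e}" | "j \<in> {e + 1..d - e - 1}"
  using assms by (cases "j \<le> e") auto

lemma gamma_ne_beta: "j \<in> J \<Longrightarrow> \<gamma> j \<noteq> of_real \<beta>"
  by (erule J_cases) (metis gamma_nonreal Reals_of_real, simp add: gamma_real)

lemma Z_subset_field: "x \<in> Z\<beta> \<Longrightarrow> x \<in> rat_field_adjoin \<beta>"
proof -
  assume "x \<in> Z\<beta>"
  then obtain p :: "int poly" where p: "x = poly (map_poly of_int p) \<beta>" unfolding int_adjoin_def by auto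
  have "map_poly of_rat (map_poly of_int p) = (map_poly of_int p :: real poly)"
    by (intro poly_eqI) (simp add: coeff_map_poly)
  then have "x = poly (map_poly of_rat (map_poly of_int p)) \<beta> / poly (map_poly of_rat (1 :: rat poly)) \<beta>"
    using p by simp
  moreover have "poly (map_poly of_rat (1 :: rat poly)) \<beta> \<noteq> 0" by simp
  ultimately show ?thesis unfolding rat_field_adjoin_def by blast
qed

context
  fixes j assumes j: "j \<in> J"
begin

lemma sigma_add: "x \<in> Z\<beta> \<Longrightarrow> y \<in> Z\<beta> \<Longrightarrow> \<sigma> j (x + y) = \<sigma> j x + \<sigma> j y"
  using iso[OF j] Z_subset_field unfolding field_iso_on_def by blast

lemma sigma_mult: "x \<in> Z\<beta> \<Longrightarrow> y \<in> Z\<beta> \<Longrightarrow> \<sigma> j (x * y) = \<sigma> j x * \<sigma> j y"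
  using iso[OF j] Z_subset_field unfolding field_iso_on_def by blast

lemma sigma_1: "\<sigma> j 1 = 1" and sigma_beta: "\<sigma> j \<beta> = \<gamma> j"
  using iso[OF j] unfolding field_iso_on_def by auto

lemma sigma_0: "\<sigma> j 0 = 0"
  using sigma_add[of 0 0] by simp

lemma sigma_sum: "finite A \<Longrightarrow> (\<And>i. i \<in> A \<Longrightarrow> f i \<in> Z\<beta>) \<Longrightarrow> \<sigma> j (sum f A) = (\<Sum>i\<in>A. \<sigma> j (f i))"
  by (induction A rule: finite_induct) (auto simp: sigma_0 sigma_add Z_sum)

lemma sigma_power: "x \<in> Z\<beta> \<Longrightarrow> \<sigma> j (x ^ n) = \<sigma> j x ^ n"
  by (induction n) (auto simp: sigma_1 sigma_mult Z_power)

lemma sigma_uminus: "x \<in> Z\<beta> \<Longrightarrow> \<sigma> j (- x) = - \<sigma> j x"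
  using sigma_add[of x "- x"] Z_uminus sigma_0 by (simp add: eq_neg_iff_add_eq_0 add.commute)

lemma sigma_of_int: "\<sigma> j (of_int k) = of_int k"
proof -
  have nat: "\<sigma> j (of_nat n) = of_nat n" for n
    by (induction n) (use sigma_0 sigma_1 sigma_add in auto)
  show ?thesis
    by (cases k) (use nat sigma_uminus[OF Z_of_nat] in \<open>auto simp del: of_nat_Suc\<close>)
qed

lemma gamma_root: "\<gamma> j ^ d = (\<Sum>i<d. \<gamma> j ^ i)"
proof -
  have "\<gamma> j ^ d = \<sigma> j (\<Sum>i<d. \<beta> ^ i)" unfolding beta_pow_d[symmetric] sigma_power[OF Z_beta] sigma_beta ..
  also have "\<dots> = (\<Sum>i<d. \<gamma> j ^ i)"
    using sigma_sum[of "{..<d}" "\<lambda>i. \<beta> ^ i"] Z_power[OF Z_beta] by (simp add: sigma_power sigma_beta)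
  finally show ?thesis .
qed

lemma gamma_norm: "norm (\<gamma> j) < 1"
  using conjugate_norm_less_1[OF gamma_root gamma_ne_beta[OF j]] .

lemma sigma_inverse_beta: "\<sigma> j (1/\<beta>) * \<gamma> j = 1"
  using sigma_mult[OF Z_inverse_beta Z_beta] beta_pos by (simp add: sigma_1 sigma_beta)

lemma gamma_nonzero: "\<gamma> j \<noteq> 0"
  using sigma_inverse_beta by auto

lemma sigma_ival: "\<sigma> j (ival c) = (\<Sum>i\<in>{1..d}. of_int (c i) * (1 / \<gamma> j) ^ i)"
proof -
  have inv: "\<sigma> j (1/\<beta>) = 1 / \<gamma> j" using sigma_inverse_beta gamma_nonzero by (simp add: field_simps)
  have "\<sigma> j (ival c) = (\<Sum>i\<in>{1..d}. \<sigma> j (of_int (c i) * (1/\<beta>) ^ i))"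
    unfolding ival_def by (rule sigma_sum) (auto intro!: Z_mult Z_power Z_inverse_beta)
  also have "\<dots> = (\<Sum>i\<in>{1..d}. of_int (c i) * (1 / \<gamma> j) ^ i)"
    by (intro sum.cong refl)
       (simp only: sigma_mult[OF Z_of_int Z_power[OF Z_inverse_beta]] sigma_of_int sigma_power[OF Z_inverse_beta] inv)
  finally show ?thesis .
qed

end

section \<open>Vectors as tuples of conjugates\<close>

definition asm :: "(nat \<Rightarrow> complex) \<Rightarrow> real ^ 'n" where
  "asm u = (\<chi> i. if \<iota> i \<le> e then Re (u (\<iota> i)) else if \<iota> i \<le> 2 * e then Im (u (\<iota> i - e))
     else Re (u (\<iota> i - e)))"

definition \<kappa> :: "nat \<Rightarrow> 'n" where
  "\<kappa> = inv_into UNIV \<iota>"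

text \<open>Inverse of \<open>asm\<close> on tuples that are real beyond \<open>e\<close>. Component
  j > e sits at position j + e, because each of the first \<open>e\<close> components occupies two
  positions.\<close>

definition cc :: "real ^ 'n \<Rightarrow> nat \<Rightarrow> complex" where
  "cc z j = (if j \<le> e then Complex (z $ \<kappa> j) (z $ \<kappa> (j + e)) else of_real (z $ \<kappa> (j + e)))"

lemma embed_eq_asm: "embed e \<sigma> \<iota> x = asm (\<lambda>j. \<sigma> j x)"
  unfolding embed_def asm_def ..

lemma iota_range: "\<iota> i \<in> {1..d - 1}"
  using iota unfolding bij_betw_def by blast

lemma iota_kappa: "k \<in> {1..d - 1} \<Longrightarrow> \<iota> (\<kappa> k) = k"
  unfolding \<kappa>_def using iota by (metis bij_betw_def f_inv_into_f)

lemma kappa_iota: "\<kappa> (\<iota> i) = i"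
  unfolding \<kappa>_def using iota by (metis bij_betw_def inv_into_f_f UNIV_I)

lemma asm_cc: "asm (cc z) = z"
proof (rule vec_eq_iff[THEN iffD2, rule_format])
  fix i
  show "asm (cc z) $ i = z $ i"
    unfolding asm_def cc_def using kappa_iota[of i] by auto
qed

lemma cc_asm:
  assumes "j \<in> J" "j \<le> e \<or> Im (u j) = 0"
  shows "cc (asm u) j = u j"
proof (cases "j \<le> e")
  case True
  have "\<iota> (\<kappa> j) = j" "\<iota> (\<kappa> (j + e)) = j + e"
    using assms(1) True e_less by (auto intro!: iota_kappa)
  then show ?thesis using True assms(1) unfolding cc_def asm_def by (simp add: complex_eq_iff)
next
  case False
  have "\<iota> (\<kappa> (j + e)) = j + e" using assms(1) False e_less by (intro iota_kappa) auto
  then show ?thesis using False assms unfolding cc_def asm_def by (simp add: complex_eq_iff)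
qed

lemma Im_cc: "\<not> j \<le> e \<Longrightarrow> Im (cc z j) = 0"
  unfolding cc_def by simp

lemma asm_cong: assumes "\<And>j. j \<in> J \<Longrightarrow> u j = u' j" shows "asm u = asm u'"
proof (rule vec_eq_iff[THEN iffD2, rule_format])
  fix i
  have "\<iota> i \<in> J" if "\<iota> i \<le> e" using iota_range[of i] e_less that by auto
  moreover have "\<iota> i - e \<in> J" if "\<not> \<iota> i \<le> e" using iota_range[of i] e_less that by auto
  ultimately show "asm u $ i = asm u' $ i" unfolding asm_def using assms by auto
qed

lemma asm_add: "asm (\<lambda>j. u j + u' j) = asm u + asm u'"
  unfolding asm_def by (simp add: vec_eq_iff)

lemma asm_scaleR: "asm (\<lambda>j. r *\<^sub>R u j) = r *\<^sub>R asm u"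
  unfolding asm_def by (simp add: vec_eq_iff)

lemma cc_add: "cc (z + z') j = cc z j + cc z' j"
  unfolding cc_def by (simp add: complex_eq_iff)

lemma cc_scaleR: "cc (r *\<^sub>R z) j = r *\<^sub>R cc z j"
  unfolding cc_def by (simp add: complex_eq_iff)

lemma norm_asm:
  "(norm (asm u))\<^sup>2 = (\<Sum>j\<in>{1..e}. (norm (u j))\<^sup>2) + (\<Sum>j\<in>{e + 1..d - e - 1}. (Re (u j))\<^sup>2)"
proof -
  define g where "g k = (if k \<le> e then Re (u k) else if k \<le> 2 * e then Im (u (k - e)) else Re (u (k - e)))" for k
  have "(norm (asm u))\<^sup>2 = (\<Sum>i\<in>UNIV. (asm u $ i)\<^sup>2)"
    unfolding norm_vec_def L2_set_def by (simp add: sum_nonneg)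
  also have "\<dots> = (\<Sum>i\<in>UNIV. (g (\<iota> i))\<^sup>2)" unfolding asm_def g_def by simp
  also have "\<dots> = (\<Sum>k\<in>{1..d - 1}. (g k)\<^sup>2)" by (rule sum.reindex_bij_betw[OF iota])
  also have "{1..d - 1} = ({1..e} \<union> {e + 1..2 * e}) \<union> {2 * e + 1..d - 1}" using e_less by auto
  also have "(\<Sum>k\<in>\<dots>. (g k)\<^sup>2) = (\<Sum>k\<in>{1..e}. (g k)\<^sup>2) + (\<Sum>k\<in>{e + 1..2 * e}. (g k)\<^sup>2)
      + (\<Sum>k\<in>{2 * e + 1..d - 1}. (g k)\<^sup>2)"
    by (subst sum.union_disjoint; (subst sum.union_disjoint)?) auto
  also have "(\<Sum>k\<in>{1..e}. (g k)\<^sup>2) = (\<Sum>j\<in>{1..e}. (Re (u j))\<^sup>2)" unfolding g_def by simp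
  also have "(\<Sum>k\<in>{e + 1..2 * e}. (g k)\<^sup>2) = (\<Sum>j\<in>{1..e}. (Im (u j))\<^sup>2)"
    by (rule sum.reindex_bij_witness[of _ "\<lambda>j. j + e" "\<lambda>k. k - e"]) (auto simp: g_def)
  also have "(\<Sum>k\<in>{2 * e + 1..d - 1}. (g k)\<^sup>2) = (\<Sum>j\<in>{e + 1..d - e - 1}. (Re (u j))\<^sup>2)"
    by (rule sum.reindex_bij_witness[of _ "\<lambda>j. j + e" "\<lambda>k. k - e"]) (use e_less in \<open>auto simp: g_def\<close>)
  finally show ?thesis by (simp add: cmod_power2 sum.distrib)
qed

abbreviation "\<Phi> \<equiv> embed e \<sigma> \<iota>"

text \<open>Multiplication by the conjugate in each component. Being diagonal, it contracts the
  Euclidean norm itself.\<close>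

definition M :: "real ^ 'n \<Rightarrow> real ^ 'n" where
  "M z = asm (\<lambda>j. \<gamma> j * cc z j)"

text \<open>Inserting 1/2 makes the maximum visibly positive.\<close>

definition \<theta> :: real where
  "\<theta> = Max (insert (1/2) ((\<lambda>j. norm (\<gamma> j)) ` J))"

lemma theta_props: "0 < \<theta>" "\<theta> < 1" "\<And>j. j \<in> J \<Longrightarrow> norm (\<gamma> j) \<le> \<theta>"
proof -
  have fin: "finite (insert (1/2) ((\<lambda>j. norm (\<gamma> j)) ` J))" by simp
  have "1/2 \<le> \<theta>" unfolding \<theta>_def using fin by (intro Max_ge) auto
  then show "0 < \<theta>" by simp
  show "\<theta> < 1" unfolding \<theta>_def using fin gamma_norm by (subst Max_less_iff) auto
  show "norm (\<gamma> j) \<le> \<theta>" if "j \<in> J" for j unfolding \<theta>_def using fin that by (intro Max_ge) auto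
qed

lemma Im_gamma: "j \<in> J \<Longrightarrow> \<not> j \<le> e \<Longrightarrow> Im (\<gamma> j) = 0"
  using gamma_real[of j] complex_is_Real_iff by auto

lemma cc_M: "j \<in> J \<Longrightarrow> cc (M z) j = \<gamma> j * cc z j"
  unfolding M_def by (rule cc_asm) (simp, metis Im_gamma Im_cc mult_zero_left mult_zero_right add_0 times_complex.sel(2))

lemma linear_M: "linear M"
  by (rule linearI)
     (auto simp: M_def cc_add cc_scaleR asm_add[symmetric] asm_scaleR[symmetric] distrib_left)

lemma inj_M: "inj M"
proof (rule injI)
  fix z z' assume eq: "M z = M z'"
  have "cc z j = cc z' j" if j: "j \<in> J" for j
    using cc_M[OF j, of z] cc_M[OF j, of z'] eq gamma_nonzero[OF j] by simp
  then have "asm (cc z) = asm (cc z')" by (rule asm_cong)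
  then show "z = z'" by (simp only: asm_cc)
qed

lemma contraction: "norm (M z) \<le> \<theta> * norm z"
proof -
  have "(norm (\<gamma> j * cc z j))\<^sup>2 \<le> \<theta>\<^sup>2 * (norm (cc z j))\<^sup>2" if "j \<in> J" for j
    unfolding norm_mult power_mult_distrib using theta_props(3)[OF that]
    by (intro mult_right_mono power_mono) auto
  moreover have "(Re (\<gamma> j * cc z j))\<^sup>2 \<le> \<theta>\<^sup>2 * (Re (cc z j))\<^sup>2" if "j \<in> {e + 1..d - e - 1}" for j
  proof -
    have j: "j \<in> J" "\<not> j \<le> e" using that by auto
    have "Im (\<gamma> j * cc z j) = 0" using Im_gamma[OF j] Im_cc[OF j(2), of z] by simp
    then have "(Re (\<gamma> j * cc z j))\<^sup>2 = (norm (\<gamma> j * cc z j))\<^sup>2" by (simp add: cmod_power2)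
    moreover have "(Re (cc z j))\<^sup>2 = (norm (cc z j))\<^sup>2" using Im_cc[OF j(2), of z] by (simp add: cmod_power2)
    moreover have "(norm (\<gamma> j * cc z j))\<^sup>2 \<le> \<theta>\<^sup>2 * (norm (cc z j))\<^sup>2"
      unfolding norm_mult power_mult_distrib using theta_props(3)[OF j(1)]
      by (intro mult_right_mono power_mono) auto
    ultimately show ?thesis by simp
  qed
  ultimately have "(norm (M z))\<^sup>2 \<le> \<theta>\<^sup>2 * (norm (asm (cc z)))\<^sup>2"
    unfolding M_def norm_asm distrib_left sum_distrib_left using e_less
    by (intro add_mono sum_mono) auto
  then have "(norm (M z))\<^sup>2 \<le> (\<theta> * norm z)\<^sup>2" unfolding asm_cc power_mult_distrib .
  then show ?thesis by (rule power2_le_imp_le) (use theta_props in simp)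
qed

lemma Phi_add: "x \<in> Z\<beta> \<Longrightarrow> y \<in> Z\<beta> \<Longrightarrow> \<Phi> (x + y) = \<Phi> x + \<Phi> y"
  unfolding embed_eq_asm asm_add[symmetric] by (rule asm_cong) (rule sigma_add)

lemma Im_sigma: assumes "j \<in> J" "\<not> j \<le> e" "x \<in> Z\<beta>" shows "Im (\<sigma> j x) = 0"
proof -
  obtain c where c: "x = ival c" using Z_ival[OF assms(3)] by auto
  have "\<gamma> j \<in> \<real>" using gamma_real[of j] assms by auto
  then have "\<sigma> j x \<in> \<real>" unfolding c sigma_ival[OF assms(1)] by (intro sum_in_Reals Reals_mult Reals_power Reals_divide) auto
  then show ?thesis by (simp add: complex_is_Real_iff)
qed

lemma cc_Phi: "j \<in> J \<Longrightarrow> x \<in> Z\<beta> \<Longrightarrow> cc (\<Phi> x) j = \<sigma> j x"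
  unfolding embed_eq_asm by (rule cc_asm) (use Im_sigma in auto)

lemma Phi_beta: "x \<in> Z\<beta> \<Longrightarrow> \<Phi> (\<beta> * x) = M (\<Phi> x)"
  unfolding M_def embed_eq_asm[of "\<beta> * x"]
  by (rule asm_cong) (simp add: cc_Phi sigma_mult sigma_beta)

section \<open>The lattice formed by the ring\<close>

definition coord :: "real \<times> (real ^ 'n) \<Rightarrow> nat \<Rightarrow> real" where
  "coord p i = (if i = d then fst p else snd p $ \<kappa> i)"

definition uncoord :: "(nat \<Rightarrow> real) \<Rightarrow> real \<times> (real ^ 'n)" where
  "uncoord b = (b d, \<chi> i. b (\<iota> i))"

text \<open>Real-linear extension of c -> (ival c, \<Phi> (ival c)), with R x R^(d-1) also serving
  as the space of the d coordinates, index d in the first slot. Since source and target agree,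
  injectivity alone turns the integer vectors into a lattice.\<close>

definition L :: "real \<times> (real ^ 'n) \<Rightarrow> real \<times> (real ^ 'n)" where
  "L p = ((\<Sum>i\<in>{1..d}. coord p i * (1/\<beta>) ^ i),
     asm (\<lambda>j. \<Sum>i\<in>{1..d}. of_real (coord p i) * (1 / \<gamma> j) ^ i))"

lemma coord_uncoord: "i \<in> {1..d} \<Longrightarrow> coord (uncoord b) i = b i"
  unfolding coord_def uncoord_def using iota_kappa[of i] by auto

lemma L_uncoord_ival: "L (uncoord (\<lambda>i. of_int (c i))) = (ival c, \<Phi> (ival c))"
proof -
  have "(\<Sum>i\<in>{1..d}. of_real (coord (uncoord (\<lambda>i. of_int (c i))) i) * (1 / \<gamma> j) ^ i) = \<sigma> j (ival c)"
    if "j \<in> J" for j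
    unfolding sigma_ival[OF that] by (intro sum.cong refl) (simp only: coord_uncoord of_real_of_int_eq)
  then show ?thesis unfolding L_def embed_eq_asm ival_def[of c]
    by (auto simp: coord_uncoord intro!: asm_cong)
qed

lemma linear_L: "linear L"
proof (rule linearI)
  have c1: "coord (p + q) i = coord p i + coord q i" for p q i unfolding coord_def by simp
  have c2: "coord (r *\<^sub>R p) i = r * coord p i" for r p i unfolding coord_def by simp
  show "L (p + q) = L p + L q" for p q
    unfolding L_def c1 by (simp add: asm_add[symmetric] distrib_right sum.distrib)
  show "L (r *\<^sub>R p) = r *\<^sub>R L p" for r p
    unfolding L_def c2 scaleR_Pair asm_scaleR[symmetric] scaleR_sum_right
    by (simp add: scaleR_conv_of_real mult.assoc sum_distrib_left)
qed

text \<open>The count is 1 + (d - e - 1) + e.\<close>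

lemma roots_card: "card (insert (of_real \<beta>) (\<gamma> ` J \<union> cnj ` \<gamma> ` {1..e})) = d"
proof -
  have sub: "{1..e} \<subseteq> J" using e_less by auto
  have "cnj ` \<gamma> ` {1..e} \<inter> \<gamma> ` J = {}"
  proof -
    have "cnj (\<gamma> i) \<noteq> \<gamma> j" if "i \<in> {1..e}" "j \<in> J" for i j
      using that(2)
    proof (cases rule: J_cases)
      case 1 then show ?thesis using gamma_cnj_disjoint that(1) by blast
    next
      case 2
      then have "\<gamma> j \<in> \<real>" using gamma_real by simp
      moreover have "cnj (\<gamma> i) \<notin> \<real>" using gamma_nonreal[OF that(1)] by (simp add: complex_is_Real_iff)
      ultimately show ?thesis by auto
    qed
    then show ?thesis by fastforce
  qed
  then have "card (\<gamma> ` J \<union> cnj ` \<gamma> ` {1..e}) = card (\<gamma> ` J) + card (cnj ` \<gamma> ` {1..e})"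
    by (intro card_Un_disjoint) auto
  also have "card (\<gamma> ` J) = d - e - 1" using gamma_inj by (simp add: card_image)
  also have "card (cnj ` \<gamma> ` {1..e}) = card (\<gamma> ` {1..e})" by (intro card_image) (auto simp: inj_on_def)
  also have "\<dots> = e" using inj_on_subset[OF gamma_inj sub] by (simp add: card_image)
  finally have c: "card (\<gamma> ` J \<union> cnj ` \<gamma> ` {1..e}) = d - 1" using e_less by simp
  have "of_real \<beta> \<notin> \<gamma> ` J" using gamma_ne_beta by force
  moreover have "of_real \<beta> \<notin> cnj ` \<gamma> ` {1..e}"
    using gamma_nonreal by (force simp: complex_is_Real_iff complex_eq_iff)
  ultimately show ?thesis using c d_ge by simp
qed

text \<open>A vector in the kernel is the coefficient list of a real polynomial of degree at most d
  - 1 that vanishes at d distinct numbers.\<close>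

lemma inj_L: "inj L"
proof -
  have "p = 0" if Lp: "L p = 0" for p
  proof -
    define b where "b = coord p"
    define P :: "complex poly" where "P = (\<Sum>i\<in>{1..d}. monom (of_real (b i)) (d - i))"
    have polyP: "poly P z = z ^ d * (\<Sum>i\<in>{1..d}. of_real (b i) * (1 / z) ^ i)" if "z \<noteq> 0" for z
      unfolding P_def poly_sum poly_monom sum_distrib_left
      by (intro sum.cong refl) (use that in \<open>auto simp: power_diff power_one_over field_simps\<close>)
    have "(\<Sum>i\<in>{1..d}. b i * (1/\<beta>) ^ i) = 0" using Lp unfolding L_def b_def by (simp add: zero_prod_def)
    then have "complex_of_real (\<Sum>i\<in>{1..d}. b i * (1/\<beta>) ^ i) = 0" by (simp only: of_real_0)
    then have r1: "poly P (of_real \<beta>) = 0" using polyP[of "of_real \<beta>"] beta_pos by simp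
    have r2: "poly P (\<gamma> j) = 0" if j: "j \<in> J" for j
    proof -
      let ?u = "\<lambda>j. \<Sum>i\<in>{1..d}. of_real (b i) * (1 / \<gamma> j) ^ i"
      have "asm ?u = 0" using Lp unfolding L_def b_def by (simp add: zero_prod_def)
      moreover have "cc (asm ?u) j = ?u j"
      proof (rule cc_asm[OF j])
        show "j \<le> e \<or> Im (?u j) = 0"
        proof (cases "j \<le> e")
          case False
          then have "\<gamma> j \<in> \<real>" using gamma_real[of j] j by auto
          then have "?u j \<in> \<real>" by (intro sum_in_Reals Reals_mult Reals_power Reals_divide) auto
          then show ?thesis by (simp only: complex_is_Real_iff) simp
        qed simp
      qed
      moreover have "cc 0 j = 0" unfolding cc_def by (simp add: complex_eq_iff)
      ultimately have "?u j = 0" by simp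
      then show ?thesis using polyP[OF gamma_nonzero[OF j]] by simp
    qed
    \<comment> \<open>Real coefficients supply the roots that are complex conjugate to the listed
      ones.\<close>
    have r3: "poly P (cnj z) = 0" if "poly P z = 0" for z
    proof -
      have "map_poly cnj P = P" unfolding P_def
        by (intro poly_eqI) (auto simp: coeff_map_poly coeff_sum intro!: sum.cong)
      then show ?thesis using poly_cnj[of P z] that by simp
    qed
    have deg: "degree P \<le> d - 1" unfolding P_def
      by (intro degree_sum_le) (auto intro: order_trans[OF degree_monom_le])
    have "P = 0"
    proof (rule ccontr)
      assume "P \<noteq> 0"
      have "insert (of_real \<beta>) (\<gamma> ` J \<union> cnj ` \<gamma> ` {1..e}) \<subseteq> {z. poly P z = 0}"
      proof -
        have "{1..e} \<subseteq> J" using e_less by auto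
        then show ?thesis using r1 r2 r3 by blast
      qed
      then have "card (insert (of_real \<beta>) (\<gamma> ` J \<union> cnj ` \<gamma> ` {1..e})) \<le> card {z. poly P z = 0}"
        using \<open>P \<noteq> 0\<close> by (intro card_mono poly_roots_finite)
      also have "\<dots> \<le> degree P" by (rule card_poly_roots_bound[OF \<open>P \<noteq> 0\<close>])
      finally show False using deg d_ge unfolding roots_card by simp
    qed
    have b0: "b i = 0" if i: "i \<in> {1..d}" for i
    proof -
      have "coeff P (d - i) = (\<Sum>k\<in>{1..d}. if k = i then of_real (b k) else 0)"
        unfolding P_def coeff_sum coeff_monom using i by (intro sum.cong) auto
      also have "\<dots> = of_real (b i)" using i by simp
      finally show ?thesis using \<open>P = 0\<close> by simp
    qed
    have "fst p = 0" using b0[of d] d_ge unfolding b_def coord_def by simp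
    moreover have "snd p $ i = 0" for i
    proof -
      have "\<iota> i \<in> {1..d}" "\<iota> i \<noteq> d" using iota_range[of i] d_ge by auto
      then show ?thesis using b0[of "\<iota> i"] unfolding b_def coord_def by (simp add: kappa_iota)
    qed
    ultimately show "p = 0" by (simp add: prod_eq_iff vec_eq_iff)
  qed
  then show ?thesis using linear_injective_0[OF linear_L] by blast
qed

text \<open>Linear independence over \<int>: the value of \<Phi> depends only on the number
  \<open>ival c\<close>, so \<open>L\<close> also vanishes at the coordinate vector of c.\<close>

lemma ival_eq_0: assumes "ival c = 0" "i \<in> {1..d}" shows "c i = 0"
proof -
  have "\<Phi> (0 :: real) = 0" using Phi_add[of 0 0] by simp
  then have "L (uncoord (\<lambda>i. of_int (c i))) = L 0"
    unfolding L_uncoord_ival assms(1) using linear_0[OF linear_L] by (simp add: zero_prod_def)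
  then have "uncoord (\<lambda>i. of_int (c i)) = 0" using inj_L by (rule injD[rotated])
  then have "coord (uncoord (\<lambda>i. of_int (c i))) i = coord 0 i" by (simp only:)
  then show ?thesis unfolding coord_uncoord[OF assms(2)] by (simp add: coord_def split: if_splits)
qed

lemma abs_coord_le: "\<bar>coord p i\<bar> \<le> norm p"
  unfolding coord_def using norm_fst_le[of "fst p" "snd p"] norm_snd_le[of "snd p" "fst p"]
    component_le_norm_cart[of "snd p" "\<kappa> i"] by auto

lemma discrete: "finite {x \<in> Z\<beta>. \<bar>x\<bar> \<le> a \<and> norm (\<Phi> x) \<le> b}"
proof -
  obtain B where B: "B > 0" "\<And>p. B * norm p \<le> norm (L p)"
    using linear_inj_bounded_below_pos[OF linear_L inj_L] by blast
  define N where "N = \<lceil>(a + b) / B\<rceil>"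
  have "{x \<in> Z\<beta>. \<bar>x\<bar> \<le> a \<and> norm (\<Phi> x) \<le> b} \<subseteq> ival ` (\<Pi>\<^sub>E i\<in>{1..d}. {-N..N})"
  proof
    fix x assume "x \<in> {x \<in> Z\<beta>. \<bar>x\<bar> \<le> a \<and> norm (\<Phi> x) \<le> b}"
    then have x: "x \<in> Z\<beta>" "\<bar>x\<bar> \<le> a" "norm (\<Phi> x) \<le> b" by auto
    obtain c where c: "x = ival c" using Z_ival[OF x(1)] by auto
    let ?p = "uncoord (\<lambda>i. of_int (c i))"
    have "B * norm ?p \<le> norm (x, \<Phi> x)" using B(2)[of ?p] unfolding L_uncoord_ival c .
    also have "\<dots> \<le> norm x + norm (\<Phi> x)" by (rule norm_Pair_le)
    also have "\<dots> \<le> a + b" using x by simp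
    finally have p: "norm ?p \<le> (a + b) / B" using B(1) by (simp add: le_divide_eq mult.commute)
    have "c i \<in> {-N..N}" if i: "i \<in> {1..d}" for i
    proof -
      have "\<bar>real_of_int (c i)\<bar> \<le> (a + b) / B"
        using abs_coord_le[of ?p i] p unfolding coord_uncoord[OF i] by simp
      also have "\<dots> \<le> of_int N" unfolding N_def by (rule le_of_int_ceiling)
      finally have "\<bar>c i\<bar> \<le> N" by (simp flip: of_int_abs)
      then show ?thesis by auto
    qed
    then have "restrict c {1..d} \<in> (\<Pi>\<^sub>E i\<in>{1..d}. {-N..N})" by auto
    moreover have "x = ival (restrict c {1..d})" unfolding c ival_def by (intro sum.cong) auto
    ultimately show "x \<in> ival ` (\<Pi>\<^sub>E i\<in>{1..d}. {-N..N})" by blast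
  qed
  then show ?thesis by (rule finite_subset) (intro finite_imageI finite_PiE; simp)
qed

text \<open>Rounding the coordinates of the preimage of (t, z) under \<open>L\<close> changes each
  of them by at most 1.\<close>

lemma relatively_dense: "\<exists>K. \<forall>t z. \<exists>x\<in>Z\<beta>. \<bar>x - t\<bar> \<le> K \<and> norm (\<Phi> x - z) \<le> K"
proof -
  have "surj L" using linear_inj_imp_surj[OF linear_L inj_L] .
  obtain B where B: "B > 0" "\<And>p. norm (L p) \<le> B * norm p" using linear_bounded_pos[OF linear_L] by blast
  define K where "K = B * (1 + real CARD('n))"
  have "\<exists>x\<in>Z\<beta>. \<bar>x - t\<bar> \<le> K \<and> norm (\<Phi> x - z) \<le> K" for t z
  proof -
    obtain p where p: "L p = (t, z)" using \<open>surj L\<close> by (metis surjD)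
    define c where "c i = round (coord p i)" for i
    let ?q = "uncoord (\<lambda>i. of_int (c i))"
    have le1: "\<bar>of_int (c i) - coord p i\<bar> \<le> 1" for i
      unfolding c_def using of_int_round_abs_le[of "coord p i"] by linarith
    have "norm (fst (?q - p)) \<le> 1" using le1[of d] unfolding uncoord_def by (simp add: coord_def)
    moreover have "norm (snd (?q - p)) \<le> (\<Sum>i\<in>UNIV. \<bar>snd (?q - p) $ i\<bar>)" by (rule norm_le_l1_cart)
    moreover have "(\<Sum>i\<in>UNIV. \<bar>snd (?q - p) $ i\<bar>) \<le> (\<Sum>i\<in>(UNIV :: 'n set). 1)"
    proof (rule sum_mono)
      fix i
      have "\<iota> i \<noteq> d" using iota_range[of i] d_ge by auto
      then show "\<bar>snd (?q - p) $ i\<bar> \<le> 1" using le1[of "\<iota> i"] unfolding uncoord_def coord_def by (simp add: kappa_iota)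
    qed
    moreover have "norm (?q - p) \<le> norm (fst (?q - p)) + norm (snd (?q - p))"
      using norm_Pair_le[of "fst (?q - p)" "snd (?q - p)"] by (simp only: prod.collapse)
    ultimately have "norm (?q - p) \<le> 1 + real CARD('n)" by simp
    then have "norm (L (?q - p)) \<le> K" unfolding K_def using B by (meson mult_left_mono order_trans less_imp_le)
    moreover have "L (?q - p) = (ival c - t, \<Phi> (ival c) - z)"
      unfolding linear_diff[OF linear_L] L_uncoord_ival p by simp
    ultimately have "norm (ival c - t, \<Phi> (ival c) - z) \<le> K" by simp
    then have "norm (ival c - t) \<le> K" "norm (\<Phi> (ival c) - z) \<le> K"
      using norm_fst_le[of "ival c - t" "\<Phi> (ival c) - z"] norm_snd_le[of "\<Phi> (ival c) - z" "ival c - t"]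
      by (auto intro: order_trans)
    then show ?thesis using ival_in_Z[of c] by auto
  qed
  then show ?thesis by blast
qed

sublocale bonacci_embedding d \<beta> \<Phi> M \<theta>
  by (intro bonacci_embedding.intro bonacci_embedding_axioms.intro bonacci_axioms Phi_add Phi_beta
      linear_M inj_M contraction theta_props(1,2) discrete relatively_dense)

end

section \<open>The layers\<close>

lemma multiple_tiling_reindex:
  assumes mt: "multiple_tiling m I R" and g: "bij_betw g K I" and R': "\<And>k. k \<in> K \<Longrightarrow> R' k = R (g k)"
  shows "multiple_tiling m K R'"
proof -
  have sub: "g ` {k \<in> K. P (R' k)} = {i \<in> I. P (R i)}" for P
    using g R' unfolding bij_betw_def by auto
  have inj: "inj_on g {k \<in> K. P (R' k)}" for P
    using g unfolding bij_betw_def by (auto intro: inj_on_subset)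
  have card_eq: "card {k \<in> K. P (R' k)} = card {i \<in> I. P (R i)}" for P
    using card_image[OF inj[of P]] sub[of P] by simp
  have fin_eq: "finite {k \<in> K. P (R' k)} \<longleftrightarrow> finite {i \<in> I. P (R i)}" for P
    using finite_image_iff[OF inj[of P]] sub[of P] by simp
  have gI: "g k \<in> I" if "k \<in> K" for k using g that unfolding bij_betw_def by auto
  have UN: "(\<Union>k\<in>K. R' k) = (\<Union>i\<in>I. R i)" using g R' unfolding bij_betw_def by auto
  show ?thesis
    using mt unfolding multiple_tiling_def UN
      card_eq[of "\<lambda>S. z \<in> S" for z] fin_eq[of "\<lambda>S. S \<inter> U \<noteq> {}" for U]
    by (auto simp: R' gI)
qed

context bonacci_embedding begin

lemma multiple_tiling_Rt:
  assumes "I \<subseteq> X \<inter> Z\<beta>" "\<And>z. \<exists>v\<in>I. z \<in> Rt v" "AE z in lborel. card {v \<in> I. z \<in> Rt v} = m"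
  shows "multiple_tiling m I Rt"
  unfolding multiple_tiling_def
proof (intro conjI)
  show "\<exists>\<S>. finite \<S> \<and> (\<forall>v\<in>I. \<exists>S\<in>\<S>. \<exists>t. Rt v = (\<lambda>s. t + s) ` S)"
    using Rt_finitely_many_shapes assms(1) by (meson subsetD)
  show "\<forall>z. \<exists>U. open U \<and> z \<in> U \<and> finite {v \<in> I. Rt v \<inter> U \<noteq> {}}"
  proof
    fix z
    have "finite {v \<in> I. Rt v \<inter> ball z 1 \<noteq> {}}"
      by (rule finite_subset[OF _ Rt_locally_finite[of z 1]]) (use assms(1) in blast)
    then show "\<exists>U. open U \<and> z \<in> U \<and> finite {v \<in> I. Rt v \<inter> U \<noteq> {}}"
      by (intro exI[of _ "ball z 1"]) simp
  qed
  show "(\<Union>v\<in>I. Rt v) = UNIV" using assms(2) by blast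
  show "\<forall>v\<in>I. Rt v = closure (interior (Rt v))" using Rt_closure_interior assms(1) by blast
  show "AE z in lborel. card {v \<in> I. z \<in> Rt v} = m" by (rule assms(3))
qed

lemma tiling_cls: "multiple_tiling 1 (cls j) Rt"
proof (rule multiple_tiling_Rt)
  show "cls j \<subseteq> X \<inter> Z\<beta>" using clsD(1,2) by (intro subsetI IntI)
qed (rule cls_covers AE_exactly_one)+

end

section \<open>Separation of the classes and identification of the layers\<close>

context bonacci_conjugates begin

text \<open>Compare coordinates in j = \<beta> z - z and add the d equations: the shifted
  coefficients cancel and d j = (d - 1) c(1) remains. With \<open>d_minus_1_in_Lam\<close> the ring
  has exactly d - 1 classes modulo the ideal.\<close>

lemma of_int_in_Lam:
  assumes "of_int j \<in> \<Lambda>"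
  shows "(int d - 1) dvd j"
proof -
  obtain z where z: "z \<in> Z\<beta>" "of_int j = (\<beta> - 1) * z" using assms unfolding \<Lambda>_def by auto
  obtain c where c: "z = ival c" using Z_ival[OF z(1)] by auto
  define c' where "c' i = c 1 + (if i = d then 0 else c (Suc i))" for i
  have "ival (\<lambda>i. c i + (j - c' i)) = ival c + (ival (\<lambda>_. j) - ival c')"
    unfolding ival_def sum_subtractf[symmetric] sum.distrib[symmetric] by (simp add: algebra_simps)
  also have "ival c' = \<beta> * ival c" unfolding beta_ival c'_def ..
  also have "ival c + (ival (\<lambda>_. j) - \<beta> * ival c) = 0"
    unfolding ival_const using z(2) c by (simp add: algebra_simps)
  finally have "c i + (j - c' i) = 0" if "i \<in> {1..d}" for i using ival_eq_0[OF _ that] by blast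
  then have "j = c' i - c i" if "i \<in> {1..d}" for i using that by fastforce
  then have "(\<Sum>i\<in>{1..d}. j) = (\<Sum>i\<in>{1..d}. c' i - c i)" by (intro sum.cong) auto
  then have dj: "int d * j = (\<Sum>i\<in>{1..d}. c' i) - (\<Sum>i\<in>{1..d}. c i)" by (simp add: sum_subtractf)
  have "(\<Sum>i\<in>{1..d}. c' i) = int d * c 1 + (\<Sum>i\<in>{1..d}. if i = d then 0 else c (Suc i))"
    unfolding c'_def sum.distrib by simp
  also have "(\<Sum>i\<in>{1..d}. if i = d then 0 else c (Suc i)) = (\<Sum>i\<in>{1..d - 1}. c (Suc i))"
    by (rule sum.mono_neutral_cong_right) auto
  also have "\<dots> = (\<Sum>i\<in>{2..d}. c i)"
    by (rule sum.reindex_bij_witness[of _ "\<lambda>i. i - 1" Suc]) auto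
  finally have 1: "(\<Sum>i\<in>{1..d}. c' i) = int d * c 1 + (\<Sum>i\<in>{2..d}. c i)" .
  have "{1..d} = insert 1 {2..d}" using d_ge by auto
  then have 2: "(\<Sum>i\<in>{1..d}. c i) = c 1 + (\<Sum>i\<in>{2..d}. c i)" by simp
  have "j = (int d - 1) * (c 1 - j)" using dj unfolding 1 2 by (simp add: algebra_simps)
  then show ?thesis by (rule dvdI)
qed

lemma cls_disjoint:
  assumes "h \<in> {1..d - 1}" "h' \<in> {1..d - 1}" "h \<noteq> h'"
  shows "cls (int h) \<inter> cls (int h') = {}"
proof -
  have False if "v \<in> cls (int h)" "v \<in> cls (int h')" for v
  proof -
    have "(v - of_int (int h)) - (v - of_int (int h')) \<in> \<Lambda>"
      using clsD(3)[OF that(1)] clsD(3)[OF that(2)] by (rule Lam_diff)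
    then have "of_int (int h' - int h) \<in> \<Lambda>" by simp
    then have "(int d - 1) dvd (int h' - int h)" by (rule of_int_in_Lam)
    moreover have "int h' - int h \<noteq> 0" using assms by simp
    ultimately have "int d - 1 \<le> \<bar>int h' - int h\<bar>"
      using dvd_imp_le_int[of "int h' - int h" "int d - 1"] d_ge by simp
    then show False using assms d_ge by auto
  qed
  then show ?thesis by blast
qed

lemma X_Z_eq: "X \<inter> Z\<beta> = (\<Union>h\<in>{1..d - 1}. cls (int h))"
proof (intro equalityI subsetI)
  fix v assume v: "v \<in> X \<inter> Z\<beta>"
  then obtain h where "h \<in> {1..d - 1}" "v - of_int (int h) \<in> \<Lambda>" using Z_class by blast
  then show "v \<in> (\<Union>h\<in>{1..d - 1}. cls (int h))" using v by (intro UN_I clsI) auto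
next
  fix v assume "v \<in> (\<Union>h\<in>{1..d - 1}. cls (int h))"
  then obtain h where "v \<in> cls (int h)" by blast
  from clsD(1,2)[OF this] show "v \<in> X \<inter> Z\<beta>" by blast
qed

lemma multiple_tiling_all: "multiple_tiling (d - 1) (X \<inter> Z\<beta>) Rt"
proof (rule multiple_tiling_Rt)
  show "\<exists>v\<in>X \<inter> Z\<beta>. z \<in> Rt v" for z 
  proof -
    obtain v where v: "v \<in> cls 1" "z \<in> Rt v" using cls_covers by blast
    then show ?thesis using clsD(1,2)[OF v(1)] by blast
  qed
  have "AE z in lborel. \<forall>h\<in>{1..d - 1}. card {v \<in> cls (int h). z \<in> Rt v} = 1"
    using AE_exactly_one by (intro AE_finite_allI) auto
  then show "AE z in lborel. card {v \<in> X \<inter> Z\<beta>. z \<in> Rt v} = d - 1"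
  proof (rule AE_mp, intro AE_I2 impI)
    fix z assume one: "\<forall>h\<in>{1..d - 1}. card {v \<in> cls (int h). z \<in> Rt v} = 1"
    have "{v \<in> X \<inter> Z\<beta>. z \<in> Rt v} = (\<Union>h\<in>{1..d - 1}. {v \<in> cls (int h). z \<in> Rt v})"
      unfolding X_Z_eq by blast
    also have "card \<dots> = (\<Sum>h\<in>{1..d - 1}. card {v \<in> cls (int h). z \<in> Rt v})"
    proof (rule card_UN_disjoint)
      show "\<forall>h\<in>{1..d - 1}. finite {v \<in> cls (int h). z \<in> Rt v}"
        using one by (metis card.infinite zero_neq_one)
      show "\<forall>h\<in>{1..d - 1}. \<forall>h'\<in>{1..d - 1}. h \<noteq> h' \<longrightarrow>
          {v \<in> cls (int h). z \<in> Rt v} \<inter> {v \<in> cls (int h'). z \<in> Rt v} = {}"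
        using cls_disjoint by blast
    qed simp
    also have "\<dots> = d - 1" using one by simp
    finally show "card {v \<in> X \<inter> Z\<beta>. z \<in> Rt v} = d - 1" .
  qed
qed simp

lemma tile_eq_Rt:
  assumes "x \<in> Z\<beta> \<inter> XS \<beta>"
  shows "tile \<beta> e \<sigma> \<iota> x = Rt (lift x)"
  unfolding tile_def using assms by (intro hausdorff_lim_Rt) auto

lemma bij_lift_all: "bij_betw lift (Z\<beta> \<inter> XS \<beta>) (X \<inter> Z\<beta>)"
proof (rule bij_betwI')
  show "lift x = lift y \<longleftrightarrow> x = y" if "x \<in> Z\<beta> \<inter> XS \<beta>" "y \<in> Z\<beta> \<inter> XS \<beta>" for x y
    using that inj_onD[OF bij_betw_imp_inj_on[OF lift_bij]] by blast
  show "lift x \<in> X \<inter> Z\<beta>" if "x \<in> Z\<beta> \<inter> XS \<beta>" for x using that lift_in_X lift_in_Z_iff by blast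
  show "\<exists>x\<in>Z\<beta> \<inter> XS \<beta>. v = lift x" if v: "v \<in> X \<inter> Z\<beta>" for v
  proof -
    obtain x where "x \<in> XS \<beta>" "v = lift x" using lift_bij v unfolding bij_betw_def by blast
    then show ?thesis using v lift_in_Z_iff by blast
  qed
qed

text \<open>Lifting adds 1 to the negative points, and h - d + 1 differs from h by d - 1, an element
  of the ideal. This explains the residue h - d in the layer.\<close>

lemma layer_index_iff: "x \<in> layer_index d \<beta> h \<longleftrightarrow> x \<in> XS \<beta> \<and> lift x \<in> cls (int h)"
proof -
  have pos: "lift x = x" if "x \<in> XS_pos \<beta>"
    using that beta_less_2 unfolding XS_pos_def lift_def by auto
  have neg: "lift x = x + 1" if "x \<in> XS_neg \<beta>"
    using that beta_less_2 unfolding XS_neg_def lift_def by auto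
  have sh: "x \<in> residue_class \<beta> (int h - int d) \<longleftrightarrow> x + 1 \<in> residue_class \<beta> (int h)"
  proof -
    have eq: "x - of_int (int h - int d) = (x + 1 - of_int (int h)) + (real d - 1)" by simp
    have eq': "x + 1 - of_int (int h) = (x - of_int (int h - int d)) - (real d - 1)" by simp
    show ?thesis unfolding residue_class_iff
      using Lam_add[OF _ d_minus_1_in_Lam] Lam_diff[OF _ d_minus_1_in_Lam] eq eq' by metis
  qed
  show ?thesis
    unfolding layer_index_def cls_def
    using pos neg sh lift_in_X[of x] unfolding XS_def by auto
qed

lemma bij_lift_layer: "bij_betw lift (layer_index d \<beta> h) (cls (int h))"
proof (rule bij_betwI')
  show "lift x = lift y \<longleftrightarrow> x = y" if "x \<in> layer_index d \<beta> h" "y \<in> layer_index d \<beta> h" for x y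
    using that inj_onD[OF bij_betw_imp_inj_on[OF lift_bij]] unfolding layer_index_iff by blast
  show "lift x \<in> cls (int h)" if "x \<in> layer_index d \<beta> h" for x using that layer_index_iff by blast
  show "\<exists>x\<in>layer_index d \<beta> h. v = lift x" if v: "v \<in> cls (int h)" for v
  proof -
    obtain x where "x \<in> XS \<beta>" "v = lift x" using lift_bij clsD(1)[OF v] unfolding bij_betw_def by blast
    then show ?thesis using v layer_index_iff by blast
  qed
qed

lemma layer_index_subset: "layer_index d \<beta> h \<subseteq> Z\<beta> \<inter> XS \<beta>"
proof
  fix x assume "x \<in> layer_index d \<beta> h"
  then have "x \<in> XS \<beta>" and l: "lift x \<in> cls (int h)" unfolding layer_index_iff by auto
  then show "x \<in> Z\<beta> \<inter> XS \<beta>" using clsD(2)[OF l] lift_in_Z_iff by simp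
qed

lemma tiling_layer: "tiling (layer_index d \<beta> h) (tile \<beta> e \<sigma> \<iota>)"
  unfolding tiling_def
proof (rule multiple_tiling_reindex[OF tiling_cls bij_lift_layer])
  show "tile \<beta> e \<sigma> \<iota> x = Rt (lift x)" if "x \<in> layer_index d \<beta> h" for x
    using tile_eq_Rt layer_index_subset that by blast
qed

lemma multiple_tiling_tiles: "multiple_tiling (d - 1) (Z\<beta> \<inter> XS \<beta>) (tile \<beta> e \<sigma> \<iota>)"
  by (rule multiple_tiling_reindex[OF multiple_tiling_all bij_lift_all]) (rule tile_eq_Rt)

end

theorem theorem2:
  fixes d e h :: nat and \<beta> :: real
    and \<gamma> :: "nat \<Rightarrow> complex" and \<sigma> :: "nat \<Rightarrow> real \<Rightarrow> complex"
    and \<iota> :: "'n::finite \<Rightarrow> nat"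
  assumes "d \<ge> 3"
    and "dBonacci d \<beta>"
    and "h \<in> {1..d - 1}"
    and "conjugate_enumeration d \<beta> e \<gamma>"
    and "\<And>j. j \<in> {1..d - e - 1} \<Longrightarrow>
           field_iso_on (rat_field_adjoin \<beta>) (rat_field_adjoin (\<gamma> j)) (\<sigma> j) \<and> \<sigma> j \<beta> = \<gamma> j"
    and "bij_betw \<iota> (UNIV :: 'n set) {1..d - 1}"
  shows "tiling (layer_index d \<beta> h) (tile \<beta> e \<sigma> \<iota>)
    \<and> layer_index d \<beta> h \<subseteq> int_adjoin \<beta> \<inter> XS \<beta>
    \<and> multiple_tiling (d - 1) (int_adjoin \<beta> \<inter> XS \<beta>) (tile \<beta> e \<sigma> \<iota>)"
proof -
  interpret bonacci_conjugates d \<beta> e \<gamma> \<sigma> \<iota>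
    using assms(1,2,4,6) assms(5)
    by (intro bonacci_conjugates.intro bonacci.intro bonacci_conjugates_axioms.intro)
  show ?thesis using tiling_layer layer_index_subset multiple_tiling_tiles by blast
qed

end
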